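(* Let $\mu,\sigma_0,a,\rho>0$ be fixed with $\rho>\mu+\sigma_0^2/2$. For $\lambda>0$, consider the optimal stopping problem described in the context with $\sigma=\sigma_0\sqrt{\lambda}$, and let $g_\lambda(y,s)$ be its value function and $u_-(\lambda)$ its threshold in state $-1$. For $\lambda\neq\mu^2/\sigma_0^2$ set $$\Omega_\pm(\lambda)=\frac{(\lambda+\rho)\mu\pm\sqrt{\lambda^2\mu^2+\lambda\sigma_0^2(\rho^2+2\lambda\rho)}}{\mu^2-\lambda\sigma_0^2},\qquad \omega_\pm(\lambda)=1+\frac{\rho}{\lambda}-\frac{\mu+\sigma_0\sqrt\lambda}{\lambda}\Omega_\pm(\lambda),$$ and let $$\Omega_0=\frac{-\mu+\sqrt{\mu^2+2\rho\sigma_0^2}}{\sigma_0^2},\qquad u=a\frac{\Omega_0}{\Omega_0-1},\qquad g(y)=\begin{cases}(u-a)\left[\dfrac{y}{u}\right]^{\Omega_0},&0\le y\le u,\\ y-a,&y\ge u.\end{cases}$$ Then $$\lim_{\lambda\to+\infty}\Omega_-(\lambda)=\Omega_0,\qquad \lim_{\lambda\to+\infty}\omega_\pm(\lambda)=1,\qquad \lim_{\lambda\to+\infty}u_-(\lambda)=u,$$ and for every $y\ge 0$, $\displaystyle\lim_{\lambda\to+\infty}g_\lambda(y,\pm1)=g(y)$.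
   Context: Optimal stopping problem with parameters $\lambda,\mu,\sigma,a,\rho>0$: let $(\xi(t),t\ge 0)$ be the continuous-time Markov chain with (right-continuous) piecewise constant paths in $S=\{-1,+1\}$, which jumps from each state to the other at rate $\lambda$ (infinitesimal generator $\begin{pmatrix}-\lambda&\lambda\\ \lambda&-\lambda\end{pmatrix}$). For $Y_0\ge 0$, let $Y_t=Y_0\exp\left(\mu t+\sigma\int_0^t\xi(u)\,du\right)$, i.e. $dY_t/dt=(\mu+\sigma\xi(t))Y_t$. Let $(\mathcal F_t)$ be the completed natural filtration of $(\xi(t))$. $P_{y,s}$ and $E_{y,s}$ denote probability and expectation given $Y_0=y$, $\xi(0)=s$. The reward process is $X_t=e^{-\rho t}(Y_t-a)$ for $0\le t<\infty$, and $X_{+\infty}=0$. The value function is $\sup_\tau E_{y,s}(X_\tau)$, the supremum being over all $(\mathcal F_t)$-stopping times $\tau$ with values in $[0,\infty]$. If $\rho>\mu-\lambda+\sqrt{\sigma^2+\lambda^2}$ (which holds here), then for $s=\pm 1$ the set of $y\in[0,\infty)$ at which the value function in state $s$ equals $y-a$ is an interval $[u_s,+\infty)$ (possibly empty, with $u_s=+\infty$); $u_-=u_{-1}$. The numbers $u$ and function $g(y)$ in the claim are the known stopping threshold and value function of the analogous problem for the Stratonovich diffusion $dZ_t=Z_t(\mu\,dt+\sigma_0\,dW_t)$. *)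

theory Defs
  imports "HOL-Probability.Probability"
begin

subsection \<open>Continuous-time Markov chains on a finite state space\<close>

text \<open>Right-continuous piecewise constant paths on the half-line, with finitely many jumps in
  bounded time; the partition points \<open>T n\<close> need not be jump times.\<close>

definition step_path :: "(real \<Rightarrow> 's) \<Rightarrow> bool" where
  "step_path f \<longleftrightarrow> (\<exists>T :: nat \<Rightarrow> real. T 0 = 0 \<and> strict_mono T \<and> filterlim T at_top sequentially \<and>
     (\<forall>n. \<forall>t\<in>{T n..<T (Suc n)}. f t = f (T n)))"

definition transition_semigroup ::
  "'s set \<Rightarrow> ('s \<Rightarrow> 's \<Rightarrow> real) \<Rightarrow> (real \<Rightarrow> 's \<Rightarrow> 's \<Rightarrow> real) \<Rightarrow> bool" where
  "transition_semigroup S Q p \<longleftrightarrow>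
     (\<forall>t\<ge>0. \<forall>i\<in>S. (\<forall>j\<in>S. 0 \<le> p t i j) \<and> (\<Sum>j\<in>S. p t i j) = 1) \<and>
     (\<forall>i\<in>S. \<forall>j\<in>S. p 0 i j = (if i = j then 1 else 0)) \<and>
     (\<forall>t\<ge>0. \<forall>h\<ge>0. \<forall>i\<in>S. \<forall>j\<in>S. p (t + h) i j = (\<Sum>k\<in>S. p t i k * p h k j)) \<and>
     (\<forall>i\<in>S. \<forall>j\<in>S. ((\<lambda>t. p t i j) has_real_derivative Q i j) (at 0 within {0..}))"

text \<open>Filtrations are indexed by \<open>[0,\<infinity>]\<close>, so that the stopping times of the library, taken
  with time type \<^typ>\<open>ennreal\<close>, may take the value \<open>\<infinity>\<close>. The state space is discrete.\<close>

definition natural_filtration :: "'w measure \<Rightarrow> (real \<Rightarrow> 'w \<Rightarrow> 's) \<Rightarrow> ennreal \<Rightarrow> 'w measure" where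
  "natural_filtration M X t =
     sigma (space M) {X r -` A \<inter> space M | r A. 0 \<le> r \<and> ennreal r \<le> t}"

definition completed_natural_filtration ::
  "'w measure \<Rightarrow> (real \<Rightarrow> 'w \<Rightarrow> 's) \<Rightarrow> ennreal \<Rightarrow> 'w measure" where
  "completed_natural_filtration M X t =
     sigma (space M) (sets (natural_filtration M X t) \<union> null_sets (completion M))"

locale markov_chain = prob_space M
  for M :: "'w measure" +
  fixes S :: "'s set" and Q :: "'s \<Rightarrow> 's \<Rightarrow> real" and X :: "real \<Rightarrow> 'w \<Rightarrow> 's"
  assumes finite_states: "finite S"
    and measurable_process: "\<And>t. 0 \<le> t \<Longrightarrow> X t \<in> measurable M (count_space S)"
    and step_paths: "\<And>\<omega>. \<omega> \<in> space M \<Longrightarrow> step_path (\<lambda>t. X t \<omega>)"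
    and markov_property: "\<exists>p. transition_semigroup S Q p \<and>
      (\<forall>t\<ge>0. \<forall>h\<ge>0. \<forall>A\<in>sets (natural_filtration M X (ennreal t)). \<forall>i\<in>S. \<forall>j\<in>S.
         measure M {\<omega> \<in> A. X t \<omega> = i \<and> X (t + h) \<omega> = j} = measure M {\<omega> \<in> A. X t \<omega> = i} * p h i j)"

definition flip_generator :: "real \<Rightarrow> real \<Rightarrow> real \<Rightarrow> real" where
  "flip_generator lambda i j = (if i = j then - lambda else lambda)"

text \<open>The law \<open>P\<^sub>y\<^sub>,\<^sub>s\<close> is rendered by a realisation of the chain started at \<open>s\<close>;
  the deterministic value \<open>y\<close> only enters the price process.\<close>

definition telegraph_process :: "'w measure \<Rightarrow> real \<Rightarrow> real \<Rightarrow> (real \<Rightarrow> 'w \<Rightarrow> real) \<Rightarrow> bool" where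
  "telegraph_process M lambda s xi \<longleftrightarrow>
     markov_chain M {-1, 1} (flip_generator lambda) xi \<and> (AE \<omega> in M. xi 0 \<omega> = s)"


subsection \<open>The optimal stopping problem\<close>

definition price :: "(real \<Rightarrow> 'w \<Rightarrow> real) \<Rightarrow> real \<Rightarrow> real \<Rightarrow> real \<Rightarrow> real \<Rightarrow> 'w \<Rightarrow> real" where
  "price xi mu sig y t \<omega> = y * exp (mu * t + sig * integral {0..t} (\<lambda>r. xi r \<omega>))"

definition reward ::
  "(real \<Rightarrow> 'w \<Rightarrow> real) \<Rightarrow> real \<Rightarrow> real \<Rightarrow> real \<Rightarrow> real \<Rightarrow> real \<Rightarrow> ennreal \<Rightarrow> 'w \<Rightarrow> real" where
  "reward xi mu sig a rho y t \<omega> =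
     (if t = \<infinity> then 0
      else exp (- rho * enn2real t) * (price xi mu sig y (enn2real t) \<omega> - a))"

text \<open>Expectation with values in \<open>[-\<infinity>,\<infinity>]\<close>. The reward is bounded below by \<open>-a\<close>,
  so \<open>\<infinity> - \<infinity>\<close> does not arise below; non-integrable rewards get expectation \<open>\<infinity>\<close>.\<close>

definition ext_expectation :: "'w measure \<Rightarrow> ('w \<Rightarrow> real) \<Rightarrow> ereal" where
  "ext_expectation M f =
     enn2ereal (\<integral>\<^sup>+ \<omega>. ennreal (f \<omega>) \<partial>M) - enn2ereal (\<integral>\<^sup>+ \<omega>. ennreal (- f \<omega>) \<partial>M)"

definition value_function ::
  "'w measure \<Rightarrow> (real \<Rightarrow> 'w \<Rightarrow> real) \<Rightarrow> real \<Rightarrow> real \<Rightarrow> real \<Rightarrow> real \<Rightarrow> real \<Rightarrow> ereal" where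
  "value_function M xi mu sig a rho y =
     (SUP \<tau> \<in> {\<tau>. stopping_time (completed_natural_filtration M xi) \<tau>}.
        ext_expectation (completion M) (\<lambda>\<omega>. reward xi mu sig a rho y (\<tau> \<omega>) \<omega>))"

text \<open>Left endpoint of the stopping region; \<open>\<infinity>\<close> if the region is empty.\<close>

definition threshold ::
  "'w measure \<Rightarrow> (real \<Rightarrow> 'w \<Rightarrow> real) \<Rightarrow> real \<Rightarrow> real \<Rightarrow> real \<Rightarrow> real \<Rightarrow> ereal" where
  "threshold M xi mu sig a rho =
     Inf (ereal ` {y. 0 \<le> y \<and> value_function M xi mu sig a rho y = ereal (y - a)})"


subsection \<open>Explicit quantities\<close>

text \<open>The sign \<open>e \<in> {-1, 1}\<close> selects the lower or upper sign of \<open>\<plusminus>\<close>.\<close>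

definition Omega_pm :: "real \<Rightarrow> real \<Rightarrow> real \<Rightarrow> real \<Rightarrow> real \<Rightarrow> real" where
  "Omega_pm e mu sigma0 rho lambda =
     ((lambda + rho) * mu
        + e * sqrt (lambda\<^sup>2 * mu\<^sup>2 + lambda * sigma0\<^sup>2 * (rho\<^sup>2 + 2 * lambda * rho)))
     / (mu\<^sup>2 - lambda * sigma0\<^sup>2)"

definition omega_pm :: "real \<Rightarrow> real \<Rightarrow> real \<Rightarrow> real \<Rightarrow> real \<Rightarrow> real" where
  "omega_pm e mu sigma0 rho lambda =
     1 + rho / lambda - (mu + sigma0 * sqrt lambda) / lambda * Omega_pm e mu sigma0 rho lambda"

definition Omega0 :: "real \<Rightarrow> real \<Rightarrow> real \<Rightarrow> real" where
  "Omega0 mu sigma0 rho = (- mu + sqrt (mu\<^sup>2 + 2 * rho * sigma0\<^sup>2)) / sigma0\<^sup>2"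

definition limit_threshold :: "real \<Rightarrow> real \<Rightarrow> real \<Rightarrow> real \<Rightarrow> real" where
  "limit_threshold mu sigma0 a rho = a * (Omega0 mu sigma0 rho / (Omega0 mu sigma0 rho - 1))"

definition limit_value :: "real \<Rightarrow> real \<Rightarrow> real \<Rightarrow> real \<Rightarrow> real \<Rightarrow> real" where
  "limit_value mu sigma0 a rho y =
     (let u = limit_threshold mu sigma0 a rho
      in if y \<le> u then (u - a) * (y / u) powr Omega0 mu sigma0 rho else y - a)"

end

theory Submission
  imports Defs
begin

text \<open>Put \<open>\<sigma> = \<sigma>\<^sub>0 sqrt \<lambda>\<close>. For large \<open>\<lambda>\<close> it is never optimal to stop in state \<open>1\<close>, and the
  free boundary problem has an explicit solution: below the boundary \<open>U\<close> it is a multiple of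
  \<open>y\<^sup>q\<close> with \<open>q = \<Omega>\<^sub>-\<close>, in state \<open>1\<close> with the additional factor \<open>w\<close>; above \<open>U\<close> it is \<open>y - a\<close>
  in state \<open>-1\<close> and the value of waiting for the next jump in state \<open>1\<close>. This supersolution bounds
  the value function from above. The lower bound comes from stopping when the price first reaches
  the limit threshold \<open>u\<close>, whose value is again a multiple of \<open>y\<^sup>q\<close>. Both bounds converge to the
  limit value function, because \<open>q\<close>, \<open>w\<close> and \<open>U\<close> tend to \<open>\<Omega>\<^sub>0\<close>, \<open>1\<close> and \<open>u\<close>. The value at \<open>U\<close> in
  state \<open>-1\<close> is \<open>U - a\<close>, so the threshold is at most \<open>U\<close>; below \<open>u\<close> the convex lower bound, replaced
  by a tangent, stays above \<open>y - a\<close> uniformly.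

  No stochastic calculus is used. Along a time grid of mesh \<open>h\<close> a discounted supersolution is a
  supermartingale up to an error \<open>o(h)\<close> per step: by the Markov property and Fubini's theorem the
  expected time away from the present state is \<open>O(h\<^sup>2)\<close>, so up to this error the price moves along the
  deterministic flow, and the chain has jumped with probability \<open>\<lambda>h + o(h)\<close>.\<close>

subsection \<open>Supersolutions along the deterministic flow\<close>

text \<open>One notion serves both bounds. The condition in \<open>supersolution\<close> is an
  inequality, so the negative of an exact solution qualifies as well, and the grid estimate for
  \<open>- (c i * u powr q)\<close> reads as a lower bound for the reward of the hitting rule.
  Conditional expectations do not appear: the supermartingale property is an inequality of integrals
  over events of the natural filtration, the form in which the Markov property is given, and events
  of the completed filtration are changed on null sets to reach it. The obstacle in the limit is
  that the equation for \<open>U\<close> degenerates: with \<open>w\<close> and \<open>al\<close>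
  tending to 1 and \<open>be\<close> to \<open>a\<close> it becomes \<open>U - a = U - a\<close>.
  The boundary is determined by the terms of order \<open>1 / sqrt lambda\<close>, hence the limits
  scaled by that root. In state 1 the two branches of the upper bound join with equal slopes at
  \<open>U\<close>; in state -1 only a kink of the harmless sign is guaranteed. The price rises only
  in state 1, so the rule that stops at \<open>u\<close> is calibrated by the larger component,
  which costs a factor \<open>w\<close> in state -1.\<close>

text \<open>Finitely many kinks are harmless: between two jumps of the chain the price passes each of
  them at most once.\<close>

definition supersolution :: "real \<Rightarrow> real \<Rightarrow> real \<Rightarrow> real \<Rightarrow> (real \<Rightarrow> real \<Rightarrow> real) \<Rightarrow> bool" where
  "supersolution mu sig lambda rho \<phi> \<longleftrightarrow>
     (\<forall>i\<in>{-1, 1}. \<phi> i \<in> borel_measurable borel \<and> \<phi> i 0 = 0 \<and> (\<forall>R. \<exists>L. L-lipschitz_on {0..R} (\<phi> i))) \<and>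
     (\<exists>E. finite E \<and> (\<forall>i\<in>{-1, 1}. \<forall>u>0. u \<notin> E \<longrightarrow> (\<exists>D. (\<phi> i has_real_derivative D) (at u) \<and>
        (mu + sig * i) * u * D + lambda * (\<phi> (-i) u - \<phi> i u) - rho * \<phi> i u \<le> 0)))"

lemma supersolution_lipschitz:
  assumes "supersolution mu sig lambda rho \<phi>"
  obtains L where "\<And>i. i \<in> {-1, 1} \<Longrightarrow> L-lipschitz_on {0..R} (\<phi> i)" "0 \<le> L"
proof -
  obtain L1 L2 where L: "L1-lipschitz_on {0..R} (\<phi> (-1))" "L2-lipschitz_on {0..R} (\<phi> 1)"
    using assms unfolding supersolution_def by blast
  then have "(max L1 L2)-lipschitz_on {0..R} (\<phi> (-1))" "(max L1 L2)-lipschitz_on {0..R} (\<phi> 1)"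
    by (auto intro: lipschitz_on_mono)
  moreover have "0 \<le> max L1 L2" using lipschitz_on_nonneg[OF L(1)] by simp
  ultimately show thesis using that[of "max L1 L2"] by blast
qed

lemma exp_diff_le:
  fixes a b :: real
  assumes "a \<le> c" "b \<le> c"
  shows "\<bar>exp a - exp b\<bar> \<le> exp c * \<bar>a - b\<bar>"
proof -
  have *: "exp v - exp u \<le> exp c * (v - u)" if "u \<le> v" "v \<le> c" for u v :: real
  proof -
    have "exp v * (1 - exp (u - v)) \<le> exp v * (v - u)"
      by (intro mult_left_mono) (use exp_ge_add_one_self[of "u - v"] in linarith, simp)
    also have "\<dots> \<le> exp c * (v - u)" using that by (intro mult_right_mono) auto
    finally show ?thesis by (simp add: right_diff_distrib exp_diff)
  qed
  show ?thesis using *[of a b] *[of b a] assms by (cases "a \<le> b") auto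
qed

text \<open>Integrating the inequality of \<open>supersolution\<close> along the flow gives
  \<open>exp (- rho * h) * \<phi> i (x h) \<le> \<phi> i u + lambda * h * (\<phi> i u - \<phi> (-i)
  u) + O(h\<^sup>2)\<close>, and the flip term cancels the middle one to first order. Here
  \<open>q\<close> stands for the flip probability, known only up to \<open>\<delta> * h\<close>;
  \<open>mu < sig\<close> makes the flow strictly monotone in both states.\<close>

lemma flow_step:
  assumes S: "supersolution mu sig lambda rho \<phi>" and mu: "0 < mu" "mu < sig"
    and lambda: "0 < lambda" and rho: "0 < rho" and R: "0 \<le> R" and \<epsilon>: "0 < \<epsilon>"
  obtains \<delta> h0 where "\<delta> > 0" "h0 > 0"
    "\<And>h q i u. 0 < h \<Longrightarrow> h < h0 \<Longrightarrow> 0 \<le> q \<Longrightarrow> \<bar>q - lambda * h\<bar> \<le> \<delta> * h \<Longrightarrow> i \<in> {-1, 1} \<Longrightarrow> u \<in> {0..R} \<Longrightarrow>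
       exp (- rho * h) * ((1 - q) * \<phi> i (u * exp ((mu + sig * i) * h)) + q * \<phi> (-i) u) \<le> \<phi> i u + \<epsilon> * h"
proof -
  define B where "B = mu + sig"
  \<comment> \<open>A flow started in \<open>[0, R]\<close> stays in \<open>[0, R1]\<close> during a
    step of length at most 1.\<close>
  define R1 where "R1 = R * exp B"
  have B: "B > 0" unfolding B_def using mu by simp
  have R1: "R1 \<ge> 0" unfolding R1_def using R by simp
  have RR1: "R \<le> R1" unfolding R1_def using R B by (simp add: mult_le_cancel_left1)
  obtain L where L: "\<And>i. i \<in> {-1, 1} \<Longrightarrow> L-lipschitz_on {0..R1} (\<phi> i)" "0 \<le> L"
    using supersolution_lipschitz[OF S] by blast
  have lip: "\<bar>\<phi> i u - \<phi> i v\<bar> \<le> L * \<bar>u - v\<bar>" if "i \<in> {-1, 1}" "u \<in> {0..R1}" "v \<in> {0..R1}" for i u v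
    using lipschitz_onD[OF L(1)[OF that(1)] that(2,3)] by (simp add: dist_real_def)
  have zero: "\<phi> i 0 = 0" if "i \<in> {-1, 1}" for i using S that unfolding supersolution_def by blast
  have neg: "-i \<in> {-1, 1}" if "i \<in> {-1, 1}" for i :: real using that by auto
  define m where "m = L * R1"
  have m: "m \<ge> 0" unfolding m_def using L(2) R1 by simp
  have bound: "\<bar>\<phi> i u\<bar> \<le> m" if "i \<in> {-1, 1}" "u \<in> {0..R1}" for i u
  proof -
    have "\<bar>\<phi> i u - \<phi> i 0\<bar> \<le> L * \<bar>u - 0\<bar>" using that R1 by (intro lip) auto
    also have "\<dots> \<le> m" unfolding m_def using that L(2) by (intro mult_left_mono) auto
    finally show ?thesis by (simp add: zero[OF that(1)])
  qed
  \<comment> \<open>\<open>C1\<close> measures how fast the integrand along the flow can exceed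
    \<open>lambda * d0\<close>, \<open>C2\<close> how large \<open>e2\<close> can become per unit of
    \<open>h\<close>; both end up multiplied by \<open>h\<^sup>2\<close>.\<close>
  define C1 where "C1 = lambda * (2 * rho * m + 2 * (L * (R1 * B)))"
  define C2 where "C2 = 2 * rho * m + L * (R1 * B)"
  have C: "C1 \<ge> 0" "C2 \<ge> 0" unfolding C1_def C2_def using lambda rho m L(2) R1 B by auto
  \<comment> \<open>Half of \<open>\<epsilon> * h\<close> is reserved for the error in the flip
    probability and half for the second-order terms.\<close>
  define \<delta> where "\<delta> = min 1 (\<epsilon> / (4 * m + 4))"
  define h0 where "h0 = min 1 (\<epsilon> / (2 * (C1 + (lambda + 1) * C2) + 1))"
  have \<delta>: "\<delta> > 0" "\<delta> \<le> 1" "2 * m * \<delta> \<le> \<epsilon> / 2"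
  proof -
    show "\<delta> > 0" "\<delta> \<le> 1" unfolding \<delta>_def using \<epsilon> m by auto
    have "\<delta> \<le> \<epsilon> / (4 * m + 4)" unfolding \<delta>_def by simp
    then have "\<delta> * (4 * m + 4) \<le> \<epsilon>" using m by (simp add: le_divide_eq)
    moreover have "\<delta> * (4 * m + 4) \<ge> 4 * (m * \<delta>)" using \<open>\<delta> > 0\<close> by (simp add: algebra_simps)
    ultimately show "2 * m * \<delta> \<le> \<epsilon> / 2" by simp
  qed
  have C3: "C1 + (lambda + 1) * C2 \<ge> 0" using C lambda by simp
  have h0: "h0 > 0" "h0 \<le> 1" "(C1 + (lambda + 1) * C2) * h0 \<le> \<epsilon> / 2"
  proof -
    show "h0 > 0" "h0 \<le> 1" unfolding h0_def using \<epsilon> C3 by auto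
    have "h0 \<le> \<epsilon> / (2 * (C1 + (lambda + 1) * C2) + 1)" unfolding h0_def by simp
    then have "h0 * (2 * (C1 + (lambda + 1) * C2) + 1) \<le> \<epsilon>" using C3 by (simp add: le_divide_eq)
    then have "2 * ((C1 + (lambda + 1) * C2) * h0) + h0 \<le> \<epsilon>" by (simp add: algebra_simps)
    then show "(C1 + (lambda + 1) * C2) * h0 \<le> \<epsilon> / 2" using \<open>h0 > 0\<close> by linarith
  qed
  obtain E D where E: "finite E" and D: "\<And>i u. i \<in> {-1, 1} \<Longrightarrow> 0 < u \<Longrightarrow> u \<notin> E \<Longrightarrow> (\<phi> i has_real_derivative D i u) (at u)"
    "\<And>i u. i \<in> {-1, 1} \<Longrightarrow> 0 < u \<Longrightarrow> u \<notin> E \<Longrightarrow> (mu + sig * i) * u * D i u + lambda * (\<phi> (-i) u - \<phi> i u) - rho * \<phi> i u \<le> 0"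
  proof -
    obtain E where E: "finite E" "\<forall>i\<in>{-1, 1}. \<forall>u>0. u \<notin> E \<longrightarrow> (\<exists>D. (\<phi> i has_real_derivative D) (at u) \<and>
        (mu + sig * i) * u * D + lambda * (\<phi> (-i) u - \<phi> i u) - rho * \<phi> i u \<le> 0)"
      using S unfolding supersolution_def by blast
    define D where "D i u = (SOME D. (\<phi> i has_real_derivative D) (at u) \<and>
        (mu + sig * i) * u * D + lambda * (\<phi> (-i) u - \<phi> i u) - rho * \<phi> i u \<le> 0)" for i u
    have "(\<phi> i has_real_derivative D i u) (at u) \<and>
        (mu + sig * i) * u * D i u + lambda * (\<phi> (-i) u - \<phi> i u) - rho * \<phi> i u \<le> 0" if "i \<in> {-1, 1}" "0 < u" "u \<notin> E" for i u
      unfolding D_def by (rule someI_ex) (use E(2) that in blast)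
    then show thesis using that[OF E(1)] by blast
  qed
  have main: "exp (- rho * h) * ((1 - q) * \<phi> i (u * exp ((mu + sig * i) * h)) + q * \<phi> (-i) u) \<le> \<phi> i u + \<epsilon> * h"
    if h: "0 < h" "h < h0" and q: "0 \<le> q" "\<bar>q - lambda * h\<bar> \<le> \<delta> * h" and i: "i \<in> {-1, 1}" and u: "u \<in> {0..R}" for h q i u
  proof (cases "u = 0")
    case True
    then show ?thesis using zero[OF i] zero[OF neg[OF i]] \<epsilon> h by simp
  next
    case False
    then have u0: "u > 0" using u by simp
    define b where "b = mu + sig * i"
    have b: "b \<noteq> 0" "\<bar>b\<bar> \<le> B" unfolding b_def B_def using i mu by auto
    define x where "x r = u * exp (b * r)" for r
    have xpos: "x r > 0" for r unfolding x_def using u0 by simp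
    have h1: "h \<le> 1" using h h0 by simp
    have br: "\<bar>b * r\<bar> \<le> B * r" "b * r \<le> B" if "0 \<le> r" "r \<le> 1" for r
    proof -
      show *: "\<bar>b * r\<bar> \<le> B * r" using that b by (simp add: abs_mult mult_right_mono)
      have "B * r \<le> B" using that B by (simp add: mult_le_cancel_left1)
      with * show "b * r \<le> B" by linarith
    qed
    have xR: "x r \<in> {0..R1}" if "0 \<le> r" "r \<le> 1" for r
      using br[OF that] u u0 unfolding x_def R1_def by (auto intro!: mult_mono)
    have xu: "\<bar>x r - u\<bar> \<le> R1 * B * r" if "0 \<le> r" "r \<le> 1" for r
    proof -
      have "\<bar>exp (b * r) - exp 0\<bar> \<le> exp B * \<bar>b * r - 0\<bar>"
        using br[OF that] B by (intro exp_diff_le) auto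
      also have "\<dots> \<le> exp B * (B * r)" using br[OF that] by simp
      finally have "u * \<bar>exp (b * r) - 1\<bar> \<le> R * (exp B * (B * r))" using u by (intro mult_mono) auto
      moreover have "\<bar>x r - u\<bar> = u * \<bar>exp (b * r) - 1\<bar>"
      proof -
        have "x r - u = u * (exp (b * r) - 1)" unfolding x_def by (simp add: right_diff_distrib)
        then show ?thesis using u0 by (simp add: abs_mult)
      qed
      ultimately show ?thesis unfolding R1_def by (simp add: mult.assoc)
    qed
    have phix: "\<bar>\<phi> k (x r) - \<phi> k u\<bar> \<le> L * (R1 * B) * r" if "k \<in> {-1, 1}" "0 \<le> r" "r \<le> 1" for k r
    proof -
      have "\<bar>\<phi> k (x r) - \<phi> k u\<bar> \<le> L * \<bar>x r - u\<bar>" using that xR u RR1 by (intro lip) auto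
      also have "\<dots> \<le> L * (R1 * B * r)" using xu that L(2) by (intro mult_left_mono) auto
      finally show ?thesis by (simp add: mult.assoc)
    qed
    have er: "\<bar>exp (- rho * r) - 1\<bar> \<le> rho * r" "exp (- rho * r) \<le> 1" if "0 \<le> r" for r
      using exp_ge_add_one_self[of "- rho * r"] that rho by (auto simp: mult_nonneg_nonneg)
    have uR: "u \<in> {0..R1}" using u RR1 by auto
    define d where "d r = \<phi> i (x r) - \<phi> (-i) (x r)" for r
    define d0 where "d0 = \<phi> i u - \<phi> (-i) u"
    have d0: "\<bar>d0\<bar> \<le> 2 * m" unfolding d0_def using bound[OF i uR] bound[OF neg[OF i] uR] by linarith
    define f where "f r = exp (- rho * r) * \<phi> i (x r)" for r
    \<comment> \<open>The times at which the flow meets a kink; \<open>x\<close> is injective, so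
      they are finitely many. There \<open>g\<close> receives its intended upper bound as value, so
      that \<open>g_le\<close> holds everywhere while the fundamental theorem ignores
      \<open>Z\<close>.\<close>
    define Z where "Z = {r \<in> {0..h}. x r \<in> E}"
    define g where "g r = (if r \<in> Z then lambda * d0 + C1 * h
       else exp (- rho * r) * (b * x r * D i (x r) - rho * \<phi> i (x r)))" for r
    have "inj x" unfolding x_def inj_on_def using b(1) u0 by simp
    then have Z: "finite Z" unfolding Z_def by (intro finite_subset[OF _ finite_vimageI[OF E]]) auto
    have g_le: "g r \<le> lambda * d0 + C1 * h" if r: "r \<in> {0..h}" for r
    proof (cases "r \<in> Z")
      case False
      then have "x r \<notin> E" using r unfolding Z_def by simp
      have r1: "0 \<le> r" "r \<le> 1" using r h1 by auto
      have dr: "\<bar>d r\<bar> \<le> 2 * m"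
        unfolding d_def using bound[OF i xR[OF r1]] bound[OF neg[OF i] xR[OF r1]] by linarith
      have "b * x r * D i (x r) - rho * \<phi> i (x r) \<le> lambda * d r"
        using D(2)[OF i xpos \<open>x r \<notin> E\<close>] unfolding d_def b_def by (simp add: algebra_simps)
      then have "exp (- rho * r) * (b * x r * D i (x r) - rho * \<phi> i (x r)) \<le> exp (- rho * r) * (lambda * d r)"
        by (intro mult_left_mono) auto
      then have "g r \<le> lambda * (exp (- rho * r) * d r)" using False by (simp add: g_def algebra_simps)
      also have "exp (- rho * r) * d r \<le> d0 + (2 * rho * m + 2 * (L * (R1 * B))) * r"
      proof -
        have "(exp (- rho * r) - 1) * d r \<le> (rho * r) * (2 * m)"
        proof -
          have "(exp (- rho * r) - 1) * d r \<le> \<bar>exp (- rho * r) - 1\<bar> * \<bar>d r\<bar>" by (metis abs_ge_self abs_mult)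
          also have "\<dots> \<le> (rho * r) * (2 * m)" using er(1)[OF r1(1)] dr r1 rho by (intro mult_mono) auto
          finally show ?thesis .
        qed
        moreover have "d r - d0 \<le> 2 * (L * (R1 * B) * r)"
          unfolding d_def d0_def using phix[OF i r1] phix[OF neg[OF i] r1] by linarith
        moreover have "exp (- rho * r) * d r = (exp (- rho * r) - 1) * d r + (d r - d0) + d0" by (simp add: algebra_simps)
        ultimately show ?thesis by (simp add: algebra_simps)
      qed
      finally have "g r \<le> lambda * (d0 + (2 * rho * m + 2 * (L * (R1 * B))) * r)" using lambda by simp
      also have "\<dots> = lambda * d0 + C1 * r" unfolding C1_def by (simp add: algebra_simps)
      also have "\<dots> \<le> lambda * d0 + C1 * h" using r C(1) by (simp add: mult_left_mono)
      finally show ?thesis .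
    qed (simp add: g_def)
    have "(g has_integral (f h - f 0)) {0..h}"
    proof (rule fundamental_theorem_of_calculus_interior_strong[OF Z])
      fix r assume r: "r \<in> {0<..<h} - Z"
      then have "x r \<notin> E" unfolding Z_def by auto
      have x': "(x has_real_derivative b * x r) (at r)"
        unfolding x_def by (auto intro!: derivative_eq_intros)
      have "((\<lambda>r. \<phi> i (x r)) has_real_derivative D i (x r) * (b * x r)) (at r)"
        by (rule DERIV_chain2[OF D(1)[OF i xpos \<open>x r \<notin> E\<close>] x'])
      then have "(f has_real_derivative exp (- rho * r) * (b * x r * D i (x r) - rho * \<phi> i (x r))) (at r)"
        unfolding f_def by (auto intro!: derivative_eq_intros simp: algebra_simps)
      then show "(f has_vector_derivative g r) (at r)"
        using r by (simp add: g_def has_real_derivative_iff_has_vector_derivative)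
    next
      have "continuous_on {0..h} (\<lambda>r. \<phi> i (x r))"
        by (rule continuous_on_compose2[OF lipschitz_on_continuous_on[OF L(1)[OF i]]])
          (use xR h1 in \<open>auto simp: x_def intro!: continuous_intros\<close>)
      then show "continuous_on {0..h} f" unfolding f_def by (intro continuous_intros)
    qed (use h in simp)
    moreover have "((\<lambda>r. lambda * d0 + C1 * h) has_integral h * (lambda * d0 + C1 * h)) {0..h}"
      using has_integral_const_real[of "lambda * d0 + C1 * h" 0 h] h by simp
    ultimately have "f h - f 0 \<le> h * (lambda * d0 + C1 * h)"
      by (rule has_integral_le) (use g_le in simp)
    moreover have "f 0 = \<phi> i u" unfolding f_def x_def by simp
    ultimately have fh: "f h \<le> \<phi> i u + h * (lambda * d0 + C1 * h)" by simp
    have h': "0 \<le> h" using h by simp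
    \<comment> \<open>In the gap \<open>exp (- rho * h) * \<phi> (-i) u - f h\<close> between
      flipping and staying, \<open>- d0\<close> is the leading part; the remainder \<open>e2\<close>
      is at most of order \<open>h\<close>.\<close>
    define e2 where "e2 = exp (- rho * h) * \<phi> (-i) u - f h + d0"
    have e2: "e2 \<le> C2 * h"
    proof -
      have "e2 = (exp (- rho * h) - 1) * (\<phi> (-i) u - \<phi> i (x h)) + (\<phi> i u - \<phi> i (x h))"
        unfolding e2_def f_def d0_def by (simp add: algebra_simps)
      moreover have "(exp (- rho * h) - 1) * (\<phi> (-i) u - \<phi> i (x h)) \<le> (rho * h) * (2 * m)"
      proof -
        have "\<bar>\<phi> (-i) u - \<phi> i (x h)\<bar> \<le> 2 * m"
          using bound[OF neg[OF i] uR] bound[OF i xR[OF h' h1]] by linarith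
        have "(exp (- rho * h) - 1) * (\<phi> (-i) u - \<phi> i (x h)) \<le> \<bar>exp (- rho * h) - 1\<bar> * \<bar>\<phi> (-i) u - \<phi> i (x h)\<bar>"
          by (metis abs_ge_self abs_mult)
        also have "\<dots> \<le> (rho * h) * (2 * m)"
          using er(1)[OF h'] \<open>\<bar>\<phi> (-i) u - \<phi> i (x h)\<bar> \<le> 2 * m\<close> h' rho by (intro mult_mono) auto
        finally show ?thesis .
      qed
      moreover have "\<phi> i u - \<phi> i (x h) \<le> L * (R1 * B) * h" using phix[OF i h' h1] by linarith
      ultimately show ?thesis unfolding C2_def by (simp add: algebra_simps)
    qed
    have "exp (- rho * h) * ((1 - q) * \<phi> i (x h) + q * \<phi> (-i) u) = f h + q * (e2 - d0)"
      unfolding e2_def f_def by (simp add: algebra_simps)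
    also have "\<dots> \<le> \<phi> i u + h * (lambda * d0 + C1 * h) + q * (C2 * h - d0)"
      using fh e2 q by (intro add_mono mult_left_mono) auto
    also have "\<dots> = \<phi> i u + (lambda * h - q) * d0 + (C1 * h + q * C2) * h" by (simp add: algebra_simps)
    also have "\<dots> \<le> \<phi> i u + (\<delta> * h) * (2 * m) + (C1 * h + (lambda + 1) * h * C2) * h"
    proof -
      have "(lambda * h - q) * d0 \<le> \<bar>lambda * h - q\<bar> * \<bar>d0\<bar>" by (metis abs_ge_self abs_mult)
      also have "\<dots> \<le> (\<delta> * h) * (2 * m)" using q d0 \<delta> h by (intro mult_mono) (auto simp: abs_minus_commute)
      finally have 1: "(lambda * h - q) * d0 \<le> (\<delta> * h) * (2 * m)" .
      have "\<delta> * h \<le> h" using \<delta> h by simp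
      then have "q \<le> (lambda + 1) * h" using q by (simp add: algebra_simps)
      then have "(C1 * h + q * C2) * h \<le> (C1 * h + (lambda + 1) * h * C2) * h"
        using C h' by (intro mult_right_mono add_mono) auto
      with 1 show ?thesis by linarith
    qed
    also have "\<dots> = \<phi> i u + (2 * m * \<delta>) * h + ((C1 + (lambda + 1) * C2) * h) * h" by (simp add: algebra_simps)
    also have "\<dots> \<le> \<phi> i u + (\<epsilon> / 2) * h + (\<epsilon> / 2) * h"
    proof -
      have "(C1 + (lambda + 1) * C2) * h \<le> \<epsilon> / 2"
        using h0(3) mult_left_mono[OF less_imp_le[OF h(2)] C3] by linarith
      then show ?thesis using \<delta>(3) h' by (intro add_mono mult_right_mono) auto
    qed
    finally show ?thesis unfolding x_def b_def by simp
  qed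
  show thesis by (rule that[OF \<delta>(1) h0(1) main])
qed

subsection \<open>The telegraph process\<close>

lemma ext_expectation_integrable:
  assumes "integrable M f"
  shows "ext_expectation M f = ereal (integral\<^sup>L M f)"
proof -
  have fin: "(\<integral>\<^sup>+ x. ennreal (f x) \<partial>M) \<noteq> \<infinity>" "(\<integral>\<^sup>+ x. ennreal (- f x) \<partial>M) \<noteq> \<infinity>"
    using real_integrable_def[THEN iffD1, OF assms] by auto
  obtain b c where bc: "(\<integral>\<^sup>+ x. ennreal (f x) \<partial>M) = ennreal b" "0 \<le> b"
    "(\<integral>\<^sup>+ x. ennreal (- f x) \<partial>M) = ennreal c" "0 \<le> c"
    using fin by (metis ennreal_cases infinity_ennreal_def)
  show ?thesis
    unfolding ext_expectation_def real_lebesgue_integral_def[OF assms] bc(1) bc(3)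
    using bc(2,4) by (simp add: enn2ereal_ennreal)
qed

locale telegraph = markov_chain M "{-1, 1}" "flip_generator lambda" xi
  for M :: "'w measure" and lambda :: real and xi :: "real \<Rightarrow> 'w \<Rightarrow> real" +
  fixes s mu sig rho y :: real
  assumes lambda_pos: "lambda > 0"
    and start: "AE \<omega> in M. xi 0 \<omega> = s"
    and start_state: "s \<in> {-1, 1}"
    and mu_pos: "mu > 0" and sig_pos: "sig > 0" and rho_pos: "rho > 0"
    and y_nonneg: "y \<ge> 0"
begin

abbreviation "F \<equiv> \<lambda>t. natural_filtration M xi (ennreal t)"
abbreviation "Fc \<equiv> \<lambda>t. completed_natural_filtration M xi (ennreal t)"
abbreviation "Y \<equiv> price xi mu sig y"

section \<open>Path regularity, measurability and growth of the price\<close>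

lemma xi_values: "0 \<le> t \<Longrightarrow> \<omega> \<in> space M \<Longrightarrow> xi t \<omega> = -1 \<or> xi t \<omega> = 1"
  using measurable_space[OF measurable_process] by fastforce

lemma abs_xi: "0 \<le> t \<Longrightarrow> \<omega> \<in> space M \<Longrightarrow> \<bar>xi t \<omega>\<bar> = 1"
  using xi_values[of t \<omega>] by auto

text \<open>The time \<open>r\<close> lies in the cell that ends at the first partition point beyond
  it, and the path is constant up to that point. This makes the approximations in
  \<open>progressive\<close> eventually exact.\<close>

lemma xi_right_const:
  assumes "\<omega> \<in> space M" "0 \<le> r"
  obtains e where "e > 0" "\<And>q. r \<le> q \<Longrightarrow> q < r + e \<Longrightarrow> xi q \<omega> = xi r \<omega>"
proof -
  obtain T :: "nat \<Rightarrow> real" where T: "T 0 = 0" "strict_mono T" "filterlim T at_top sequentially"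
    "\<And>n t. t \<in> {T n..<T (Suc n)} \<Longrightarrow> xi t \<omega> = xi (T n) \<omega>"
    using step_paths[OF assms(1)] unfolding step_path_def by blast
  have "\<exists>n. r < T n"
    using T(3) unfolding filterlim_at_top_dense by (auto simp: eventually_sequentially)
  define n where "n = (LEAST n. r < T n)"
  have n: "r < T n" unfolding n_def using \<open>\<exists>n. r < T n\<close> by (rule LeastI_ex)
  have "n \<noteq> 0" using n T(1) assms(2) by (intro notI) auto
  then obtain m where m: "n = Suc m" by (cases n) auto
  have "T m \<le> r" using not_less_Least[of m "\<lambda>n. r < T n"] m n_def by auto
  show thesis
  proof (rule that[of "T n - r"])
    fix q assume "r \<le> q" "q < r + (T n - r)"
    then show "xi q \<omega> = xi r \<omega>"
      using T(4)[of q m] T(4)[of r m] \<open>T m \<le> r\<close> n m by auto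
  qed (use n in simp)
qed

lemma space_F [simp]: "space (natural_filtration M xi u) = space M"
  unfolding natural_filtration_def by (intro space_measure_of) auto

lemma sets_natural_filtration:
  "sets (natural_filtration M xi u) =
     sigma_sets (space M) {xi r -` A \<inter> space M | r A. 0 \<le> r \<and> ennreal r \<le> u}"
  unfolding natural_filtration_def by (intro sets_measure_of) auto

lemma sets_F_subset: "sets (natural_filtration M xi u) \<subseteq> sets M"
  unfolding sets_natural_filtration
proof (intro sets.sigma_sets_subset subsetI)
  fix B assume "B \<in> {xi r -` A \<inter> space M | r A. 0 \<le> r \<and> ennreal r \<le> u}"
  then obtain r A where B: "B = xi r -` A \<inter> space M" "0 \<le> r" by auto
  have "B = xi r -` (A \<inter> {-1,1}) \<inter> space M" using B xi_values by auto
  then show "B \<in> sets M" using measurable_sets[OF measurable_process[OF B(2)], of "A \<inter> {-1,1}"] by simp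
qed

lemma subalgebra_F: "subalgebra M (natural_filtration M xi u)"
  unfolding subalgebra_def using sets_F_subset by auto

lemma F_mono: "u \<le> v \<Longrightarrow> sets (natural_filtration M xi u) \<subseteq> sets (natural_filtration M xi v)"
  unfolding sets_natural_filtration by (intro sigma_sets_mono') (fast elim: order_trans)

lemma measurable_from_F: "f \<in> borel_measurable (natural_filtration M xi u) \<Longrightarrow> f \<in> borel_measurable M"
  using measurable_from_subalg[OF subalgebra_F] by blast

lemma xi_measurable_F:
  assumes "0 \<le> r" "r \<le> t"
  shows "xi r \<in> borel_measurable (F t)"
proof (rule measurableI)
  fix A assume "A \<in> sets (borel :: real measure)"
  show "xi r -` A \<inter> space (F t) \<in> sets (F t)"
    unfolding sets_natural_filtration space_F
    by (rule sigma_sets.Basic) (use assms in \<open>auto intro!: exI[of _ r] ennreal_leI\<close>)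
qed simp

text \<open>Time is rounded up to a grid. Paths are right-constant, so the value at the next grid
  point is eventually the value at \<open>r\<close>. Each approximation selects among countably many
  variables by the grid cell of \<open>r\<close>, hence is jointly measurable.\<close>

lemma progressive:
  assumes t: "0 \<le> t"
  shows "(\<lambda>(\<omega>, r). indicator {0..t} r * xi r \<omega>) \<in> borel_measurable (F t \<Otimes>\<^sub>M borel)"
proof -
  \<comment> \<open>\<open>(k + 1) / (n + 1)\<close> is the right end of the cell of
    \<open>r\<close>; clipping at \<open>t\<close> keeps the sampled variable measurable for
    \<open>F t\<close>.\<close>
  define q :: "nat \<Rightarrow> int \<Rightarrow> real" where "q n k = max 0 (min t ((of_int k + 1) / real (Suc n)))" for n k
  define f :: "nat \<Rightarrow> 'w \<times> real \<Rightarrow> real"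
    where "f n = (\<lambda>(\<omega>, r). indicator {0..t} r * xi (q n \<lfloor>r * real (Suc n)\<rfloor>) \<omega>)" for n
  have qt: "0 \<le> q n k" "q n k \<le> t" for n k unfolding q_def using t by auto
  show ?thesis
  proof (rule borel_measurable_LIMSEQ_metric[where f = f])
    fix n
    have [measurable]: "(\<lambda>(\<omega>, r). xi (q n k) \<omega>) \<in> borel_measurable (F t \<Otimes>\<^sub>M borel)" for k
      using measurable_compose[OF measurable_fst xi_measurable_F[OF qt]]
      by (simp add: case_prod_beta')
    have "(\<lambda>x. (\<lambda>k (\<omega>, r). xi (q n k) \<omega>) (\<lfloor>snd x * real (Suc n)\<rfloor>) x) \<in> borel_measurable (F t \<Otimes>\<^sub>M borel)"
      by (rule measurable_compose_countable) measurable
    then show "f n \<in> borel_measurable (F t \<Otimes>\<^sub>M borel)"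
      unfolding f_def by (simp add: case_prod_beta')
  next
    fix x assume x: "x \<in> space (F t \<Otimes>\<^sub>M (borel :: real measure))"
    obtain \<omega> r where xr: "x = (\<omega>, r)" by (cases x)
    have \<omega>: "\<omega> \<in> space M" using x xr by (simp add: space_pair_measure)
    show "(\<lambda>n. f n x) \<longlonglongrightarrow> (case x of (\<omega>, r) \<Rightarrow> indicator {0..t} r * xi r \<omega>)"
    proof (cases "r \<in> {0..t}")
      case True
      obtain e where e: "e > 0" "\<And>q. r \<le> q \<Longrightarrow> q < r + e \<Longrightarrow> xi q \<omega> = xi r \<omega>"
        using xi_right_const[OF \<omega>, of r] True by auto
      have "eventually (\<lambda>n. 1 / real (Suc n) < e) sequentially"
        using LIMSEQ_inverse_real_of_nat e(1) by (auto dest!: order_tendstoD(2) simp: inverse_eq_divide)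
      then have "eventually (\<lambda>n. f n x = indicator {0..t} r * xi r \<omega>) sequentially"
      proof eventually_elim
        case (elim n)
        define k where "k = \<lfloor>r * real (Suc n)\<rfloor>"
        define N where "N = real (Suc n)"
        have N: "N > 0" unfolding N_def by simp
        have "of_int k \<le> r * N" "r * N < of_int k + 1"
          unfolding k_def N_def by linarith+
        then have "r < (of_int k + 1) / N" "(of_int k + 1) / N \<le> r + 1 / N"
          using N by (simp_all add: pos_less_divide_eq divide_le_eq distrib_right)
        then have "r \<le> q n k" "q n k < r + e" using True elim unfolding q_def N_def[symmetric] by simp_all
        then have "xi (q n k) \<omega> = xi r \<omega>" by (rule e(2))
        then show ?case unfolding f_def xr prod.case k_def by (simp only:)
      qed
      then show ?thesis unfolding xr by (simp add: tendsto_eventually)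
    qed (simp add: f_def xr)
  qed
qed

lemma xi_section_measurable:
  assumes "0 \<le> t" "\<omega> \<in> space M"
  shows "(\<lambda>r. indicator {0..t} r * xi r \<omega>) \<in> borel_measurable borel"
  using measurable_compose[OF measurable_Pair1'[of \<omega> "F t" borel] progressive[OF assms(1)]] assms(2)
  by simp

lemma xi_set_integrable:
  assumes "0 \<le> t" "\<omega> \<in> space M"
  shows "set_integrable lborel {0..t} (\<lambda>r. xi r \<omega>)"
  unfolding set_integrable_def
proof (rule Bochner_Integration.integrable_bound[of _ "indicator {0..t} :: real \<Rightarrow> real"])
  show "(\<lambda>x. indicator {0..t} x *\<^sub>R xi x \<omega>) \<in> borel_measurable lborel"
    using xi_section_measurable[OF assms] by simp
  show "AE x in lborel. norm (indicator {0..t} x *\<^sub>R xi x \<omega>) \<le> norm (indicator {0..t} x :: real)"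
    by (intro AE_I2) (simp add: indicator_def abs_xi[OF _ assms(2)])
qed (use assms in auto)

lemma xi_integrable_on:
  assumes "0 \<le> b" "b \<le> c" "\<omega> \<in> space M"
  shows "(\<lambda>r. xi r \<omega>) integrable_on {b..c}"
  by (rule integrable_subinterval_real[OF set_borel_integral_eq_integral(1)[OF xi_set_integrable[of c \<omega>]]])
    (use assms in auto)

lemma integral_xi_measurable:
  assumes t: "0 \<le> t"
  shows "(\<lambda>\<omega>. integral {0..t} (\<lambda>r. xi r \<omega>)) \<in> borel_measurable (F t)"
proof -
  have "(\<lambda>\<omega>. \<integral>r. (\<lambda>(\<omega>, r). indicator {0..t} r * xi r \<omega>) (\<omega>, r) \<partial>lborel) \<in> borel_measurable (F t)"
    by (rule lborel.borel_measurable_lebesgue_integral) (use progressive[OF t] in simp)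
  moreover have "(\<integral>r. indicator {0..t} r * xi r \<omega> \<partial>lborel) = integral {0..t} (\<lambda>r. xi r \<omega>)"
    if "\<omega> \<in> space M" for \<omega>
    using set_borel_integral_eq_integral(2)[OF xi_set_integrable[OF t that]]
    unfolding set_lebesgue_integral_def by simp
  ultimately show ?thesis by (subst measurable_cong) auto
qed

lemma Y_measurable_F: "0 \<le> t \<Longrightarrow> Y t \<in> borel_measurable (F t)"
  unfolding price_def using integral_xi_measurable by measurable

lemma Y_measurable: "0 \<le> t \<Longrightarrow> Y t \<in> borel_measurable M"
  using Y_measurable_F measurable_from_F by blast

lemma Y_nonneg: "0 \<le> Y t \<omega>" unfolding price_def using y_nonneg by simp

lemma Y_increment:
  assumes "0 \<le> t" "0 \<le> h" "\<omega> \<in> space M"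
  shows "Y (t + h) \<omega> = Y t \<omega> * exp (mu * h + sig * integral {t..t+h} (\<lambda>r. xi r \<omega>))"
proof -
  have "integral {0..t+h} (\<lambda>r. xi r \<omega>) = integral {0..t} (\<lambda>r. xi r \<omega>) + integral {t..t+h} (\<lambda>r. xi r \<omega>)"
    using assms by (intro Henstock_Kurzweil_Integration.integral_combine[symmetric] xi_integrable_on) auto
  then have "mu * (t + h) + sig * integral {0..t+h} (\<lambda>r. xi r \<omega>) = (mu * t + sig * integral {0..t} (\<lambda>r. xi r \<omega>)) + (mu * h + sig * integral {t..t+h} (\<lambda>r. xi r \<omega>))"
    by (simp only: distrib_left)
  then show ?thesis unfolding price_def by (simp only: exp_add mult.assoc)
qed

lemma integral_xi_bound:
  assumes "0 \<le> t" "0 \<le> h" "\<omega> \<in> space M"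
  shows "\<bar>integral {t..t+h} (\<lambda>r. xi r \<omega>)\<bar> \<le> h"
proof -
  have "norm (integral {t..t+h} (\<lambda>r. xi r \<omega>)) \<le> integral {t..t+h} (\<lambda>r. 1)"
    by (intro integral_norm_bound_integral xi_integrable_on) (use assms in \<open>auto simp: abs_xi[OF _ assms(3)]\<close>)
  then show ?thesis using assms by simp
qed

lemma log_increment_bound:
  assumes "0 \<le> t" "0 \<le> h" "\<omega> \<in> space M"
  shows "\<bar>mu * h + sig * integral {t..t+h} (\<lambda>r. xi r \<omega>)\<bar> \<le> (mu + sig) * h"
proof -
  have "\<bar>sig * integral {t..t+h} (\<lambda>r. xi r \<omega>)\<bar> \<le> sig * h"
    using integral_xi_bound[OF assms] sig_pos by (simp add: abs_mult)
  moreover have "\<bar>mu * h\<bar> = mu * h" using mu_pos assms by simp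
  ultimately show ?thesis unfolding distrib_right by linarith
qed

lemma Y_0 [simp]: "Y 0 \<omega> = y" unfolding price_def by simp

lemma Y_step_le:
  assumes "0 \<le> t" "0 \<le> h" "\<omega> \<in> space M"
  shows "Y (t + h) \<omega> \<le> Y t \<omega> * exp ((mu + sig) * h)"
  unfolding Y_increment[OF assms] using log_increment_bound[OF assms] Y_nonneg
  by (intro mult_left_mono) auto

lemma Y_le:
  assumes "0 \<le> t" "\<omega> \<in> space M"
  shows "Y t \<omega> \<le> y * exp ((mu + sig) * t)"
  using Y_step_le[of 0 t] assms by simp

lemma Y_continuous:
  assumes "\<omega> \<in> space M"
  shows "continuous_on {0..T} (\<lambda>t. Y t \<omega>)"
proof (cases "T \<ge> 0")
  case True
  have "continuous_on {0..T} (\<lambda>t. integral {0..t} (\<lambda>r. xi r \<omega>))"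
    using xi_integrable_on[OF _ True assms] by (intro indefinite_integral_continuous_1) auto
  then show ?thesis unfolding price_def by (intro continuous_intros)
qed simp

section \<open>Transition probabilities and the integrated Markov property\<close>

definition p :: "real \<Rightarrow> real \<Rightarrow> real \<Rightarrow> real" where
  "p = (SOME p. transition_semigroup {-1, 1} (flip_generator lambda) p \<and>
      (\<forall>t\<ge>0. \<forall>h\<ge>0. \<forall>A\<in>sets (F t). \<forall>i\<in>{-1, 1}. \<forall>j\<in>{-1, 1}.
         measure M {\<omega> \<in> A. xi t \<omega> = i \<and> xi (t + h) \<omega> = j} = measure M {\<omega> \<in> A. xi t \<omega> = i} * p h i j))"

lemma p_spec:
  "transition_semigroup {-1, 1} (flip_generator lambda) p"
  "\<And>t h A i j. 0 \<le> t \<Longrightarrow> 0 \<le> h \<Longrightarrow> A \<in> sets (F t) \<Longrightarrow> i \<in> {-1, 1} \<Longrightarrow> j \<in> {-1, 1} \<Longrightarrow>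
     measure M {\<omega> \<in> A. xi t \<omega> = i \<and> xi (t + h) \<omega> = j} = measure M {\<omega> \<in> A. xi t \<omega> = i} * p h i j"
  using someI_ex[OF markov_property] unfolding p_def[symmetric] by blast+

lemma p_nonneg: "0 \<le> h \<Longrightarrow> i \<in> {-1, 1} \<Longrightarrow> j \<in> {-1, 1} \<Longrightarrow> 0 \<le> p h i j"
  using p_spec(1) unfolding transition_semigroup_def by blast

lemma p_diag:
  assumes "0 \<le> h" "i \<in> {-1, 1}"
  shows "p h i i = 1 - p h i (-i)"
proof -
  have "(\<Sum>j\<in>{-1, 1}. p h i j) = 1"
    using p_spec(1) assms unfolding transition_semigroup_def by blast
  then have *: "p h i (-1) + p h i 1 = 1" by simp
  from assms(2) have "i = -1 \<or> i = 1" by simp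
  then show ?thesis
  proof
    assume i: "i = -1"
    show ?thesis using * unfolding i minus_minus by linarith
  next
    assume i: "i = 1"
    show ?thesis using * unfolding i by linarith
  qed
qed

text \<open>The entry \<open>p h i (-i)\<close> vanishes at 0 and its one-sided derivative there is
  the jump rate. The estimate is used with the small \<open>\<delta>\<close> of
  \<open>flow_step\<close>, and with \<open>\<delta> = lambda\<close> for the crude bound
  \<open>2 * lambda * h\<close>.\<close>

lemma p_asymp:
  assumes "\<delta> > 0"
  obtains h0 where "h0 > 0" "\<And>h i. 0 \<le> h \<Longrightarrow> h < h0 \<Longrightarrow> i \<in> {-1, 1} \<Longrightarrow> \<bar>p h i (-i) - lambda * h\<bar> \<le> \<delta> * h"
proof -
  have p0: "\<forall>i\<in>{-1, 1}. \<forall>j\<in>{-1, 1}. p 0 i j = (if i = j then 1 else 0)"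
    and p': "\<forall>i\<in>{-1, 1}. \<forall>j\<in>{-1, 1}.
      ((\<lambda>t. p t i j) has_real_derivative flip_generator lambda i j) (at 0 within {0..})"
    using p_spec(1) unfolding transition_semigroup_def by blast+
  have neg: "-i \<in> {-1, 1}" "i \<noteq> -i" if "i \<in> {-1, 1}" for i :: real
    using that by auto
  have 0: "p 0 i (-i) = 0" if "i \<in> {-1, 1}" for i
    using bspec[OF bspec[OF p0 that] neg(1)[OF that]] neg(2)[OF that] by simp
  have *: "\<exists>h0>0. \<forall>h. 0 \<le> h \<longrightarrow> h < h0 \<longrightarrow> \<bar>p h i (-i) - lambda * h\<bar> \<le> \<delta> * h" if i: "i \<in> {-1, 1}" for i
  proof -
    have "((\<lambda>t. p t i (-i)) has_real_derivative flip_generator lambda i (-i)) (at 0 within {0..})"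
      by (rule bspec[OF bspec[OF p' i] neg(1)[OF i]])
    moreover have "flip_generator lambda i (-i) = lambda" using neg(2)[OF i] by (simp add: flip_generator_def)
    ultimately have "((\<lambda>h. (p h i (-i) - p 0 i (-i)) / (h - 0)) \<longlongrightarrow> lambda) (at 0 within {0..})"
      by (simp only: has_field_derivative_iff)
    then have "((\<lambda>h. p h i (-i) / h) \<longlongrightarrow> lambda) (at 0 within {0..})" using 0[OF i] by simp
    from tendstoD[OF this assms] obtain d where
      d: "d > 0" "\<And>h. h \<in> {0..} \<Longrightarrow> h \<noteq> 0 \<Longrightarrow> dist h 0 < d \<Longrightarrow> dist (p h i (-i) / h) lambda < \<delta>"
      unfolding eventually_at by auto
    have "\<bar>p h i (-i) - lambda * h\<bar> \<le> \<delta> * h" if "0 \<le> h" "h < d" for h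
    proof (cases "h = 0")
      case False
      then have "h > 0" using that by simp
      have "\<bar>p h i (-i) / h - lambda\<bar> < \<delta>" using d(2)[of h] that False by (simp add: dist_real_def)
      then have "\<bar>p h i (-i) / h - lambda\<bar> * h \<le> \<delta> * h" using \<open>h > 0\<close> by (intro mult_right_mono) auto
      moreover have "\<bar>p h i (-i) / h - lambda\<bar> * h = \<bar>p h i (-i) - lambda * h\<bar>"
      proof -
        have "(p h i (-i) / h - lambda) * h = p h i (-i) - lambda * h"
          using \<open>h > 0\<close> by (simp add: left_diff_distrib)
        then show ?thesis using \<open>h > 0\<close> by (metis abs_mult abs_of_pos)
      qed
      ultimately show ?thesis by simp
    qed (use 0[OF i] in simp)
    then show ?thesis using d(1) by blast
  qed
  obtain h1 where h1: "h1 > 0" "\<And>h. 0 \<le> h \<Longrightarrow> h < h1 \<Longrightarrow> \<bar>p h (-1) (-(-1)) - lambda * h\<bar> \<le> \<delta> * h"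
    using *[of "-1"] by auto
  obtain h2 where h2: "h2 > 0" "\<And>h. 0 \<le> h \<Longrightarrow> h < h2 \<Longrightarrow> \<bar>p h 1 (-1) - lambda * h\<bar> \<le> \<delta> * h"
    using *[of 1] by auto
  show thesis by (rule that[of "min h1 h2"]) (use h1 h2 in auto)
qed

lemma xi_measurable [measurable (raw)]: "0 \<le> t \<Longrightarrow> xi t \<in> borel_measurable M"
  using xi_measurable_F[of t t] measurable_from_F by blast

text \<open>The Markov property for events says that the measures with densities \<open>g1\<close>
  and \<open>g2\<close> agree on the sets of \<open>F t\<close>. Restricted to that subalgebra they
  are one measure, so they give every \<open>F t\<close>-measurable \<open>f\<close> the same
  integral.\<close>

lemma markov_integral:
  fixes f :: "'w \<Rightarrow> real"
  assumes "0 \<le> t" "0 \<le> h" "i \<in> {-1, 1}" "j \<in> {-1, 1}" and f: "f \<in> borel_measurable (F t)"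
  shows "(\<integral>\<omega>. indicator {\<omega>. xi t \<omega> = i \<and> xi (t + h) \<omega> = j} \<omega> * f \<omega> \<partial>M) =
         p h i j * (\<integral>\<omega>. indicator {\<omega>. xi t \<omega> = i} \<omega> * f \<omega> \<partial>M)"
proof -
  define g1 :: "'w \<Rightarrow> real" where "g1 = indicator {\<omega>. xi t \<omega> = i \<and> xi (t + h) \<omega> = j}"
  define g2 :: "'w \<Rightarrow> real" where "g2 \<omega> = p h i j * indicator {\<omega>. xi t \<omega> = i} \<omega>" for \<omega>
  have [measurable]: "xi t \<in> borel_measurable M" "xi (t + h) \<in> borel_measurable M"
    using assms by auto
  have g [measurable]: "g1 \<in> borel_measurable M" "g2 \<in> borel_measurable M"
    unfolding g1_def g2_def by measurable
  have nn: "0 \<le> g1 \<omega>" "0 \<le> g2 \<omega>" for \<omega>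
    using p_nonneg[OF assms(2-4)] by (auto simp: g1_def g2_def)
  have sub: "subalgebra (density M (\<lambda>x. ennreal (g1 x))) (F t)" "subalgebra (density M (\<lambda>x. ennreal (g2 x))) (F t)"
    using subalgebra_F unfolding subalgebra_def by auto
  have "restr_to_subalg (density M (\<lambda>x. ennreal (g1 x))) (F t) = restr_to_subalg (density M (\<lambda>x. ennreal (g2 x))) (F t)"
  proof (rule measure_eqI)
    fix A assume "A \<in> sets (restr_to_subalg (density M (\<lambda>x. ennreal (g1 x))) (F t))"
    then have A: "A \<in> sets (F t)" by (simp add: sets_restr_to_subalg[OF sub(1)])
    then have AM [measurable]: "A \<in> sets M" using sets_F_subset by blast
    have s: "A \<subseteq> space M" using sets.sets_into_space[OF AM] .
    have "emeasure (density M (\<lambda>x. ennreal (g1 x))) A = emeasure M {\<omega> \<in> A. xi t \<omega> = i \<and> xi (t + h) \<omega> = j}"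
    proof -
      have "emeasure (density M (\<lambda>x. ennreal (g1 x))) A = (\<integral>\<^sup>+x. indicator {\<omega> \<in> A. xi t \<omega> = i \<and> xi (t + h) \<omega> = j} x \<partial>M)"
        by (subst emeasure_density, measurable, intro nn_integral_cong) (auto simp: g1_def split: split_indicator)
      also have "\<dots> = emeasure M {\<omega> \<in> A. xi t \<omega> = i \<and> xi (t + h) \<omega> = j}"
      proof (rule nn_integral_indicator)
        have "{\<omega> \<in> A. xi t \<omega> = i \<and> xi (t + h) \<omega> = j} = A \<inter> {\<omega> \<in> space M. xi t \<omega> = i \<and> xi (t + h) \<omega> = j}"
          using s by auto
        then show "{\<omega> \<in> A. xi t \<omega> = i \<and> xi (t + h) \<omega> = j} \<in> sets M" by simp
      qed
      finally show ?thesis .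
    qed
    also have "\<dots> = ennreal (p h i j) * emeasure M {\<omega> \<in> A. xi t \<omega> = i}"
      unfolding emeasure_eq_measure p_spec(2)[OF assms(1,2) A assms(3,4)]
      using p_nonneg[OF assms(2-4)] by (simp add: ennreal_mult mult.commute)
    also have "\<dots> = emeasure (density M (\<lambda>x. ennreal (g2 x))) A"
    proof -
      have *: "{\<omega> \<in> A. xi t \<omega> = i} = A \<inter> {\<omega> \<in> space M. xi t \<omega> = i}" using s by auto
      have "emeasure (density M (\<lambda>x. ennreal (g2 x))) A = (\<integral>\<^sup>+x. ennreal (p h i j) * indicator {\<omega> \<in> A. xi t \<omega> = i} x \<partial>M)"
        by (subst emeasure_density, measurable, intro nn_integral_cong) (auto simp: g2_def split: split_indicator)
      also have "\<dots> = ennreal (p h i j) * emeasure M {\<omega> \<in> A. xi t \<omega> = i}"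
        by (rule nn_integral_cmult_indicator) (simp add: *)
      finally show ?thesis by simp
    qed
    finally show "emeasure (restr_to_subalg (density M (\<lambda>x. ennreal (g1 x))) (F t)) A = emeasure (restr_to_subalg (density M (\<lambda>x. ennreal (g2 x))) (F t)) A"
      using emeasure_restr_to_subalg[OF sub(1) A] emeasure_restr_to_subalg[OF sub(2) A] by simp
  qed (simp add: sets_restr_to_subalg[OF sub(1)] sets_restr_to_subalg[OF sub(2)])
  then have "integral\<^sup>L (density M (\<lambda>x. ennreal (g1 x))) f = integral\<^sup>L (density M (\<lambda>x. ennreal (g2 x))) f"
    using integral_subalgebra2[OF sub(1) f] integral_subalgebra2[OF sub(2) f] by simp
  then have "(\<integral>x. g1 x * f x \<partial>M) = (\<integral>x. g2 x * f x \<partial>M)"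
    using nn measurable_from_F[OF f] by (simp add: integral_density)
  then show ?thesis unfolding g1_def g2_def by (simp add: mult.assoc)
qed

lemma progressive_M:
  assumes t: "0 \<le> t"
  shows "(\<lambda>x. indicator {0..t} (snd x) * xi (snd x) (fst x)) \<in> borel_measurable (M \<Otimes>\<^sub>M borel)"
proof -
  have "(\<lambda>x. (fst x, snd x)) \<in> measurable (M \<Otimes>\<^sub>M borel) (F t \<Otimes>\<^sub>M (borel :: real measure))"
  proof (rule measurable_Pair)
    have "(\<lambda>x. x) \<in> measurable M (F t)"
      by (rule measurableI) (use sets_F_subset in \<open>auto simp: Int_absorb2 sets.sets_into_space\<close>)
    then show "fst \<in> measurable (M \<Otimes>\<^sub>M (borel :: real measure)) (F t)"
      using measurable_compose[OF measurable_fst] by blast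
  qed simp
  from measurable_compose[OF this progressive[OF t]] show ?thesis by simp
qed

text \<open>The time that the chain spends away from its state \<open>i\<close> at time \<open>t\<close> during \<open>[t, t + h]\<close>
  is half of \<open>h - i * integral {t..t+h} xi\<close>; it is of second order in expectation.\<close>

lemma excursion_bound:
  assumes t: "0 \<le> t" and h: "0 \<le> h" and i: "i \<in> {-1, 1}"
    and A: "A \<in> sets (F t)" "\<And>\<omega>. \<omega> \<in> A \<Longrightarrow> xi t \<omega> = i"
    and K: "0 \<le> K" "\<And>r. 0 \<le> r \<Longrightarrow> r \<le> h \<Longrightarrow> p r i (-i) \<le> K * r"
  shows "(\<integral>\<omega>. indicator A \<omega> * (h - i * integral {t..t+h} (\<lambda>r. xi r \<omega>)) \<partial>M) \<le> 2 * K * h\<^sup>2"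
proof -
  have AM [measurable]: "A \<in> sets M" using A sets_F_subset by blast
  have As: "A \<subseteq> space M" using sets.sets_into_space[OF AM] .
  \<comment> \<open>On \<open>A\<close> the factor \<open>1 - i * xi r \<omega>\<close> is 2 when
    the chain is in \<open>-i\<close> and 0 otherwise. The inner indicator changes nothing on
    \<open>[t, t + h]\<close> and brings the integrand into the jointly measurable form of
    \<open>progressive_M\<close>.\<close>
  define g :: "'w \<Rightarrow> real \<Rightarrow> real"
    where "g \<omega> r = indicator A \<omega> * (indicator {t..t+h} r * (1 - i * (indicator {0..t+h} r * xi r \<omega>)))" for \<omega> r
  have th: "0 \<le> t + h" using t h by simp
  note [measurable] = progressive_M[OF th]
  have gm: "(\<lambda>x. ennreal (g (fst x) (snd x))) \<in> borel_measurable (M \<Otimes>\<^sub>M lborel)"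
  proof -
    have "(\<lambda>x. ennreal (g (fst x) (snd x))) \<in> borel_measurable (M \<Otimes>\<^sub>M borel)"
      unfolding g_def by measurable
    then show ?thesis by simp
  qed
  have g_eq: "g \<omega> r = 2 * indicator {\<omega> \<in> A. xi t \<omega> = i \<and> xi r \<omega> = -i} \<omega>" if "r \<in> {t..t+h}" "\<omega> \<in> space M" for \<omega> r
    using that i xi_values[of r \<omega>] t A(2)[of \<omega>] by (auto simp: g_def indicator_def)
  have inner: "(\<integral>\<^sup>+r. ennreal (g \<omega> r) \<partial>lborel) = ennreal (indicator A \<omega> * (h - i * integral {t..t+h} (\<lambda>r. xi r \<omega>)))"
    if w: "\<omega> \<in> space M" for \<omega>
  proof -
    have int: "(\<lambda>r. 1 - i * xi r \<omega>) integrable_on {t..t+h}"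
      using w t h by (intro integrable_diff integrable_on_mult_right xi_integrable_on integrable_on_const) auto
    have "(\<integral>\<^sup>+r. ennreal (g \<omega> r) \<partial>lborel) = indicator A \<omega> * (\<integral>\<^sup>+r. ennreal (1 - i * (indicator {0..t+h} r * xi r \<omega>)) * indicator {t..t+h} r \<partial>lborel)"
    proof -
      have m: "(\<lambda>r. indicator {0..t+h} r * xi r \<omega>) \<in> borel_measurable borel"
        by (rule xi_section_measurable[OF th w])
      have "(\<integral>\<^sup>+r. ennreal (g \<omega> r) \<partial>lborel) = (\<integral>\<^sup>+r. indicator A \<omega> * (ennreal (1 - i * (indicator {0..t+h} r * xi r \<omega>)) * indicator {t..t+h} r) \<partial>lborel)"
        by (intro nn_integral_cong) (auto simp: g_def indicator_def)
      then show ?thesis using m by (subst (asm) nn_integral_cmult) auto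
    qed
    also have "(\<integral>\<^sup>+r. ennreal (1 - i * (indicator {0..t+h} r * xi r \<omega>)) * indicator {t..t+h} r \<partial>lborel) =
       ennreal (integral {t..t+h} (\<lambda>r. 1 - i * xi r \<omega>))"
    proof (rule nn_integral_has_integral_lebesgue')
      show "((\<lambda>r. 1 - i * (indicator {0..t+h} r * xi r \<omega>)) has_integral integral {t..t+h} (\<lambda>r. 1 - i * xi r \<omega>)) {t..t+h}"
        using integrable_integral[OF int] by (rule has_integral_eq[rotated]) (use t in \<open>auto simp: indicator_def\<close>)
      show "0 \<le> 1 - i * (indicator {0..t+h} r * xi r \<omega>)" for r
        using i xi_values[of r \<omega>] w by (auto simp: indicator_def)
    qed
    also have "integral {t..t+h} (\<lambda>r. 1 - i * xi r \<omega>) = h - i * integral {t..t+h} (\<lambda>r. xi r \<omega>)"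
      using w t h xi_integrable_on[of t "t+h" \<omega>]
      by (subst Henstock_Kurzweil_Integration.integral_diff) (auto intro: integrable_on_mult_right)
    finally show ?thesis by (simp add: indicator_def)
  qed
  interpret P: pair_sigma_finite M lborel ..
  have "(\<integral>\<^sup>+\<omega>. ennreal (indicator A \<omega> * (h - i * integral {t..t+h} (\<lambda>r. xi r \<omega>))) \<partial>M) =
        (\<integral>\<^sup>+\<omega>. (\<integral>\<^sup>+r. ennreal (g \<omega> r) \<partial>lborel) \<partial>M)"
    by (intro nn_integral_cong) (simp add: inner)
  \<comment> \<open>After the exchange, the inner integral at a fixed \<open>r\<close> is at most
    \<open>2 * p (r - t) i (-i)\<close>, hence at most \<open>2 * K * h\<close>; integration over an
    interval of length \<open>h\<close> yields the second order.\<close>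
  also have "\<dots> = (\<integral>\<^sup>+r. (\<integral>\<^sup>+\<omega>. ennreal (g \<omega> r) \<partial>M) \<partial>lborel)"
    using P.Fubini[OF gm] by simp
  also have "\<dots> \<le> (\<integral>\<^sup>+r. ennreal (2 * K * h) * indicator {t..t+h} r \<partial>lborel)"
  proof (intro nn_integral_mono)
    fix r
    show "(\<integral>\<^sup>+\<omega>. ennreal (g \<omega> r) \<partial>M) \<le> ennreal (2 * K * h) * indicator {t..t+h} r"
    proof (cases "r \<in> {t..t+h}")
      case True
      have set: "{\<omega> \<in> A. xi t \<omega> = i \<and> xi r \<omega> = -i} = A \<inter> {\<omega> \<in> space M. xi t \<omega> = i \<and> xi r \<omega> = -i}" using As by auto
      have [measurable]: "xi t \<in> borel_measurable M" "xi r \<in> borel_measurable M"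
        using t True by auto
      have "(\<integral>\<^sup>+\<omega>. ennreal (g \<omega> r) \<partial>M) = (\<integral>\<^sup>+\<omega>. ennreal 2 * indicator {\<omega> \<in> A. xi t \<omega> = i \<and> xi r \<omega> = -i} \<omega> \<partial>M)"
        by (intro nn_integral_cong) (simp add: g_eq[OF True] ennreal_mult ennreal_indicator)
      also have "\<dots> = ennreal 2 * emeasure M {\<omega> \<in> A. xi t \<omega> = i \<and> xi r \<omega> = -i}"
        by (rule nn_integral_cmult_indicator) (simp add: set)
      also have "\<dots> = ennreal (2 * (measure M {\<omega> \<in> A. xi t \<omega> = i} * p (r - t) i (-i)))"
      proof -
        have "measure M {\<omega> \<in> A. xi t \<omega> = i \<and> xi r \<omega> = -i} = measure M {\<omega> \<in> A. xi t \<omega> = i} * p (r - t) i (-i)"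
          using p_spec(2)[OF t _ A(1) i, of "r - t" "-i"] True i by auto
        note this[symmetric]
        then show ?thesis
          by (simp only: emeasure_eq_measure) (rule ennreal_mult[symmetric], simp_all)
      qed
      also have "\<dots> \<le> ennreal (2 * (1 * (K * h)))"
      proof -
        have "p (r - t) i (-i) \<le> K * (r - t)" using K(2) True by auto
        also have "\<dots> \<le> K * h" using True K(1) by (intro mult_left_mono) auto
        finally have "p (r - t) i (-i) \<le> K * h" .
        moreover have "0 \<le> p (r - t) i (-i)" using p_nonneg True i by auto
        ultimately show ?thesis by (intro ennreal_leI mult_left_mono mult_mono) auto
      qed
      finally show ?thesis using True by (simp add: mult.assoc)
    qed (simp add: g_def)
  qed
  also have "\<dots> = ennreal (2 * K * h) * ennreal h" using h by (subst nn_integral_cmult_indicator) auto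
  also have "\<dots> = ennreal (2 * K * h\<^sup>2)" using K(1) h by (simp add: ennreal_mult[symmetric] power2_eq_square)
  finally have "(\<integral>\<^sup>+\<omega>. ennreal (indicator A \<omega> * (h - i * integral {t..t+h} (\<lambda>r. xi r \<omega>))) \<partial>M) \<le> ennreal (2 * K * h\<^sup>2)" .
  then show ?thesis
    by (rule integral_real_bounded[rotated]) (use K(1) in simp)
qed

subsection \<open>Discrete supermartingales\<close>

lemma phi_measurable:
  assumes "supersolution mu sig lambda rho \<phi>" "0 \<le> t"
  shows "(\<lambda>\<omega>. \<phi> (xi t \<omega>) (Y t \<omega>)) \<in> borel_measurable M"
proof -
  have [measurable]: "\<phi> 1 \<in> borel_measurable borel" "\<phi> (-1) \<in> borel_measurable borel"
    using assms(1) unfolding supersolution_def by auto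
  note [measurable] = xi_measurable[OF assms(2)] Y_measurable[OF assms(2)]
  have "(\<lambda>\<omega>. if xi t \<omega> = 1 then \<phi> 1 (Y t \<omega>) else \<phi> (-1) (Y t \<omega>)) \<in> borel_measurable M"
    by measurable
  then show ?thesis
    by (rule measurable_cong[THEN iffD1, rotated]) (use xi_values[OF assms(2)] in force)
qed

lemma Y_range:
  assumes "0 \<le> t" "t \<le> T" "\<omega> \<in> space M"
  shows "Y t \<omega> \<in> {0..y * exp ((mu + sig) * T)}"
proof -
  have "y * exp ((mu + sig) * t) \<le> y * exp ((mu + sig) * T)"
    using assms(1,2) mu_pos sig_pos y_nonneg by (intro mult_left_mono) auto
  then show ?thesis using Y_le[OF assms(1,3)] Y_nonneg[of t \<omega>] by auto
qed

lemma phi_bounded: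
  assumes "supersolution mu sig lambda rho \<phi>" "0 \<le> T"
  obtains m where "0 \<le> m" "\<And>i u. i \<in> {-1, 1} \<Longrightarrow> u \<in> {0..y * exp ((mu + sig) * T)} \<Longrightarrow> \<bar>\<phi> i u\<bar> \<le> m"
proof -
  define R where "R = y * exp ((mu + sig) * T)"
  have R: "R \<ge> 0" unfolding R_def using y_nonneg by simp
  obtain L where L: "\<And>i. i \<in> {-1, 1} \<Longrightarrow> L-lipschitz_on {0..R} (\<phi> i)" "0 \<le> L"
    using supersolution_lipschitz[OF assms(1)] by blast
  have "\<bar>\<phi> i u\<bar> \<le> L * R" if "i \<in> {-1, 1}" "u \<in> {0..R}" for i u
  proof -
    have "\<phi> i 0 = 0" using assms(1) that(1) unfolding supersolution_def by blast
    then have "\<bar>\<phi> i u\<bar> \<le> L * u"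
      using lipschitz_onD[OF L(1)[OF that(1)] that(2), of 0] R that(2) by (simp add: dist_real_def)
    also have "\<dots> \<le> L * R" using that L(2) by (intro mult_left_mono) auto
    finally show ?thesis .
  qed
  then show thesis using that[of "L * R"] L(2) R unfolding R_def by simp
qed

lemma phi_integrable:
  assumes "supersolution mu sig lambda rho \<phi>" "0 \<le> t"
  shows "integrable M (\<lambda>\<omega>. \<phi> (xi t \<omega>) (Y t \<omega>))"
proof -
  obtain m where m: "\<And>i u. i \<in> {-1, 1} \<Longrightarrow> u \<in> {0..y * exp ((mu + sig) * t)} \<Longrightarrow> \<bar>\<phi> i u\<bar> \<le> m"
    using phi_bounded[OF assms] by metis
  show ?thesis
  proof (rule integrable_const_bound[OF _ phi_measurable[OF assms], of m], rule AE_I2)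
    fix \<omega> assume "\<omega> \<in> space M"
    then show "norm (\<phi> (xi t \<omega>) (Y t \<omega>)) \<le> m"
      using m[OF _ Y_range[OF assms(2) order_refl]] xi_values[OF assms(2), of \<omega>] by auto
  qed
qed

text \<open>The price at \<open>t + h\<close> is compared with a reference point known at time
  \<open>t\<close>: the end \<open>u1\<close> of the flow if the chain is again in \<open>i\<close>,
  and \<open>Y t\<close> itself if it is in \<open>-i\<close>. In the first case the deviation is
  controlled by the time spent away, of expectation \<open>O(h\<^sup>2)\<close>; in the second it is
  \<open>O(h)\<close> on an event of probability \<open>O(h)\<close>. The constant
  \<open>3 * sig + mu\<close> is \<open>2 * sig + (mu + sig)\<close>, one summand for each
  case.\<close>

lemma one_step:
  assumes S: "supersolution mu sig lambda rho \<phi>"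
    and L: "\<And>k. k \<in> {-1, 1} \<Longrightarrow> L-lipschitz_on {0..R} (\<phi> k)"
    and t: "0 \<le> t" and h: "0 \<le> h" and R: "y * exp ((mu + sig) * (t + h)) \<le> R"
    and i: "i \<in> {-1, 1}" and A: "A \<in> sets (F t)" "\<And>\<omega>. \<omega> \<in> A \<Longrightarrow> xi t \<omega> = i"
    and K: "0 \<le> K" "\<And>r. 0 \<le> r \<Longrightarrow> r \<le> h \<Longrightarrow> p r i (-i) \<le> K * r"
    and step: "\<And>u. u \<in> {0..R} \<Longrightarrow> c * ((1 - p h i (-i)) * \<phi> i (u * exp ((mu + sig * i) * h))
        + p h i (-i) * \<phi> (-i) u) \<le> \<phi> i u + \<epsilon>"
    and c: "0 \<le> c" "c \<le> 1" and \<epsilon>: "0 \<le> \<epsilon>"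
  shows "(\<integral>\<omega>. indicator A \<omega> * (c * \<phi> (xi (t + h) \<omega>) (Y (t + h) \<omega>)) \<partial>M)
    \<le> (\<integral>\<omega>. indicator A \<omega> * \<phi> (xi t \<omega>) (Y t \<omega>) \<partial>M) + \<epsilon> + L * R * K * (3 * sig + mu) * h\<^sup>2"
proof -
  have AM [measurable]: "A \<in> sets M" using A sets_F_subset by blast
  have AF [measurable]: "A \<in> sets (F t)" by (rule A(1))
  have As: "A \<subseteq> space M" using sets.sets_into_space[OF AM] .
  have neg: "-i \<in> {-1, 1}" using i by auto
  have th: "0 \<le> t + h" using t h by simp
  have L0: "0 \<le> L" using lipschitz_on_nonneg[OF L[OF i]] .
  have R0: "0 \<le> R" using R y_nonneg by (meson exp_ge_zero mult_nonneg_nonneg order_trans)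
  define b where "b = mu + sig * i"
  define I where "I \<omega> = integral {t..t+h} (\<lambda>r. xi r \<omega>)" for \<omega>
  define D where "D \<omega> = h - i * I \<omega>" for \<omega>
  define stay where "stay = {\<omega>. xi t \<omega> = i \<and> xi (t + h) \<omega> = i}"
  define flip where "flip = {\<omega>. xi t \<omega> = i \<and> xi (t + h) \<omega> = -i}"
  define u1 where "u1 \<omega> = Y t \<omega> * exp (b * h)" for \<omega>
  have [measurable]: "\<phi> i \<in> borel_measurable borel" "\<phi> (-i) \<in> borel_measurable borel"
    using S i neg unfolding supersolution_def by blast+
  note meas [measurable] = xi_measurable[OF t] xi_measurable[OF th] Y_measurable[OF t] Y_measurable[OF th]
  have stay_m [measurable]: "indicator stay \<in> borel_measurable M" and flip_m [measurable]: "indicator flip \<in> borel_measurable M"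
    unfolding stay_def flip_def by measurable
  have I_eq: "I \<omega> = integral {0..t+h} (\<lambda>r. xi r \<omega>) - integral {0..t} (\<lambda>r. xi r \<omega>)" if "\<omega> \<in> space M" for \<omega>
    using Henstock_Kurzweil_Integration.integral_combine[OF t, of "t + h" "\<lambda>r. xi r \<omega>"]
      xi_integrable_on[of 0 "t + h" \<omega>] that t h
    unfolding I_def by (simp add: eq_diff_eq add.commute)
  have [measurable]: "(\<lambda>\<omega>. integral {0..t+h} (\<lambda>r. xi r \<omega>)) \<in> borel_measurable M"
     "(\<lambda>\<omega>. integral {0..t} (\<lambda>r. xi r \<omega>)) \<in> borel_measurable M"
    using integral_xi_measurable[OF th] integral_xi_measurable[OF t] measurable_from_F by blast+
  have [measurable]: "I \<in> borel_measurable M"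
    by (subst measurable_cong[OF I_eq]) measurable
  have [measurable]: "D \<in> borel_measurable M" unfolding D_def by measurable
  have I_b: "\<bar>I \<omega>\<bar> \<le> h" if "\<omega> \<in> space M" for \<omega>
    unfolding I_def using integral_xi_bound[OF t h that] .
  have D_b: "0 \<le> D \<omega>" "D \<omega> \<le> 2 * h" if "\<omega> \<in> space M" for \<omega>
    using I_b[OF that] i unfolding D_def by auto
  have Yt: "Y t \<omega> \<in> {0..R}" "Y (t + h) \<omega> \<in> {0..R}" "u1 \<omega> \<in> {0..R}" "Y t \<omega> * exp ((mu + sig) * h) \<le> R" if "\<omega> \<in> space M" for \<omega>
  proof -
    show "Y t \<omega> \<in> {0..R}" "Y (t + h) \<omega> \<in> {0..R}"
      using Y_range[OF t _ that, of "t + h"] Y_range[OF th order_refl that] R h by auto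
    have "Y t \<omega> * exp ((mu + sig) * h) \<le> y * exp ((mu + sig) * t) * exp ((mu + sig) * h)"
      using Y_le[OF t that] by (intro mult_right_mono) auto
    also have "\<dots> = y * exp ((mu + sig) * (t + h))" by (simp add: exp_add distrib_left mult.assoc)
    finally show *: "Y t \<omega> * exp ((mu + sig) * h) \<le> R" using R by simp
    have "b * h \<le> (mu + sig) * h" unfolding b_def using i sig_pos h by (intro mult_right_mono) auto
    then have "u1 \<omega> \<le> Y t \<omega> * exp ((mu + sig) * h)" unfolding u1_def using Y_nonneg by (intro mult_left_mono) auto
    then show "u1 \<omega> \<in> {0..R}" using * Y_nonneg unfolding u1_def by auto
  qed
  have lip: "\<bar>\<phi> k u - \<phi> k v\<bar> \<le> L * \<bar>u - v\<bar>" if "k \<in> {-1, 1}" "u \<in> {0..R}" "v \<in> {0..R}" for k u v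
    using lipschitz_onD[OF L[OF that(1)] that(2,3)] by (simp add: dist_real_def)
  have Ydiff: "\<bar>Y (t + h) \<omega> - Y t \<omega> * exp v\<bar> \<le> R * \<bar>mu * h + sig * I \<omega> - v\<bar>" if w: "\<omega> \<in> space M" and v: "v \<le> (mu + sig) * h" for v \<omega>
  proof -
    have "\<bar>exp (mu * h + sig * I \<omega>) - exp v\<bar> \<le> exp ((mu + sig) * h) * \<bar>mu * h + sig * I \<omega> - v\<bar>"
      using log_increment_bound[OF t h w] v unfolding I_def by (intro exp_diff_le) auto
    then have "Y t \<omega> * \<bar>exp (mu * h + sig * I \<omega>) - exp v\<bar> \<le> Y t \<omega> * (exp ((mu + sig) * h) * \<bar>mu * h + sig * I \<omega> - v\<bar>)"
      using Y_nonneg by (intro mult_left_mono)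
    also have "\<dots> \<le> R * \<bar>mu * h + sig * I \<omega> - v\<bar>"
      using mult_right_mono[OF Yt(4)[OF w], of "\<bar>mu * h + sig * I \<omega> - v\<bar>"] by (simp add: mult.assoc)
    finally have "Y t \<omega> * \<bar>exp (mu * h + sig * I \<omega>) - exp v\<bar> \<le> R * \<bar>mu * h + sig * I \<omega> - v\<bar>" .
    moreover have "Y (t + h) \<omega> - Y t \<omega> * exp v = Y t \<omega> * (exp (mu * h + sig * I \<omega>) - exp v)"
      unfolding Y_increment[OF t h w] I_def by (simp add: right_diff_distrib)
    ultimately show ?thesis using Y_nonneg[of t \<omega>] by (simp add: abs_mult)
  qed
  \<comment> \<open>\<open>G\<close> consists of \<open>F t\<close>-measurable factors times the
    indicators of \<open>stay\<close> and \<open>flip\<close>, the form required by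
    \<open>markov_integral\<close>; \<open>Err\<close> collects the Lipschitz errors.\<close>
  define G where "G \<omega> = indicator stay \<omega> * (indicator A \<omega> * \<phi> i (u1 \<omega>))
     + indicator flip \<omega> * (indicator A \<omega> * \<phi> (-i) (Y t \<omega>))" for \<omega>
  define Err where "Err \<omega> = L * R * (sig * (indicator A \<omega> * D \<omega>) + (mu + sig) * h * (indicator flip \<omega> * indicator A \<omega>))" for \<omega>
  have pointwise: "indicator A \<omega> * \<phi> (xi (t + h) \<omega>) (Y (t + h) \<omega>) \<le> G \<omega> + Err \<omega>" if w: "\<omega> \<in> space M" for \<omega>
  proof (cases "\<omega> \<in> A")
    case True
    note xit = A(2)[OF True]
    show ?thesis
    proof (cases "xi (t + h) \<omega> = i")
      case stayed: True
      have "i \<noteq> -i" using i by auto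
      have "\<bar>\<phi> i (Y (t + h) \<omega>) - \<phi> i (u1 \<omega>)\<bar> \<le> L * \<bar>Y (t + h) \<omega> - u1 \<omega>\<bar>"
        by (rule lip[OF i Yt(2)[OF w] Yt(3)[OF w]])
      also have "\<bar>Y (t + h) \<omega> - u1 \<omega>\<bar> \<le> R * \<bar>mu * h + sig * I \<omega> - b * h\<bar>"
        unfolding u1_def using i sig_pos h by (intro Ydiff[OF w]) (auto simp: b_def intro!: mult_right_mono)
      \<comment> \<open>The chain may leave \<open>i\<close> and return before \<open>t + h\<close>,
        so even here the price can deviate from the flow; the deviation of its logarithm is a
        multiple of \<open>D\<close>.\<close>
      also have "mu * h + sig * I \<omega> - b * h = - (sig * i * D \<omega>)"
        using i unfolding b_def D_def by (auto simp: algebra_simps)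
      also have "\<bar>- (sig * i * D \<omega>)\<bar> = sig * D \<omega>"
        using i sig_pos D_b[OF w] by (auto simp: abs_mult)
      finally have "\<phi> i (Y (t + h) \<omega>) \<le> \<phi> i (u1 \<omega>) + L * R * (sig * D \<omega>)"
        using L0 by (simp add: mult.assoc mult_left_mono)
      then show ?thesis using True stayed xit \<open>i \<noteq> -i\<close> by (simp add: G_def Err_def stay_def flip_def)
    next
      case False
      then have fl: "xi (t + h) \<omega> = -i" using xi_values[OF th w] i by auto
      have "i \<noteq> -i" using i by auto
      have "\<bar>\<phi> (-i) (Y (t + h) \<omega>) - \<phi> (-i) (Y t \<omega>)\<bar> \<le> L * \<bar>Y (t + h) \<omega> - Y t \<omega>\<bar>"
        by (rule lip[OF neg Yt(2)[OF w] Yt(1)[OF w]])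
      also have "\<bar>Y (t + h) \<omega> - Y t \<omega>\<bar> \<le> R * \<bar>mu * h + sig * I \<omega>\<bar>"
        using Ydiff[OF w, of 0] mu_pos sig_pos h by simp
      also have "\<bar>mu * h + sig * I \<omega>\<bar> \<le> (mu + sig) * h"
        using log_increment_bound[OF t h w] unfolding I_def .
      finally have "\<phi> (-i) (Y (t + h) \<omega>) \<le> \<phi> (-i) (Y t \<omega>) + L * R * ((mu + sig) * h)"
        using L0 R0 by (simp add: mult.assoc mult_left_mono)
      moreover have "0 \<le> L * R * (sig * D \<omega>)" using L0 R0 sig_pos D_b[OF w] by simp
      ultimately show ?thesis using True fl xit \<open>i \<noteq> -i\<close>
        by (simp add: G_def Err_def stay_def flip_def distrib_left)
    qed
  qed (use L0 R0 in \<open>simp add: G_def Err_def\<close>)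
  obtain m where m: "\<And>k u. k \<in> {-1, 1} \<Longrightarrow> u \<in> {0..R} \<Longrightarrow> \<bar>\<phi> k u\<bar> \<le> m" "0 \<le> m"
  proof (rule that[of "L * R"])
    fix k u assume ku: "k \<in> {-1, 1::real}" "u \<in> {0..R}"
    have "\<phi> k 0 = 0" using S ku(1) unfolding supersolution_def by blast
    then have "\<bar>\<phi> k u\<bar> \<le> L * u" using lip[OF ku, of 0] R0 ku by simp
    also have "\<dots> \<le> L * R" using ku L0 by (intro mult_left_mono) auto
    finally show "\<bar>\<phi> k u\<bar> \<le> L * R" .
  qed (use L0 R0 in simp)
  have int1: "integrable M (\<lambda>\<omega>. indicator A \<omega> * \<phi> i (u1 \<omega>))" "integrable M (\<lambda>\<omega>. indicator A \<omega> * \<phi> (-i) (Y t \<omega>))"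
    "integrable M (\<lambda>\<omega>. indicator A \<omega> * D \<omega>)" "integrable M (\<lambda>\<omega>. indicator flip \<omega> * indicator A \<omega> :: real)"
    "integrable M (\<lambda>\<omega>. indicator stay \<omega> * (indicator A \<omega> * \<phi> i (u1 \<omega>)))"
    "integrable M (\<lambda>\<omega>. indicator flip \<omega> * (indicator A \<omega> * \<phi> (-i) (Y t \<omega>)))"
    "integrable M (\<lambda>\<omega>. indicator A \<omega> :: real)"
  proof -
    have u1m [measurable]: "u1 \<in> borel_measurable M" unfolding u1_def by measurable
    show "integrable M (\<lambda>\<omega>. indicator A \<omega> * \<phi> i (u1 \<omega>))"
      by (rule integrable_const_bound[of _ m]) (use m i Yt in \<open>auto split: split_indicator\<close>)
    show "integrable M (\<lambda>\<omega>. indicator A \<omega> * \<phi> (-i) (Y t \<omega>))"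
      by (rule integrable_const_bound[of _ m]) (use m neg Yt in \<open>auto split: split_indicator\<close>)
    show "integrable M (\<lambda>\<omega>. indicator A \<omega> * D \<omega>)"
      by (rule integrable_const_bound[of _ "2 * h"]) (use h D_b in \<open>auto split: split_indicator\<close>)
    show "integrable M (\<lambda>\<omega>. indicator flip \<omega> * indicator A \<omega> :: real)"
      by (rule integrable_const_bound[of _ 1]) (auto split: split_indicator)
    show "integrable M (\<lambda>\<omega>. indicator stay \<omega> * (indicator A \<omega> * \<phi> i (u1 \<omega>)))"
      by (rule integrable_const_bound[of _ m]) (use m i Yt in \<open>auto split: split_indicator\<close>)
    show "integrable M (\<lambda>\<omega>. indicator flip \<omega> * (indicator A \<omega> * \<phi> (-i) (Y t \<omega>)))"
      by (rule integrable_const_bound[of _ m]) (use m neg Yt in \<open>auto split: split_indicator\<close>)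
    show "integrable M (\<lambda>\<omega>. indicator A \<omega> :: real)"
      by (rule integrable_const_bound[of _ 1]) (auto split: split_indicator)
  qed
  have ind: "(\<integral>\<omega>. indicator {\<omega>. xi t \<omega> = i} \<omega> * (indicator A \<omega> * f \<omega>) \<partial>M) = (\<integral>\<omega>. indicator A \<omega> * f \<omega> \<partial>M)" for f :: "'w \<Rightarrow> real"
    by (intro Bochner_Integration.integral_cong) (auto simp: A(2) split: split_indicator)
  define q where "q = p h i (-i)"
  have q: "0 \<le> q" "q \<le> K * h" unfolding q_def using p_nonneg[OF h i neg] K(2)[OF h order_refl] by auto
  have YF [measurable]: "Y t \<in> borel_measurable (F t)" by (rule Y_measurable_F[OF t])
  have u1F [measurable]: "u1 \<in> borel_measurable (F t)" unfolding u1_def by measurable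
  have EG: "(\<integral>\<omega>. G \<omega> \<partial>M) = (1 - q) * (\<integral>\<omega>. indicator A \<omega> * \<phi> i (u1 \<omega>) \<partial>M) + q * (\<integral>\<omega>. indicator A \<omega> * \<phi> (-i) (Y t \<omega>) \<partial>M)"
  proof -
    have "(\<integral>\<omega>. G \<omega> \<partial>M) = (\<integral>\<omega>. indicator stay \<omega> * (indicator A \<omega> * \<phi> i (u1 \<omega>)) \<partial>M) + (\<integral>\<omega>. indicator flip \<omega> * (indicator A \<omega> * \<phi> (-i) (Y t \<omega>)) \<partial>M)"
      unfolding G_def by (intro Bochner_Integration.integral_add int1)
    also have "(\<integral>\<omega>. indicator stay \<omega> * (indicator A \<omega> * \<phi> i (u1 \<omega>)) \<partial>M) = p h i i * (\<integral>\<omega>. indicator A \<omega> * \<phi> i (u1 \<omega>) \<partial>M)"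
      unfolding stay_def by (subst markov_integral[OF t h i i]) (measurable, simp add: ind)
    also have "(\<integral>\<omega>. indicator flip \<omega> * (indicator A \<omega> * \<phi> (-i) (Y t \<omega>)) \<partial>M) = q * (\<integral>\<omega>. indicator A \<omega> * \<phi> (-i) (Y t \<omega>) \<partial>M)"
      unfolding flip_def q_def by (subst markov_integral[OF t h i neg]) (measurable, simp add: ind)
    finally show ?thesis unfolding p_diag[OF h i] q_def .
  qed
  have EErr: "(\<integral>\<omega>. Err \<omega> \<partial>M) \<le> L * R * K * (3 * sig + mu) * h\<^sup>2"
  proof -
    have 1: "(\<integral>\<omega>. indicator A \<omega> * D \<omega> \<partial>M) \<le> 2 * K * h\<^sup>2"
      unfolding D_def I_def by (rule excursion_bound[OF t h i A K])
    have "(\<integral>\<omega>. indicator flip \<omega> * indicator A \<omega> \<partial>M) = q * (\<integral>\<omega>. indicator {\<omega>. xi t \<omega> = i} \<omega> * indicator A \<omega> \<partial>M)"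
      unfolding flip_def q_def by (rule markov_integral[OF t h i neg]) measurable
    also have "\<dots> = q * measure M A"
      using ind[of "\<lambda>_. 1"] As by (simp add: Int_absorb2)
    also have "\<dots> \<le> (K * h) * 1" using q by (intro mult_mono) auto
    finally have 2: "(\<integral>\<omega>. indicator flip \<omega> * indicator A \<omega> \<partial>M) \<le> K * h" by simp
    have "(\<integral>\<omega>. Err \<omega> \<partial>M) = L * R * (sig * (\<integral>\<omega>. indicator A \<omega> * D \<omega> \<partial>M) + (mu + sig) * h * (\<integral>\<omega>. indicator flip \<omega> * indicator A \<omega> \<partial>M))"
      unfolding Err_def using int1(3,4) by simp
    also have "\<dots> \<le> L * R * (sig * (2 * K * h\<^sup>2) + (mu + sig) * h * (K * h))"
      using 1 2 L0 R0 sig_pos mu_pos h by (intro mult_left_mono add_mono) auto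
    also have "\<dots> = L * R * K * (3 * sig + mu) * h\<^sup>2" by (simp add: algebra_simps power2_eq_square)
    finally show ?thesis .
  qed
  have Err_int: "integrable M Err" unfolding Err_def using int1 by simp
  have G_int: "integrable M G" unfolding G_def using int1 by simp
  have "(\<integral>\<omega>. indicator A \<omega> * (c * \<phi> (xi (t + h) \<omega>) (Y (t + h) \<omega>)) \<partial>M) \<le> (\<integral>\<omega>. c * (G \<omega> + Err \<omega>) \<partial>M)"
  proof (rule integral_mono)
    show "integrable M (\<lambda>\<omega>. indicator A \<omega> * (c * \<phi> (xi (t + h) \<omega>) (Y (t + h) \<omega>)))"
      using integrable_real_mult_indicator[OF AM integrable_mult_right[of c, OF phi_integrable[OF S th]]]
      by (simp add: mult.commute)
    show "integrable M (\<lambda>\<omega>. c * (G \<omega> + Err \<omega>))" using G_int Err_int by simp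
    show "indicator A \<omega> * (c * \<phi> (xi (t + h) \<omega>) (Y (t + h) \<omega>)) \<le> c * (G \<omega> + Err \<omega>)" if "\<omega> \<in> space M" for \<omega>
      using mult_left_mono[OF pointwise[OF that] c(1)] by (simp add: mult.left_commute)
  qed
  also have "\<dots> = c * (\<integral>\<omega>. G \<omega> \<partial>M) + c * (\<integral>\<omega>. Err \<omega> \<partial>M)"
    using G_int Err_int by (simp add: distrib_left)
  also have "\<dots> \<le> c * (\<integral>\<omega>. G \<omega> \<partial>M) + L * R * K * (3 * sig + mu) * h\<^sup>2"
  proof -
    have "c * (\<integral>\<omega>. Err \<omega> \<partial>M) \<le> c * (L * R * K * (3 * sig + mu) * h\<^sup>2)" using EErr c by (intro mult_left_mono)
    also have "\<dots> \<le> 1 * (L * R * K * (3 * sig + mu) * h\<^sup>2)"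
      using c L0 R0 K(1) sig_pos mu_pos by (intro mult_right_mono) auto
    finally show ?thesis by simp
  qed
  also have "c * (\<integral>\<omega>. G \<omega> \<partial>M) = (\<integral>\<omega>. indicator A \<omega> * (c * ((1 - q) * \<phi> i (u1 \<omega>) + q * \<phi> (-i) (Y t \<omega>))) \<partial>M)"
  proof -
    have "c * (\<integral>\<omega>. G \<omega> \<partial>M) = (\<integral>\<omega>. c * ((1 - q) * (indicator A \<omega> * \<phi> i (u1 \<omega>)) + q * (indicator A \<omega> * \<phi> (-i) (Y t \<omega>))) \<partial>M)"
      unfolding EG using int1(1,2) by simp
    also have "\<dots> = (\<integral>\<omega>. indicator A \<omega> * (c * ((1 - q) * \<phi> i (u1 \<omega>) + q * \<phi> (-i) (Y t \<omega>))) \<partial>M)"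
      by (intro Bochner_Integration.integral_cong) (auto simp: algebra_simps)
    finally show ?thesis .
  qed
  also have "\<dots> \<le> (\<integral>\<omega>. indicator A \<omega> * \<phi> (xi t \<omega>) (Y t \<omega>) + \<epsilon> \<partial>M)"
  proof (rule integral_mono)
    have "integrable M (\<lambda>\<omega>. c * ((1 - q) * (indicator A \<omega> * \<phi> i (u1 \<omega>)) + q * (indicator A \<omega> * \<phi> (-i) (Y t \<omega>))))"
      using int1(1,2) by simp
    then show "integrable M (\<lambda>\<omega>. indicator A \<omega> * (c * ((1 - q) * \<phi> i (u1 \<omega>) + q * \<phi> (-i) (Y t \<omega>))))"
      by (rule Bochner_Integration.integrable_cong[THEN iffD1, rotated 2]) (auto simp: algebra_simps)
    show "integrable M (\<lambda>\<omega>. indicator A \<omega> * \<phi> (xi t \<omega>) (Y t \<omega>) + \<epsilon>)"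
      using integrable_real_mult_indicator[OF AM phi_integrable[OF S t]]
      by (intro Bochner_Integration.integrable_add) (simp_all add: mult.commute)
    show "indicator A \<omega> * (c * ((1 - q) * \<phi> i (u1 \<omega>) + q * \<phi> (-i) (Y t \<omega>))) \<le> indicator A \<omega> * \<phi> (xi t \<omega>) (Y t \<omega>) + \<epsilon>"
      if w: "\<omega> \<in> space M" for \<omega>
      using step[OF Yt(1)[OF w]] A(2)[of \<omega>] \<epsilon> unfolding u1_def q_def b_def by (auto split: split_indicator)
  qed
  also have "\<dots> = (\<integral>\<omega>. indicator A \<omega> * \<phi> (xi t \<omega>) (Y t \<omega>) \<partial>M) + \<epsilon>"
    using integrable_real_mult_indicator[OF AM phi_integrable[OF S t]]
    by (subst Bochner_Integration.integral_add) (simp_all add: mult.commute prob_space)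
  finally show ?thesis by simp
qed

text \<open>The event is split by the present state, which \<open>one_step\<close> needs fixed. Each
  piece may cost \<open>\<epsilon> / 2 * h\<close>: a quarter of \<open>\<epsilon> * h\<close> from
  the flow and a quarter from the second-order error. The step bound \<open>h0\<close> depends
  neither on \<open>t\<close> nor on the event, so the errors can be summed along a grid.\<close>

lemma uniform_step:
  assumes S: "supersolution mu sig lambda rho \<phi>" and ms: "mu < sig" and T: "0 \<le> T" and \<epsilon>: "0 < \<epsilon>"
  obtains h0 where "h0 > 0"
    "\<And>t h A. 0 \<le> t \<Longrightarrow> 0 < h \<Longrightarrow> h < h0 \<Longrightarrow> t + h \<le> T \<Longrightarrow> A \<in> sets (F t) \<Longrightarrow>
      (\<integral>\<omega>. indicator A \<omega> * (exp (- rho * h) * \<phi> (xi (t + h) \<omega>) (Y (t + h) \<omega>)) \<partial>M)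
       \<le> (\<integral>\<omega>. indicator A \<omega> * \<phi> (xi t \<omega>) (Y t \<omega>) \<partial>M) + \<epsilon> * h"
proof -
  define R where "R = y * exp ((mu + sig) * T)"
  have R: "0 \<le> R" unfolding R_def using y_nonneg by simp
  obtain L where L: "\<And>i. i \<in> {-1, 1} \<Longrightarrow> L-lipschitz_on {0..R} (\<phi> i)" "0 \<le> L"
    using supersolution_lipschitz[OF S] by blast
  obtain \<delta> h1 where fs: "\<delta> > 0" "h1 > 0"
    "\<And>h q i u. 0 < h \<Longrightarrow> h < h1 \<Longrightarrow> 0 \<le> q \<Longrightarrow> \<bar>q - lambda * h\<bar> \<le> \<delta> * h \<Longrightarrow> i \<in> {-1, 1} \<Longrightarrow> u \<in> {0..R} \<Longrightarrow>
       exp (- rho * h) * ((1 - q) * \<phi> i (u * exp ((mu + sig * i) * h)) + q * \<phi> (-i) u) \<le> \<phi> i u + \<epsilon> / 4 * h"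
    using flow_step[OF S mu_pos ms lambda_pos rho_pos R, of "\<epsilon> / 4"] \<epsilon> by (metis divide_pos_pos zero_less_numeral)
  obtain h2 where h2: "h2 > 0" "\<And>h i. 0 \<le> h \<Longrightarrow> h < h2 \<Longrightarrow> i \<in> {-1, 1} \<Longrightarrow> \<bar>p h i (-i) - lambda * h\<bar> \<le> \<delta> * h"
    using p_asymp[OF fs(1)] by blast
  obtain h3 where h3: "h3 > 0" "\<And>h i. 0 \<le> h \<Longrightarrow> h < h3 \<Longrightarrow> i \<in> {-1, 1} \<Longrightarrow> \<bar>p h i (-i) - lambda * h\<bar> \<le> lambda * h"
    using p_asymp[OF lambda_pos] by blast
  define C where "C = L * R * (2 * lambda) * (3 * sig + mu)"
  have C: "0 \<le> C" unfolding C_def using L(2) R lambda_pos sig_pos mu_pos by auto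
  define h0 where "h0 = min (min h1 h2) (min h3 (\<epsilon> / (4 * C + 4)))"
  show thesis
  proof (rule that[of h0])
    show "h0 > 0" unfolding h0_def using fs(2) h2(1) h3(1) \<epsilon> C by auto
    fix t h A assume t: "0 \<le> t" and h: "0 < h" "h < h0" and th: "t + h \<le> T" and A: "A \<in> sets (F t)"
    have hh: "h < h1" "h < h2" "h < h3" "h < \<epsilon> / (4 * C + 4)" using h(2) unfolding h0_def by auto
    have Ch: "C * h \<le> \<epsilon> / 4"
    proof -
      have "h * (4 * C + 4) < \<epsilon>" using hh(4) C by (simp add: less_divide_eq)
      then show ?thesis using h(1) by (simp add: algebra_simps)
    qed
    define Ai where "Ai i = A \<inter> {\<omega> \<in> space M. xi t \<omega> = i}" for i
    have Ai: "Ai i \<in> sets (F t)" for i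
    proof -
      have "{\<omega> \<in> space (F t). xi t \<omega> = i} \<in> sets (F t)"
        using xi_measurable_F[OF t order_refl] by measurable
      then show ?thesis unfolding Ai_def using A by simp
    qed
    have AM: "Ai i \<in> sets M" for i using Ai sets_F_subset by blast
    have As: "A \<subseteq> space M" using sets.sets_into_space A sets_F_subset by blast
    have step: "(\<integral>\<omega>. indicator (Ai i) \<omega> * (exp (- rho * h) * \<phi> (xi (t + h) \<omega>) (Y (t + h) \<omega>)) \<partial>M)
       \<le> (\<integral>\<omega>. indicator (Ai i) \<omega> * \<phi> (xi t \<omega>) (Y t \<omega>) \<partial>M) + \<epsilon> / 2 * h" if i: "i \<in> {-1, 1}" for i
    proof -
      have "(\<integral>\<omega>. indicator (Ai i) \<omega> * (exp (- rho * h) * \<phi> (xi (t + h) \<omega>) (Y (t + h) \<omega>)) \<partial>M)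
         \<le> (\<integral>\<omega>. indicator (Ai i) \<omega> * \<phi> (xi t \<omega>) (Y t \<omega>) \<partial>M) + \<epsilon> / 4 * h + L * R * (2 * lambda) * (3 * sig + mu) * h\<^sup>2"
      proof (rule one_step[OF S L(1) t _ _ i Ai])
        show "y * exp ((mu + sig) * (t + h)) \<le> R" unfolding R_def
          using th mu_pos sig_pos y_nonneg by (intro mult_left_mono) auto
        show "p r i (- i) \<le> 2 * lambda * r" if "0 \<le> r" "r \<le> h" for r
          using h3(2)[OF that(1) _ i] that hh(3) by (simp add: abs_le_iff)
        show "exp (- rho * h) * ((1 - p h i (- i)) * \<phi> i (u * exp ((mu + sig * i) * h)) + p h i (- i) * \<phi> (- i) u) \<le> \<phi> i u + \<epsilon> / 4 * h"
          if "u \<in> {0..R}" for u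
          by (rule fs(3)[OF h(1) hh(1) _ h2(2)[OF less_imp_le[OF h(1)] hh(2) i] i that])
            (use p_nonneg h i in auto)
        show "xi t \<omega> = i" if "\<omega> \<in> Ai i" for \<omega> using that unfolding Ai_def by simp
      qed (use h lambda_pos rho_pos \<epsilon> in auto)
      also have "\<dots> \<le> (\<integral>\<omega>. indicator (Ai i) \<omega> * \<phi> (xi t \<omega>) (Y t \<omega>) \<partial>M) + \<epsilon> / 2 * h"
        using mult_right_mono[OF Ch less_imp_le[OF h(1)]] unfolding C_def power2_eq_square by (simp add: mult.assoc)
      finally show ?thesis .
    qed
    have split: "(\<integral>\<omega>. indicator A \<omega> * f \<omega> \<partial>M) = (\<integral>\<omega>. indicator (Ai (-1)) \<omega> * f \<omega> \<partial>M) + (\<integral>\<omega>. indicator (Ai 1) \<omega> * f \<omega> \<partial>M)"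
      if f: "integrable M f" for f :: "'w \<Rightarrow> real"
    proof -
      have "integrable M (\<lambda>\<omega>. indicator (Ai i) \<omega> * f \<omega>)" for i
        using integrable_real_mult_indicator[OF AM f] by (simp add: mult.commute)
      then have "(\<integral>\<omega>. indicator (Ai (-1)) \<omega> * f \<omega> \<partial>M) + (\<integral>\<omega>. indicator (Ai 1) \<omega> * f \<omega> \<partial>M) =
         (\<integral>\<omega>. indicator (Ai (-1)) \<omega> * f \<omega> + indicator (Ai 1) \<omega> * f \<omega> \<partial>M)" by simp
      also have "\<dots> = (\<integral>\<omega>. indicator A \<omega> * f \<omega> \<partial>M)"
        by (intro Bochner_Integration.integral_cong refl)
          (use xi_values[OF t] in \<open>auto simp: Ai_def split: split_indicator\<close>)
      finally show ?thesis by simp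
    qed
    show "(\<integral>\<omega>. indicator A \<omega> * (exp (- rho * h) * \<phi> (xi (t + h) \<omega>) (Y (t + h) \<omega>)) \<partial>M)
       \<le> (\<integral>\<omega>. indicator A \<omega> * \<phi> (xi t \<omega>) (Y t \<omega>) \<partial>M) + \<epsilon> * h"
      using split[OF integrable_mult_right[of "exp (- rho * h)", OF phi_integrable[OF S, of "t + h"]]]
        split[OF phi_integrable[OF S t]] step[of "-1"] step[of 1] t h by simp
  qed
qed

section \<open>The completed filtration and optional sampling on a grid\<close>

lemma sets_completed:
  "sets (completed_natural_filtration M xi u) =
     sigma_sets (space M) (sets (natural_filtration M xi u) \<union> null_sets (completion M))"
  "space (completed_natural_filtration M xi u) = space M"
proof -
  have *: "sets (natural_filtration M xi u) \<union> null_sets (completion M) \<subseteq> Pow (space M)"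
    using sets.sets_into_space[of _ "natural_filtration M xi u"] sets.sets_into_space[of _ "completion M"] by fastforce
  show "sets (completed_natural_filtration M xi u) =
     sigma_sets (space M) (sets (natural_filtration M xi u) \<union> null_sets (completion M))"
    "space (completed_natural_filtration M xi u) = space M"
    unfolding completed_natural_filtration_def using * by (simp_all add: sets_measure_of space_measure_of)
qed

lemma F_subset_completed: "sets (natural_filtration M xi u) \<subseteq> sets (completed_natural_filtration M xi u)"
  unfolding sets_completed by auto

lemma completed_subset: "sets (completed_natural_filtration M xi u) \<subseteq> sets (completion M)"
proof -
  have "sets (natural_filtration M xi u) \<union> null_sets (completion M) \<subseteq> sets (completion M)"
    using sets_F_subset sets_completionI_sets by blast
  then have "sigma_sets (space (completion M)) (sets (natural_filtration M xi u) \<union> null_sets (completion M)) \<subseteq> sets (completion M)"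
    by (rule sets.sigma_sets_subset)
  then show ?thesis unfolding sets_completed by simp
qed

text \<open>Agreement up to a null set is stable under complements and countable unions, so
  induction over the generated sigma-algebra applies. The result moves stopping events into the
  natural filtration, where the Markov property is available.\<close>

lemma completed_approx:
  assumes "A \<in> sets (completed_natural_filtration M xi u)"
  shows "\<exists>A'\<in>sets (natural_filtration M xi u). AE \<omega> in M. \<omega> \<in> A \<longleftrightarrow> \<omega> \<in> A'"
  using assms unfolding sets_completed
proof (induction rule: sigma_sets.induct)
  case (Basic A)
  then show ?case
  proof
    assume "A \<in> null_sets (completion M)"
    then obtain N where "N \<in> null_sets M" "A \<subseteq> N" by (auto simp: null_sets_completion_iff2)
    have "AE \<omega> in M. \<omega> \<notin> N" by (rule AE_not_in) fact
    then have "AE \<omega> in M. \<omega> \<notin> A" by eventually_elim (use \<open>A \<subseteq> N\<close> in blast)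
    then show ?thesis by (intro bexI[of _ "{}"]) auto
  qed auto
next
  case Empty
  then show ?case by (intro bexI[of _ "{}"]) auto
next
  case (Compl A)
  then obtain A' where A': "A' \<in> sets (natural_filtration M xi u)" "AE \<omega> in M. \<omega> \<in> A \<longleftrightarrow> \<omega> \<in> A'" by blast
  have "space M - A' \<in> sets (natural_filtration M xi u)" using sets.compl_sets[OF A'(1)] by simp
  moreover have "AE \<omega> in M. \<omega> \<in> space M - A \<longleftrightarrow> \<omega> \<in> space M - A'" using A'(2) by auto
  ultimately show ?case by blast
next
  case (Union A)
  then have "\<forall>i. \<exists>A'. A' \<in> sets (natural_filtration M xi u) \<and> (AE \<omega> in M. \<omega> \<in> A i \<longleftrightarrow> \<omega> \<in> A')" by blast
  then obtain A' where A': "\<And>i. A' i \<in> sets (natural_filtration M xi u)" "\<And>i. AE \<omega> in M. \<omega> \<in> A i \<longleftrightarrow> \<omega> \<in> A' i"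
    by metis
  have "AE \<omega> in M. \<forall>i. \<omega> \<in> A i \<longleftrightarrow> \<omega> \<in> A' i" using A'(2) by (simp add: AE_all_countable)
  then have "AE \<omega> in M. \<omega> \<in> (\<Union>i. A i) \<longleftrightarrow> \<omega> \<in> (\<Union>i. A' i)" by eventually_elim auto
  moreover have "(\<Union>i. A' i) \<in> sets (natural_filtration M xi u)" using A'(1) by blast
  ultimately show ?case by blast
qed

abbreviation "discounted \<phi> t \<omega> \<equiv> exp (- rho * t) * \<phi> (xi t \<omega>) (Y t \<omega>)"

lemma discounted_integrable:
  "supersolution mu sig lambda rho \<phi> \<Longrightarrow> 0 \<le> t \<Longrightarrow> integrable (completion M) (\<lambda>\<omega>. discounted \<phi> t \<omega>)"
  using integrable_completion[of "\<lambda>\<omega>. discounted \<phi> t \<omega>" M] phi_integrable[of \<phi> t] by auto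

text \<open>Optional sampling by induction on \<open>n\<close>: from \<open>n\<close> to
  \<open>n + 1\<close> the stopped value changes only on the event \<open>n < N\<close>, known at
  time \<open>n * h\<close>, and there \<open>uniform_step\<close> applies. The tolerance per step
  is \<open>\<epsilon> / T * h\<close>, so at most \<open>T / h\<close> steps cost at most
  \<open>\<epsilon>\<close>.\<close>

lemma grid_supermartingale:
  assumes S: "supersolution mu sig lambda rho \<phi>" and ms: "mu < sig" and T: "0 < T" and \<epsilon>: "0 < \<epsilon>"
  obtains h0 where "h0 > 0"
    "\<And>h n N. 0 < h \<Longrightarrow> h < h0 \<Longrightarrow> real n * h \<le> T \<Longrightarrow>
       (\<And>k. k < n \<Longrightarrow> {\<omega> \<in> space M. k < N \<omega>} \<in> sets (Fc (real k * h))) \<Longrightarrow>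
       integrable (completion M) (\<lambda>\<omega>. discounted \<phi> (real (min (N \<omega>) n) * h) \<omega>) \<and>
       (\<integral>\<omega>. discounted \<phi> (real (min (N \<omega>) n) * h) \<omega> \<partial>completion M) \<le> \<phi> s y + \<epsilon>"
proof -
  have "0 < \<epsilon> / T" using \<epsilon> T by simp
  then obtain h0 where h0: "h0 > 0"
    "\<And>t h A. 0 \<le> t \<Longrightarrow> 0 < h \<Longrightarrow> h < h0 \<Longrightarrow> t + h \<le> T \<Longrightarrow> A \<in> sets (F t) \<Longrightarrow>
      (\<integral>\<omega>. indicator A \<omega> * (exp (- rho * h) * \<phi> (xi (t + h) \<omega>) (Y (t + h) \<omega>)) \<partial>M)
       \<le> (\<integral>\<omega>. indicator A \<omega> * \<phi> (xi t \<omega>) (Y t \<omega>) \<partial>M) + \<epsilon> / T * h"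
    using uniform_step[OF S ms less_imp_le[OF T]] by blast
  have main: "integrable (completion M) (\<lambda>\<omega>. discounted \<phi> (real (min (N \<omega>) n) * h) \<omega>) \<and>
       (\<integral>\<omega>. discounted \<phi> (real (min (N \<omega>) n) * h) \<omega> \<partial>completion M) \<le> \<phi> s y + \<epsilon> / T * (real n * h)"
    if h: "0 < h" "h < h0" and "real n * h \<le> T"
      and "\<And>k. k < n \<Longrightarrow> {\<omega> \<in> space M. k < N \<omega>} \<in> sets (Fc (real k * h))" for h n N
    using that(3,4)
  proof (induction n)
    case 0
    have "(\<integral>\<omega>. discounted \<phi> 0 \<omega> \<partial>completion M) = (\<integral>\<omega>. \<phi> (xi 0 \<omega>) y \<partial>M)"
      using integral_completion[of "\<lambda>\<omega>. discounted \<phi> 0 \<omega>" M] phi_measurable[OF S, of 0] by simp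
    also have "\<dots> = (\<integral>\<omega>. \<phi> s y \<partial>M)"
    proof (rule integral_cong_AE)
      show "(\<lambda>\<omega>. \<phi> (xi 0 \<omega>) y) \<in> borel_measurable M" using phi_measurable[OF S, of 0] by simp
      show "AE \<omega> in M. \<phi> (xi 0 \<omega>) y = \<phi> s y" using start by eventually_elim simp
    qed simp
    finally show ?case using discounted_integrable[OF S, of 0] by (simp add: prob_space)
  next
    case (Suc n)
    define A where "A = {\<omega> \<in> space M. n < N \<omega>}"
    have nT: "real n * h + h \<le> T" using Suc.prems(1) by (simp add: algebra_simps)
    have nh: "0 \<le> real n * h" using h by simp
    have IH: "integrable (completion M) (\<lambda>\<omega>. discounted \<phi> (real (min (N \<omega>) n) * h) \<omega>)"
       "(\<integral>\<omega>. discounted \<phi> (real (min (N \<omega>) n) * h) \<omega> \<partial>completion M) \<le> \<phi> s y + \<epsilon> / T * (real n * h)"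
      using Suc.IH Suc.prems h nT by auto
    have A: "A \<in> sets (Fc (real n * h))" unfolding A_def using Suc.prems(2) by simp
    then have Ac: "A \<in> sets (completion M)" using completed_subset by blast
    obtain A' where A': "A' \<in> sets (F (real n * h))" "AE \<omega> in M. \<omega> \<in> A \<longleftrightarrow> \<omega> \<in> A'"
      using completed_approx[OF A] by blast
    have AM: "A' \<in> sets M" using A' sets_F_subset by blast
    define Z where "Z k \<omega> = discounted \<phi> (real k * h) \<omega>" for k \<omega>
    have Zi: "integrable M (Z k)" for k
      unfolding Z_def using phi_integrable[OF S, of "real k * h"] h by simp
    have Zc: "integrable (completion M) (Z k)" for k
      unfolding Z_def using discounted_integrable[OF S, of "real k * h"] h by simp
    have eq: "discounted \<phi> (real (min (N \<omega>) (Suc n)) * h) \<omega> =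
        discounted \<phi> (real (min (N \<omega>) n) * h) \<omega> + indicator A \<omega> * (Z (Suc n) \<omega> - Z n \<omega>)"
      if "\<omega> \<in> space M" for \<omega>
    proof (cases "n < N \<omega>")
      case True
      then have "min (N \<omega>) (Suc n) = Suc n" "min (N \<omega>) n = n" by auto
      then show ?thesis using True that unfolding A_def Z_def by simp
    next
      case False
      then have "min (N \<omega>) (Suc n) = N \<omega>" "min (N \<omega>) n = N \<omega>" by auto
      then show ?thesis using False unfolding A_def by simp
    qed
    have di: "integrable (completion M) (\<lambda>\<omega>. indicator A \<omega> * (Z (Suc n) \<omega> - Z n \<omega>))"
      using integrable_real_mult_indicator[OF Ac Bochner_Integration.integrable_diff[OF Zc[of "Suc n"] Zc[of n]]]
      by (simp add: mult.commute)
    have 1: "integrable (completion M) (\<lambda>\<omega>. discounted \<phi> (real (min (N \<omega>) (Suc n)) * h) \<omega>)"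
      using Bochner_Integration.integrable_add[OF IH(1) di]
      by (rule Bochner_Integration.integrable_cong[THEN iffD2, rotated 2]) (use eq in simp_all)
    have "(\<integral>\<omega>. discounted \<phi> (real (min (N \<omega>) (Suc n)) * h) \<omega> \<partial>completion M) =
       (\<integral>\<omega>. discounted \<phi> (real (min (N \<omega>) n) * h) \<omega> + indicator A \<omega> * (Z (Suc n) \<omega> - Z n \<omega>) \<partial>completion M)"
      by (intro Bochner_Integration.integral_cong refl) (use eq in simp)
    also have "\<dots> = (\<integral>\<omega>. discounted \<phi> (real (min (N \<omega>) n) * h) \<omega> \<partial>completion M) +
       (\<integral>\<omega>. indicator A \<omega> * (Z (Suc n) \<omega> - Z n \<omega>) \<partial>completion M)"
      by (rule Bochner_Integration.integral_add[OF IH(1) di])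
    \<comment> \<open>The event is exchanged for an almost surely equal one in the natural
      filtration, which also brings the integral from the completion back to
      \<open>M\<close>.\<close>
    also have "(\<integral>\<omega>. indicator A \<omega> * (Z (Suc n) \<omega> - Z n \<omega>) \<partial>completion M) = (\<integral>\<omega>. indicator A' \<omega> * (Z (Suc n) \<omega> - Z n \<omega>) \<partial>M)"
    proof -
      have i': "integrable M (\<lambda>\<omega>. indicator A' \<omega> * (Z (Suc n) \<omega> - Z n \<omega>))"
        using integrable_real_mult_indicator[OF AM Bochner_Integration.integrable_diff[OF Zi[of "Suc n"] Zi[of n]]]
        by (simp add: mult.commute)
      have "(\<integral>\<omega>. indicator A \<omega> * (Z (Suc n) \<omega> - Z n \<omega>) \<partial>completion M) = (\<integral>\<omega>. indicator A' \<omega> * (Z (Suc n) \<omega> - Z n \<omega>) \<partial>completion M)"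
      proof (rule integral_cong_AE)
        show "AE \<omega> in completion M. indicator A \<omega> * (Z (Suc n) \<omega> - Z n \<omega>) = indicator A' \<omega> * (Z (Suc n) \<omega> - Z n \<omega>)"
          using AE_completion[OF A'(2)] by eventually_elim (auto split: split_indicator)
        show "(\<lambda>\<omega>. indicator A' \<omega> * (Z (Suc n) \<omega> - Z n \<omega>)) \<in> borel_measurable (completion M)"
          using i' by (intro measurable_completion borel_measurable_integrable)
      qed (use di in \<open>rule borel_measurable_integrable\<close>)
      also have "\<dots> = (\<integral>\<omega>. indicator A' \<omega> * (Z (Suc n) \<omega> - Z n \<omega>) \<partial>M)"
        using i' by (intro integral_completion borel_measurable_integrable)
      finally show ?thesis .
    qed
    also have "\<dots> \<le> \<epsilon> / T * h"
    proof -
      define e where "e = exp (- rho * (real n * h))"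
      have e: "0 \<le> e" "e \<le> 1" unfolding e_def using rho_pos nh by (auto simp: mult_nonneg_nonneg)
      have iZ: "integrable M (\<lambda>\<omega>. indicator A' \<omega> * Z k \<omega>)" for k
        using integrable_real_mult_indicator[OF AM Zi[of k]] by (simp add: mult.commute)
      have s: "real (Suc n) * h = real n * h + h" by (simp add: algebra_simps)
      have "(\<integral>\<omega>. indicator A' \<omega> * Z (Suc n) \<omega> \<partial>M) =
         e * (\<integral>\<omega>. indicator A' \<omega> * (exp (- rho * h) * \<phi> (xi (real n * h + h) \<omega>) (Y (real n * h + h) \<omega>)) \<partial>M)"
        unfolding integral_mult_right_zero[symmetric] Z_def e_def s
        by (intro Bochner_Integration.integral_cong refl)
          (simp add: distrib_left exp_add exp_diff exp_minus field_simps)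
      also have "\<dots> \<le> e * ((\<integral>\<omega>. indicator A' \<omega> * \<phi> (xi (real n * h) \<omega>) (Y (real n * h) \<omega>) \<partial>M) + \<epsilon> / T * h)"
        by (intro mult_left_mono h0(2)[OF nh h nT A'(1)] e)
      also have "\<dots> = (\<integral>\<omega>. indicator A' \<omega> * Z n \<omega> \<partial>M) + e * (\<epsilon> / T * h)"
        unfolding Z_def e_def distrib_left integral_mult_right_zero[symmetric] by (simp add: mult_ac)
      also have "\<dots> \<le> (\<integral>\<omega>. indicator A' \<omega> * Z n \<omega> \<partial>M) + 1 * (\<epsilon> / T * h)"
        using e \<epsilon> T h by (intro add_left_mono mult_right_mono) auto
      finally show ?thesis using iZ by (simp add: right_diff_distrib)
    qed
    finally show ?case using 1 IH(2) by (simp add: algebra_simps)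
  qed
  show thesis
  proof (rule that[OF h0(1)])
    fix h n N assume *: "0 < h" "h < h0" "real n * h \<le> T"
      "\<And>k. k < n \<Longrightarrow> {\<omega> \<in> space M. k < N \<omega>} \<in> sets (Fc (real k * h))"
    have "\<epsilon> / T * (real n * h) \<le> \<epsilon> / T * T" using *(3) \<epsilon> T by (intro mult_left_mono) auto
    also have "\<dots> = \<epsilon>" using T by simp
    finally show "integrable (completion M) (\<lambda>\<omega>. discounted \<phi> (real (min (N \<omega>) n) * h) \<omega>) \<and>
       (\<integral>\<omega>. discounted \<phi> (real (min (N \<omega>) n) * h) \<omega> \<partial>completion M) \<le> \<phi> s y + \<epsilon>"
      using main[OF *] by force
  qed
qed

subsection \<open>Bounds for the value function\<close>

abbreviation "Mc \<equiv> completion M"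

lemma prob_space_completion: "prob_space Mc"
  by (rule prob_spaceI) (simp add: emeasure_space_1)

lemma Y_measurable_c: "0 \<le> t \<Longrightarrow> Y t \<in> borel_measurable Mc"
  using Y_measurable measurable_completion by blast

lemma stopping_time_measurable:
  assumes "stopping_time (completed_natural_filtration M xi) \<tau>"
  shows "\<tau> \<in> borel_measurable Mc"
  by (rule measurable_stopping_time[OF assms]) (use completed_subset sets_completed in auto)

lemma grid_index_measurable:
  fixes \<tau> :: "'w \<Rightarrow> ennreal"
  assumes "\<tau> \<in> borel_measurable Mc"
  shows "(\<lambda>\<omega>. LEAST k. \<tau> \<omega> \<le> ennreal (real k * h) \<or> k = n) \<in> measurable Mc (count_space UNIV)"
  using assms by measurable

lemma reward_ennreal:
  "0 \<le> r \<Longrightarrow> reward xi mu sig a rho y (ennreal r) \<omega> = exp (- rho * r) * (Y r \<omega> - a)"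
  unfolding reward_def by simp

text \<open>The stopping time cut at \<open>T\<close> is rounded up to a grid of mesh
  \<open>T / (n + 1)\<close>, which keeps it a stopping time. On each fine grid the supermartingale
  bound applies because \<open>\<phi>\<close> dominates \<open>u - a\<close>; as the mesh shrinks
  the rewards converge by continuity of the price, dominated by a constant on
  \<open>[0, T]\<close>.\<close>

lemma truncated_reward_bound:
  assumes S: "supersolution mu sig lambda rho \<phi>" and ms: "mu < sig"
    and major: "\<And>i u. i \<in> {-1, 1} \<Longrightarrow> 0 \<le> u \<Longrightarrow> u - a \<le> \<phi> i u"
    and T: "0 < T" and \<tau>: "stopping_time (completed_natural_filtration M xi) \<tau>" and a: "0 < a"
  defines "X \<equiv> \<lambda>\<omega>. reward xi mu sig a rho y (min (\<tau> \<omega>) (ennreal T)) \<omega>"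
  shows "X \<in> borel_measurable Mc" "integrable Mc X" "(\<integral>\<omega>. X \<omega> \<partial>Mc) \<le> \<phi> s y"
    "\<And>\<omega>. - a \<le> X \<omega>"
proof -
  define x where "x t \<omega> = exp (- rho * t) * (Y t \<omega> - a)" for t \<omega>
  define \<theta> where "\<theta> \<omega> = enn2real (min (\<tau> \<omega>) (ennreal T))" for \<omega>
  have fin: "min (\<tau> \<omega>) (ennreal T) \<noteq> \<infinity>" for \<omega>
  proof -
    have "min (\<tau> \<omega>) (ennreal T) < \<infinity>" by (rule le_less_trans[OF min.cobounded2]) simp
    then show ?thesis by (rule less_imp_neq)
  qed
  have th: "0 \<le> \<theta> \<omega>" "\<theta> \<omega> \<le> T" "ennreal (\<theta> \<omega>) = min (\<tau> \<omega>) (ennreal T)" for \<omega>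
  proof -
    show "0 \<le> \<theta> \<omega>" unfolding \<theta>_def by simp
    show "\<theta> \<omega> \<le> T" unfolding \<theta>_def using T by (intro enn2real_leI) auto
    show "ennreal (\<theta> \<omega>) = min (\<tau> \<omega>) (ennreal T)" unfolding \<theta>_def
      using fin[of \<omega>] by (intro ennreal_enn2real) (simp add: less_top)
  qed
  have X_eq: "X \<omega> = x (\<theta> \<omega>) \<omega>" for \<omega>
    unfolding X_def reward_def x_def \<theta>_def using fin[of \<omega>] by simp
  show lower: "- a \<le> X \<omega>" for \<omega>
  proof -
    define e where "e = exp (- rho * \<theta> \<omega>)"
    have e: "0 \<le> e" "e \<le> 1" unfolding e_def using rho_pos th(1) by auto
    have "e * (- a) \<ge> 1 * (- a)" using e a by (intro mult_right_mono_neg) auto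
    moreover have "e * (Y (\<theta> \<omega>) \<omega> - a) \<ge> e * (- a)" using e Y_nonneg[of "\<theta> \<omega>" \<omega>] by (intro mult_left_mono) auto
    ultimately show ?thesis unfolding X_eq x_def e_def by linarith
  qed
  define R where "R = y * exp ((mu + sig) * T)"
  have xb: "\<bar>x t \<omega>\<bar> \<le> R + a" if "0 \<le> t" "t \<le> T" "\<omega> \<in> space M" for t \<omega>
  proof -
    have "exp (- rho * t) \<le> 1" using rho_pos that by simp
    moreover have "\<bar>Y t \<omega> - a\<bar> \<le> R + a" using Y_range[OF that] a unfolding R_def by auto
    ultimately have "exp (- rho * t) * \<bar>Y t \<omega> - a\<bar> \<le> 1 * (R + a)" by (intro mult_mono) auto
    then show ?thesis unfolding x_def by (simp add: abs_mult)
  qed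
  have x_cont: "continuous_on {0..T} (\<lambda>t. x t \<omega>)" if "\<omega> \<in> space M" for \<omega>
    unfolding x_def using Y_continuous[OF that] by (intro continuous_intros)
  define h where "h n = T / real (Suc n)" for n
  \<comment> \<open>The alternative \<open>k = Suc n\<close> caps the index at the grid point
    \<open>T\<close>, so a late or infinite \<open>\<tau>\<close> also gets an index.\<close>
  define N where "N n \<omega> = (LEAST k. \<tau> \<omega> \<le> ennreal (real k * h n) \<or> k = Suc n)" for n \<omega>
  have h: "h n > 0" "real (Suc n) * h n = T" for n unfolding h_def using T by auto
  have N1: "\<tau> \<omega> \<le> ennreal (real (N n \<omega>) * h n) \<or> N n \<omega> = Suc n" for n \<omega>
    unfolding N_def by (rule LeastI[of _ "Suc n"]) simp
  have N2: "N n \<omega> \<le> Suc n" for n \<omega> unfolding N_def by (rule Least_le) simp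
  \<comment> \<open>Below the cap, \<open>k < N n \<omega>\<close> means that \<open>\<tau>\<close>
    exceeds the \<open>k\<close>-th grid time, which is known at that time.\<close>
  have N3: "k < N n \<omega> \<longleftrightarrow> ennreal (real k * h n) < \<tau> \<omega>" if "k < Suc n" for k n \<omega>
  proof
    assume "k < N n \<omega>"
    then show "ennreal (real k * h n) < \<tau> \<omega>" using not_less_Least[of k] unfolding N_def by force
  next
    assume *: "ennreal (real k * h n) < \<tau> \<omega>"
    show "k < N n \<omega>"
    proof (rule ccontr)
      assume "\<not> k < N n \<omega>"
      then have le: "N n \<omega> \<le> k" by simp
      then have "\<tau> \<omega> \<le> ennreal (real (N n \<omega>) * h n)" using N1[of \<omega> n] that by auto
      also have "\<dots> \<le> ennreal (real k * h n)"
        using le h(1)[of n] by (intro ennreal_leI mult_right_mono) auto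
      finally show False using * by simp
    qed
  qed
  have t_le: "real (N n \<omega>) * h n \<le> T" for n \<omega>
  proof -
    have "real (N n \<omega>) * h n \<le> real (Suc n) * h n" using N2[of n \<omega>] h(1)[of n] by (intro mult_right_mono) auto
    then show ?thesis using h(2) by simp
  qed
  have t_ge: "\<theta> \<omega> \<le> real (N n \<omega>) * h n" for n \<omega>
    using N1[of \<omega> n]
  proof
    assume "\<tau> \<omega> \<le> ennreal (real (N n \<omega>) * h n)"
    then have "ennreal (\<theta> \<omega>) \<le> ennreal (real (N n \<omega>) * h n)" unfolding th(3) by (meson min.coboundedI1)
    then show ?thesis using h(1)[of n] by (subst (asm) ennreal_le_iff) auto
  qed (use th(2) h(2) in simp)
  have t_near: "real (N n \<omega>) * h n \<le> \<theta> \<omega> + h n" for n \<omega>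
  proof (cases "N n \<omega>")
    case 0
    then show ?thesis using th(1)[of \<omega>] h(1)[of n] by simp
  next
    case (Suc k)
    then have "k < Suc n" using N2[of n \<omega>] by simp
    then have "ennreal (real k * h n) < \<tau> \<omega>" using N3[of k n \<omega>] Suc by simp
    moreover have "real k * h n \<le> T"
    proof -
      have "real k * h n \<le> real (Suc n) * h n"
        using h(1)[of n] \<open>k < Suc n\<close> by (intro mult_right_mono) auto
      then show ?thesis unfolding h(2) .
    qed
    ultimately have "ennreal (real k * h n) \<le> ennreal (\<theta> \<omega>)" unfolding th(3) by (simp add: ennreal_leI)
    then have "real k * h n \<le> \<theta> \<omega>" using th(1) by (subst (asm) ennreal_le_iff) auto
    then show ?thesis using Suc by (simp add: algebra_simps)
  qed
  have h_lim: "h \<longlonglongrightarrow> 0"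
    unfolding h_def using LIMSEQ_Suc[OF lim_const_over_n[of T]] by simp
  define f where "f n \<omega> = x (real (N n \<omega>) * h n) \<omega>" for n \<omega>
  have f_lim: "(\<lambda>n. f n \<omega>) \<longlonglongrightarrow> X \<omega>" if "\<omega> \<in> space M" for \<omega>
  proof -
    have "(\<lambda>n. real (N n \<omega>) * h n) \<longlonglongrightarrow> \<theta> \<omega>"
    proof (rule tendsto_sandwich[of "\<lambda>_. \<theta> \<omega>" _ _ "\<lambda>n. \<theta> \<omega> + h n"])
      show "(\<lambda>n. \<theta> \<omega> + h n) \<longlonglongrightarrow> \<theta> \<omega>" using tendsto_add[OF tendsto_const h_lim, of "\<theta> \<omega>"] by simp
    qed (use t_ge t_near in auto)
    then show ?thesis unfolding f_def X_eq
      by (rule continuous_on_tendsto_compose[OF x_cont[OF that]])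
        (use th t_le in \<open>auto intro!: always_eventually mult_nonneg_nonneg less_imp_le[OF h(1)]\<close>)
  qed
  have f_meas: "f n \<in> borel_measurable Mc" for n
  proof -
    have "(\<lambda>\<omega>. x (real (N n \<omega>) * h n) \<omega>) \<in> borel_measurable Mc"
    proof (rule measurable_compose_countable[where f = "\<lambda>k. x (real k * h n)" and g = "N n"])
      show "N n \<in> measurable Mc (count_space UNIV)"
        unfolding N_def by (rule grid_index_measurable[OF stopping_time_measurable[OF \<tau>]])
      show "x (real k * h n) \<in> borel_measurable Mc" for k
        unfolding x_def using Y_measurable_c[of "real k * h n"] h(1)[of n] by simp
    qed
    then show ?thesis unfolding f_def .
  qed
  have f_bound: "norm (f n \<omega>) \<le> R + a" if "\<omega> \<in> space M" for n \<omega>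
    unfolding f_def using xb[OF _ t_le that] h(1)[of n] by simp
  interpret c: prob_space Mc by (rule prob_space_completion)
  show X_meas: "X \<in> borel_measurable Mc"
    by (rule borel_measurable_LIMSEQ_real[OF _ f_meas]) (use f_lim in simp)
  have AE: "AE \<omega> in Mc. (\<lambda>n. f n \<omega>) \<longlonglongrightarrow> X \<omega>" "\<And>n. AE \<omega> in Mc. norm (f n \<omega>) \<le> R + a"
    by (intro AE_I2; use f_lim f_bound in simp)+
  have const: "integrable Mc (\<lambda>_. R + a)" by simp
  note int = integrable_dominated_convergence[OF X_meas f_meas const AE]
    integrable_dominated_convergence2[OF X_meas f_meas const AE]
    integral_dominated_convergence[OF X_meas f_meas const AE]
  show "integrable Mc X" by (rule int(1))
  show "(\<integral>\<omega>. X \<omega> \<partial>Mc) \<le> \<phi> s y"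
  proof (rule field_le_epsilon)
    fix \<epsilon> :: real assume "0 < \<epsilon>"
    obtain h0 where h0: "h0 > 0"
      "\<And>h n N. 0 < h \<Longrightarrow> h < h0 \<Longrightarrow> real n * h \<le> T \<Longrightarrow>
         (\<And>k. k < n \<Longrightarrow> {\<omega> \<in> space M. k < N \<omega>} \<in> sets (Fc (real k * h))) \<Longrightarrow>
         integrable Mc (\<lambda>\<omega>. discounted \<phi> (real (min (N \<omega>) n) * h) \<omega>) \<and>
         (\<integral>\<omega>. discounted \<phi> (real (min (N \<omega>) n) * h) \<omega> \<partial>Mc) \<le> \<phi> s y + \<epsilon>"
      using grid_supermartingale[OF S ms T \<open>0 < \<epsilon>\<close>] by blast
    have "eventually (\<lambda>n. h n < h0) sequentially" using order_tendstoD(2)[OF h_lim h0(1)] .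
    then have "eventually (\<lambda>n. (\<integral>\<omega>. f n \<omega> \<partial>Mc) \<le> \<phi> s y + \<epsilon>) sequentially"
    proof eventually_elim
      case (elim n)
      have "{\<omega> \<in> space M. k < N n \<omega>} \<in> sets (Fc (real k * h n))" if "k < Suc n" for k
      proof -
        have "Measurable.pred (Fc (real k * h n)) (\<lambda>\<omega>. ennreal (real k * h n) < \<tau> \<omega>)"
          by (rule stopping_timeD2[OF \<tau>])
        then show ?thesis using N3[OF that] unfolding pred_def sets_completed(2) by simp
      qed
      from h0(2)[OF h(1) elim eq_refl[OF h(2)] this]
      have W: "integrable Mc (\<lambda>\<omega>. discounted \<phi> (real (min (N n \<omega>) (Suc n)) * h n) \<omega>)"
         "(\<integral>\<omega>. discounted \<phi> (real (min (N n \<omega>) (Suc n)) * h n) \<omega> \<partial>Mc) \<le> \<phi> s y + \<epsilon>" by auto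
      have "(\<integral>\<omega>. f n \<omega> \<partial>Mc) \<le> (\<integral>\<omega>. discounted \<phi> (real (min (N n \<omega>) (Suc n)) * h n) \<omega> \<partial>Mc)"
      proof (rule integral_mono[OF int(2) W(1)])
        fix \<omega> assume w: "\<omega> \<in> space Mc"
        have m: "min (N n \<omega>) (Suc n) = N n \<omega>" using N2[of n \<omega>] by simp
        have "xi (real (N n \<omega>) * h n) \<omega> \<in> {-1, 1}" using xi_values[of "real (N n \<omega>) * h n" \<omega>] h(1)[of n] w by simp
        then show "f n \<omega> \<le> discounted \<phi> (real (min (N n \<omega>) (Suc n)) * h n) \<omega>"
          unfolding m f_def x_def using major Y_nonneg by (intro mult_left_mono) auto
      qed
      then show ?case using W(2) by simp
    qed
    then show "(\<integral>\<omega>. X \<omega> \<partial>Mc) \<le> \<phi> s y + \<epsilon>"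
      using int(3) by (intro tendsto_upperbound) auto
  qed
qed

text \<open>Fatou's lemma removes the horizon; it is applied to the rewards increased by
  \<open>a\<close>, which are non-negative. The resulting bound also makes the reward integrable, so
  that the extended expectation is an ordinary integral.\<close>

lemma reward_expectation_le:
  assumes S: "supersolution mu sig lambda rho \<phi>" and ms: "mu < sig"
    and major: "\<And>i u. i \<in> {-1, 1} \<Longrightarrow> 0 \<le> u \<Longrightarrow> u - a \<le> \<phi> i u"
    and \<tau>: "stopping_time (completed_natural_filtration M xi) \<tau>" and a: "0 < a"
  shows "ext_expectation Mc (\<lambda>\<omega>. reward xi mu sig a rho y (\<tau> \<omega>) \<omega>) \<le> ereal (\<phi> s y)"
proof -
  define X where "X \<omega> = reward xi mu sig a rho y (\<tau> \<omega>) \<omega>" for \<omega>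
  define Xm where "Xm m = (\<lambda>\<omega>. reward xi mu sig a rho y (min (\<tau> \<omega>) (ennreal (real (Suc m)))) \<omega>)" for m
  have T: "0 < real (Suc m)" for m by simp
  have tr: "Xm m \<in> borel_measurable Mc" "integrable Mc (Xm m)" "(\<integral>\<omega>. Xm m \<omega> \<partial>Mc) \<le> \<phi> s y" "- a \<le> Xm m \<omega>" for m \<omega>
    unfolding Xm_def by (rule truncated_reward_bound[OF S ms _ T \<tau> a], rule major, assumption+)+
  interpret c: prob_space Mc by (rule prob_space_completion)
  have \<tau>m [measurable]: "\<tau> \<in> borel_measurable Mc" by (rule stopping_time_measurable[OF \<tau>])
  have Xm_eq: "eventually (\<lambda>m. Xm m \<omega> = X \<omega> \<and> \<tau> \<omega> \<le> ennreal (real (Suc m))) sequentially" if "\<tau> \<omega> \<noteq> \<infinity>" for \<omega>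
  proof -
    define r where "r = enn2real (\<tau> \<omega>)"
    have r: "\<tau> \<omega> = ennreal r" "0 \<le> r" unfolding r_def using that by (auto simp: less_top)
    obtain n where "r \<le> real n" using real_arch_simple by blast
    then have "\<tau> \<omega> \<le> ennreal (real (Suc m))" if "n \<le> m" for m
      unfolding r(1) using that by (intro ennreal_leI) auto
    then show ?thesis unfolding eventually_sequentially Xm_def X_def
      by (intro exI[of _ n]) (auto simp: min_absorb1)
  qed
  have X_lower: "- a \<le> X \<omega>" for \<omega>
  proof (cases "\<tau> \<omega> = \<infinity>")
    case True
    then show ?thesis unfolding X_def reward_def using a by simp
  next
    case False
    then obtain m where "Xm m \<omega> = X \<omega>" using Xm_eq[OF False] unfolding eventually_sequentially by blast
    then show ?thesis using tr(4)[of m \<omega>] by simp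
  qed
  \<comment> \<open>Where \<open>\<tau>\<close> is infinite the truncated rewards need not converge
    to \<open>X\<close>; the indicator that \<open>\<tau>\<close> is within the horizon replaces
    them by 0 there.\<close>
  have X_meas [measurable]: "X \<in> borel_measurable Mc"
  proof (rule borel_measurable_LIMSEQ_real)
    show "(\<lambda>\<omega>. indicator {\<omega> \<in> space Mc. \<tau> \<omega> \<le> ennreal (real (Suc m))} \<omega> * Xm m \<omega>) \<in> borel_measurable Mc" for m
      using tr(1)[of m] by measurable
    show "(\<lambda>m. indicator {\<omega> \<in> space Mc. \<tau> \<omega> \<le> ennreal (real (Suc m))} \<omega> * Xm m \<omega>) \<longlonglongrightarrow> X \<omega>"
      if w: "\<omega> \<in> space Mc" for \<omega>
    proof (cases "\<tau> \<omega> = \<infinity>")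
      case True
      have "X \<omega> = 0" unfolding X_def reward_def using True by simp
      then show ?thesis using True by (simp add: top_unique)
    next
      case False
      show ?thesis
        by (rule tendsto_eventually) (use Xm_eq[OF False] w in \<open>auto elim!: eventually_mono\<close>)
    qed
  qed
  \<comment> \<open>If \<open>\<tau>\<close> is infinite, the reward at the horizon is at least
    \<open>- a\<close> times a discount factor tending to 0, whatever the price does, and
    \<open>X\<close> is 0.\<close>
  have lim: "ennreal (X \<omega> + a) \<le> liminf (\<lambda>m. ennreal (Xm m \<omega> + a))" for \<omega>
  proof (cases "\<tau> \<omega> = \<infinity>")
    case True
    have X0: "X \<omega> = 0" unfolding X_def reward_def using True by simp
    have lb: "a - a * exp (- rho * real (Suc m)) \<le> Xm m \<omega> + a" for m
    proof -
      have min: "min (\<tau> \<omega>) (ennreal (real (Suc m))) = ennreal (real (Suc m))" using True by simp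
      have "Xm m \<omega> = exp (- rho * real (Suc m)) * (Y (real (Suc m)) \<omega> - a)"
        unfolding Xm_def min by (rule reward_ennreal) simp
      also have "\<dots> \<ge> exp (- rho * real (Suc m)) * (0 - a)"
        using Y_nonneg by (intro mult_left_mono diff_mono) auto
      finally show ?thesis by (simp add: mult.commute)
    qed
    have "(\<lambda>m. exp (- rho * real (Suc m))) \<longlonglongrightarrow> 0"
    proof -
      have "(\<lambda>m. exp (- rho) ^ (Suc m)) \<longlonglongrightarrow> 0"
        using rho_pos by (intro LIMSEQ_Suc LIMSEQ_power_zero) simp
      then show ?thesis by (simp only: exp_of_nat_mult[symmetric] mult.commute)
    qed
    then have "(\<lambda>m. a - a * exp (- rho * real (Suc m))) \<longlonglongrightarrow> a - a * 0" by (intro tendsto_intros)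
    then have "(\<lambda>m. ennreal (a - a * exp (- rho * real (Suc m)))) \<longlonglongrightarrow> ennreal a" by (intro tendsto_ennrealI) simp
    then have "ennreal a = liminf (\<lambda>m. ennreal (a - a * exp (- rho * real (Suc m))))"
      by (intro lim_imp_Liminf[symmetric]) auto
    also have "\<dots> \<le> liminf (\<lambda>m. ennreal (Xm m \<omega> + a))"
      by (intro Liminf_mono always_eventually allI ennreal_leI lb)
    finally show ?thesis using X0 by simp
  next
    case False
    have "(\<lambda>m. ennreal (Xm m \<omega> + a)) \<longlonglongrightarrow> ennreal (X \<omega> + a)"
      by (rule tendsto_eventually) (use Xm_eq[OF False] in \<open>auto elim!: eventually_mono\<close>)
    then have "liminf (\<lambda>m. ennreal (Xm m \<omega> + a)) = ennreal (X \<omega> + a)" by (intro lim_imp_Liminf) auto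
    then show ?thesis by simp
  qed
  have m_le: "(\<integral>\<^sup>+\<omega>. ennreal (Xm m \<omega> + a) \<partial>Mc) \<le> ennreal (\<phi> s y + a)" for m
  proof -
    have "(\<integral>\<^sup>+\<omega>. ennreal (Xm m \<omega> + a) \<partial>Mc) = ennreal (\<integral>\<omega>. Xm m \<omega> + a \<partial>Mc)"
    proof (rule nn_integral_eq_integral)
      show "AE \<omega> in Mc. 0 \<le> Xm m \<omega> + a" using tr(4)[of m] by (intro AE_I2) (smt (verit))
    qed (use tr(2) in simp)
    also have "(\<integral>\<omega>. Xm m \<omega> + a \<partial>Mc) = (\<integral>\<omega>. Xm m \<omega> \<partial>Mc) + a"
      using tr(2)[of m] c.prob_space by simp
    finally show ?thesis using tr(3)[of m] by (simp add: ennreal_leI)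
  qed
  have "(\<integral>\<^sup>+\<omega>. ennreal (X \<omega> + a) \<partial>Mc) \<le> (\<integral>\<^sup>+\<omega>. liminf (\<lambda>m. ennreal (Xm m \<omega> + a)) \<partial>Mc)"
    by (intro nn_integral_mono lim)
  also have "\<dots> \<le> liminf (\<lambda>m. \<integral>\<^sup>+\<omega>. ennreal (Xm m \<omega> + a) \<partial>Mc)"
    by (intro nn_integral_liminf measurable_compose[OF _ measurable_ennreal] borel_measurable_add borel_measurable_const tr(1))
  also have "\<dots> \<le> liminf (\<lambda>m. ennreal (\<phi> s y + a))"
    by (intro Liminf_mono always_eventually allI m_le)
  also have "\<dots> = ennreal (\<phi> s y + a)" by (simp add: Liminf_const)
  finally have le: "(\<integral>\<^sup>+\<omega>. ennreal (X \<omega> + a) \<partial>Mc) \<le> ennreal (\<phi> s y + a)" .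
  have "integrable Mc (\<lambda>\<omega>. X \<omega> + a)"
  proof (rule integrableI_nonneg)
    show "AE \<omega> in Mc. 0 \<le> X \<omega> + a" using X_lower by (intro AE_I2) (smt (verit))
    show "(\<integral>\<^sup>+\<omega>. ennreal (X \<omega> + a) \<partial>Mc) < \<infinity>" using le by (rule le_less_trans) simp
  qed measurable
  then have X_int: "integrable Mc X"
    using Bochner_Integration.integrable_diff[of Mc "\<lambda>\<omega>. X \<omega> + a" "\<lambda>_. a"] by simp
  have "(\<integral>\<omega>. X \<omega> + a \<partial>Mc) \<le> \<phi> s y + a"
  proof (rule integral_real_bounded[OF _ le])
    show "0 \<le> \<phi> s y + a" using major[OF start_state y_nonneg] y_nonneg by simp
  qed
  then have "(\<integral>\<omega>. X \<omega> \<partial>Mc) \<le> \<phi> s y" using X_int c.prob_space by simp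
  then show ?thesis using ext_expectation_integrable[OF X_int] unfolding X_def by simp
qed

lemma value_function_le:
  assumes "supersolution mu sig lambda rho \<phi>" and "mu < sig"
    and "\<And>i u. i \<in> {-1, 1} \<Longrightarrow> 0 \<le> u \<Longrightarrow> u - a \<le> \<phi> i u" and "0 < a"
  shows "value_function M xi mu sig a rho y \<le> ereal (\<phi> s y)"
  unfolding value_function_def using reward_expectation_le[OF assms(1-3) _ assms(4)] by (intro SUP_least) auto

lemma value_function_ge_stopped:
  "value_function M xi mu sig a rho y \<ge> ereal (y - a)"
proof -
  interpret c: prob_space Mc by (rule prob_space_completion)
  have "ext_expectation Mc (\<lambda>\<omega>. reward xi mu sig a rho y 0 \<omega>) = ereal (y - a)"
    unfolding reward_def by (simp add: ext_expectation_integrable c.prob_space prob_space)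
  then show ?thesis unfolding value_function_def
    by (intro SUP_upper2[of "\<lambda>_. 0"]) (auto simp: stopping_time_const)
qed

lemma value_function_nonneg: "value_function M xi mu sig a rho y \<ge> 0"
proof -
  have "ext_expectation Mc (\<lambda>\<omega>. reward xi mu sig a rho y \<infinity> \<omega>) = 0"
    unfolding reward_def by (simp add: ext_expectation_integrable zero_ereal_def)
  then show ?thesis unfolding value_function_def
    by (intro SUP_upper2[of "\<lambda>_. \<infinity>"]) (auto simp: stopping_time_const)
qed

text \<open>The stopping rule is the first grid time at which the price is at least \<open>U\<close>.\<close>

lemma hitting_reward:
  assumes S: "supersolution mu sig lambda rho (\<lambda>i u. - (c i * u powr q))" and ms: "mu < sig"
    and q: "0 < q" and c: "\<And>i. i \<in> {-1, 1} \<Longrightarrow> 0 \<le> c i \<and> c i * U powr q \<le> U - a"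
    and a: "0 < a" "a < U" and y: "y < U" and \<epsilon>: "0 < \<epsilon>" and T: "0 < T"
  shows "\<exists>h r. 0 < h \<and> h < \<epsilon> \<and> ereal r \<le> value_function M xi mu sig a rho y \<and> 0 \<le> r \<and>
    c s * y powr q - \<epsilon> \<le> exp (q * ((mu + sig) * h)) * r + exp (- rho * T) * (U - a)"
proof -
  \<comment> \<open>With the negated power as supersolution, the upper bound turns into the lower
    bound \<open>c s * y powr q - \<epsilon>\<close> for the expected discounted power at the
    stopped time.\<close>
  obtain h0 where h0: "h0 > 0"
      "\<And>h n N. 0 < h \<Longrightarrow> h < h0 \<Longrightarrow> real n * h \<le> T \<Longrightarrow>
         (\<And>k. k < n \<Longrightarrow> {\<omega> \<in> space M. k < N \<omega>} \<in> sets (Fc (real k * h))) \<Longrightarrow>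
         integrable Mc (\<lambda>\<omega>. discounted (\<lambda>i u. - (c i * u powr q)) (real (min (N \<omega>) n) * h) \<omega>) \<and>
         (\<integral>\<omega>. discounted (\<lambda>i u. - (c i * u powr q)) (real (min (N \<omega>) n) * h) \<omega> \<partial>Mc) \<le> - (c s * y powr q) + \<epsilon>"
    using grid_supermartingale[OF S ms T \<epsilon>] by blast
  have "(\<lambda>n. T / real (Suc n)) \<longlonglongrightarrow> 0" using LIMSEQ_Suc[OF lim_const_over_n[of T]] by simp
  then have "eventually (\<lambda>n. T / real (Suc n) < min h0 \<epsilon>) sequentially"
    using h0(1) \<epsilon> by (intro order_tendstoD(2)) auto
  then obtain n0 where "T / real (Suc n0) < min h0 \<epsilon>" unfolding eventually_sequentially by blast
  define n where "n = Suc n0"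
  define h where "h = T / real n"
  have h: "0 < h" "h < h0" "h < \<epsilon>" "real n * h = T"
    using \<open>T / real (Suc n0) < min h0 \<epsilon>\<close> T unfolding h_def n_def by auto
  have kh: "0 \<le> real k * h" for k using h(1) by simp
  define N where "N \<omega> = (LEAST k. U \<le> Y (real k * h) \<omega> \<or> k = n)" for \<omega>
  \<comment> \<open>If the level is not reached at a grid time up to \<open>T\<close>, the rule
    never stops and the reward is 0 rather than possibly negative; this makes \<open>r\<close>
    non-negative.\<close>
  define \<tau> where "\<tau> \<omega> = (if U \<le> Y (real (N \<omega>) * h) \<omega> then ennreal (real (N \<omega>) * h) else \<infinity>)" for \<omega>
  have N1: "U \<le> Y (real (N \<omega>) * h) \<omega> \<or> N \<omega> = n" for \<omega>
    unfolding N_def by (rule LeastI[of _ n]) simp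
  have N2: "N \<omega> \<le> n" for \<omega> unfolding N_def by (rule Least_le) simp
  have N3: "Y (real k * h) \<omega> < U" if "k < N \<omega>" for k \<omega>
    using not_less_Least[of k "\<lambda>k. U \<le> Y (real k * h) \<omega> \<or> k = n"] that unfolding N_def by auto
  have N4: "N \<omega> \<le> k" if "U \<le> Y (real k * h) \<omega>" for k \<omega>
    unfolding N_def using that by (intro Least_le) simp
  have hit_F: "{\<omega> \<in> space M. U \<le> Y (real k * h) \<omega>} \<in> sets (natural_filtration M xi t)"
    if "ennreal (real k * h) \<le> t" for k t
  proof -
    have "{\<omega> \<in> space (F (real k * h)). U \<le> Y (real k * h) \<omega>} \<in> sets (F (real k * h))"
      using Y_measurable_F[OF kh, of k] by measurable
    then show ?thesis using F_mono[OF that] by auto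
  qed
  have N_sets: "{\<omega> \<in> space M. k < N \<omega>} \<in> sets (Fc (real k * h))" if "k < n" for k
  proof -
    have "{\<omega> \<in> space M. k < N \<omega>} = space M - (\<Union>j\<in>{..k}. {\<omega> \<in> space M. U \<le> Y (real j * h) \<omega>})"
    proof (intro set_eqI iffI)
      fix \<omega> assume "\<omega> \<in> {\<omega> \<in> space M. k < N \<omega>}"
      then show "\<omega> \<in> space M - (\<Union>j\<in>{..k}. {\<omega> \<in> space M. U \<le> Y (real j * h) \<omega>})"
        using N4[of _ \<omega>] by force
    next
      fix \<omega> assume *: "\<omega> \<in> space M - (\<Union>j\<in>{..k}. {\<omega> \<in> space M. U \<le> Y (real j * h) \<omega>})"
      have "\<not> N \<omega> \<le> k"
      proof
        assume "N \<omega> \<le> k"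
        then have "U \<le> Y (real (N \<omega>) * h) \<omega>" using N1[of \<omega>] that by auto
        then show False using * \<open>N \<omega> \<le> k\<close> by auto
      qed
      then show "\<omega> \<in> {\<omega> \<in> space M. k < N \<omega>}" using * by auto
    qed
    moreover have "(\<Union>j\<in>{..k}. {\<omega> \<in> space M. U \<le> Y (real j * h) \<omega>}) \<in> sets (F (real k * h))"
      using h(1) by (intro sets.finite_UN hit_F ennreal_leI mult_right_mono) auto
    ultimately have "{\<omega> \<in> space M. k < N \<omega>} \<in> sets (F (real k * h))"
      using sets.compl_sets[of _ "F (real k * h)"] by simp
    then show ?thesis using F_subset_completed by blast
  qed
  have \<tau>: "stopping_time (completed_natural_filtration M xi) \<tau>"
  proof (rule stopping_timeI)
    fix t
    have "{\<omega> \<in> space M. \<tau> \<omega> \<le> t} \<in> sets (natural_filtration M xi t)"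
    proof (cases "t = \<infinity>")
      case True
      then show ?thesis using sets.top[of "natural_filtration M xi t"] by simp
    next
      case False
      have "{\<omega> \<in> space M. \<tau> \<omega> \<le> t} = (\<Union>k\<in>{k. k \<le> n \<and> ennreal (real k * h) \<le> t}. {\<omega> \<in> space M. U \<le> Y (real k * h) \<omega>})"
      proof (intro set_eqI iffI)
        fix \<omega> assume "\<omega> \<in> {\<omega> \<in> space M. \<tau> \<omega> \<le> t}"
        then show "\<omega> \<in> (\<Union>k\<in>{k. k \<le> n \<and> ennreal (real k * h) \<le> t}. {\<omega> \<in> space M. U \<le> Y (real k * h) \<omega>})"
          using False N2[of \<omega>] unfolding \<tau>_def by (auto simp: top_unique split: if_splits)
      next
        fix \<omega> assume "\<omega> \<in> (\<Union>k\<in>{k. k \<le> n \<and> ennreal (real k * h) \<le> t}. {\<omega> \<in> space M. U \<le> Y (real k * h) \<omega>})"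
        then obtain k where k: "k \<le> n" "ennreal (real k * h) \<le> t" "\<omega> \<in> space M" "U \<le> Y (real k * h) \<omega>" by auto
        have Nk: "N \<omega> \<le> k" by (rule N4[OF k(4)])
        have "U \<le> Y (real (N \<omega>) * h) \<omega>"
          using N1[of \<omega>] Nk k by (cases "N \<omega> = n") auto
        moreover have "ennreal (real (N \<omega>) * h) \<le> ennreal (real k * h)"
          using Nk h(1) by (intro ennreal_leI mult_right_mono) auto
        ultimately show "\<omega> \<in> {\<omega> \<in> space M. \<tau> \<omega> \<le> t}" using k unfolding \<tau>_def by auto
      qed
      also have "\<dots> \<in> sets (natural_filtration M xi t)"
        by (intro sets.finite_UN hit_F) auto
      finally show ?thesis .
    qed
    then show "Measurable.pred (completed_natural_filtration M xi t) (\<lambda>x. \<tau> x \<le> t)"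
      unfolding pred_def sets_completed(2) using F_subset_completed by blast
  qed
  define X where "X \<omega> = reward xi mu sig a rho y (\<tau> \<omega>) \<omega>" for \<omega>
  define W where "W \<omega> = discounted (\<lambda>i u. - (c i * u powr q)) (real (min (N \<omega>) n) * h) \<omega>" for \<omega>
  have W: "integrable Mc W" "(\<integral>\<omega>. W \<omega> \<partial>Mc) \<le> - (c s * y powr q) + \<epsilon>"
    using h0(2)[OF h(1,2) eq_refl[OF h(4)] N_sets] unfolding W_def by auto
  have X_eq: "X \<omega> = (if U \<le> Y (real (N \<omega>) * h) \<omega> then exp (- rho * (real (N \<omega>) * h)) * (Y (real (N \<omega>) * h) \<omega> - a) else 0)" for \<omega>
  proof -
    have "reward xi mu sig a rho y \<infinity> \<omega> = 0" unfolding reward_def by simp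
    then show ?thesis
      unfolding X_def \<tau>_def
      by (simp only: if_distrib[of "\<lambda>t. reward xi mu sig a rho y t \<omega>"] reward_ennreal[OF kh])
  qed
  have X_nn: "0 \<le> X \<omega>" for \<omega> unfolding X_eq using a by auto
  interpret c: prob_space Mc by (rule prob_space_completion)
  have N_meas: "N \<in> measurable Mc (count_space UNIV)"
  proof -
    have [measurable]: "Y (real k * h) \<in> borel_measurable Mc" for k by (rule Y_measurable_c[OF kh])
    show ?thesis unfolding N_def by measurable
  qed
  have X_meas: "X \<in> borel_measurable Mc"
  proof -
    define f where "f k \<omega> = (if U \<le> Y (real k * h) \<omega> then exp (- rho * (real k * h)) * (Y (real k * h) \<omega> - a) else 0)" for k \<omega>
    have "f k \<in> borel_measurable Mc" for k
      unfolding f_def using Y_measurable_c[OF kh, of k] by measurable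
    then have "(\<lambda>\<omega>. f (N \<omega>) \<omega>) \<in> borel_measurable Mc"
      using N_meas by (rule measurable_compose_countable)
    then show ?thesis unfolding f_def X_eq[abs_def] .
  qed
  have X_int: "integrable Mc X"
  proof (rule c.integrable_const_bound[OF _ X_meas, of "y * exp ((mu + sig) * T)"], rule AE_I2)
    fix \<omega> assume "\<omega> \<in> space Mc"
    then have w: "\<omega> \<in> space M" by simp
    have "real (N \<omega>) * h \<le> T" using N2[of \<omega>] h(1) h(4)[symmetric] by (simp add: mult_right_mono)
    then have Yr: "Y (real (N \<omega>) * h) \<omega> \<in> {0..y * exp ((mu + sig) * T)}"
      by (rule Y_range[OF kh _ w])
    have "exp (- rho * (real (N \<omega>) * h)) \<le> 1" using rho_pos kh by (simp add: mult_nonneg_nonneg)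
    then have "X \<omega> \<le> y * exp ((mu + sig) * T)"
    proof -
      have "exp (- rho * (real (N \<omega>) * h)) * (Y (real (N \<omega>) * h) \<omega> - a) \<le> 1 * (y * exp ((mu + sig) * T))"
        if "U \<le> Y (real (N \<omega>) * h) \<omega>"
        using Yr \<open>exp (- rho * (real (N \<omega>) * h)) \<le> 1\<close> that a by (intro mult_mono) auto
      then show ?thesis unfolding X_eq using y_nonneg by auto
    qed
    then show "norm (X \<omega>) \<le> y * exp ((mu + sig) * T)" using X_nn by simp
  qed
  define r where "r = (\<integral>\<omega>. X \<omega> \<partial>Mc)"
  have r_le: "ereal r \<le> value_function M xi mu sig a rho y"
  proof -
    have "ereal r = ext_expectation Mc (\<lambda>\<omega>. reward xi mu sig a rho y (\<tau> \<omega>) \<omega>)"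
      using ext_expectation_integrable[OF X_int] unfolding r_def X_def by simp
    then show ?thesis unfolding value_function_def by (intro SUP_upper2[of \<tau>]) (use \<tau> in auto)
  qed
  \<comment> \<open>At a hit the preceding grid price was below \<open>U\<close>, so the power
    exceeds \<open>U powr q\<close> by at most the overshoot factor
    \<open>exp (q * ((mu + sig) * h))\<close>. Without a hit the price at \<open>T\<close> is below
    \<open>U\<close>, and discounting leaves at most
    \<open>exp (- rho * T) * (U - a)\<close>.\<close>
  have pointwise: "- W \<omega> \<le> exp (q * ((mu + sig) * h)) * X \<omega> + exp (- rho * T) * (U - a)" if w: "\<omega> \<in> space Mc" for \<omega>
  proof -
    define t where "t = real (N \<omega>) * h"
    have t: "0 \<le> t" unfolding t_def by (rule kh)
    have min: "min (N \<omega>) n = N \<omega>" using N2[of \<omega>] by simp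
    have xi: "xi t \<omega> \<in> {-1, 1}" using xi_values[OF t, of \<omega>] w by auto
    have W_eq: "- W \<omega> = exp (- rho * t) * (c (xi t \<omega>) * Y t \<omega> powr q)"
      unfolding W_def min t_def by simp
    show ?thesis
    proof (cases "U \<le> Y t \<omega>")
      case True
      \<comment> \<open>\<open>y < U\<close> excludes a hit at time 0, so there is a preceding grid
        point.\<close>
      have "N \<omega> \<noteq> 0" using True y unfolding t_def by (intro notI) simp
      then obtain k where k: "N \<omega> = Suc k" by (cases "N \<omega>") auto
      have "Y t \<omega> \<le> Y (real k * h) \<omega> * exp ((mu + sig) * h)"
        using Y_step_le[OF kh less_imp_le[OF h(1)], of \<omega> k] w k unfolding t_def by (simp add: algebra_simps)
      also have "\<dots> \<le> U * exp ((mu + sig) * h)"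
        using N3[of k \<omega>] k by (intro mult_right_mono) auto
      finally have "Y t \<omega> powr q \<le> (U * exp ((mu + sig) * h)) powr q"
        using Y_nonneg q by (intro powr_mono2) auto
      also have "\<dots> = U powr q * exp (q * ((mu + sig) * h))"
        using a by (simp add: powr_mult exp_powr_real mult.commute)
      finally have "c (xi t \<omega>) * Y t \<omega> powr q \<le> c (xi t \<omega>) * (U powr q * exp (q * ((mu + sig) * h)))"
        using c[OF xi] by (intro mult_left_mono) auto
      also have "\<dots> \<le> (U - a) * exp (q * ((mu + sig) * h))"
        using mult_right_mono[OF conjunct2[OF c[OF xi]], of "exp (q * ((mu + sig) * h))"] by (simp add: mult.assoc)
      also have "\<dots> \<le> (Y t \<omega> - a) * exp (q * ((mu + sig) * h))" using True by (intro mult_right_mono) auto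
      finally have "exp (- rho * t) * (c (xi t \<omega>) * Y t \<omega> powr q) \<le> exp (- rho * t) * ((Y t \<omega> - a) * exp (q * ((mu + sig) * h)))"
        by (intro mult_left_mono) auto
      also have "\<dots> = exp (q * ((mu + sig) * h)) * X \<omega>"
        using True unfolding X_eq t_def[symmetric] by (simp add: mult_ac)
      finally have "- W \<omega> \<le> exp (q * ((mu + sig) * h)) * X \<omega>" unfolding W_eq .
      moreover have "0 \<le> exp (- rho * T) * (U - a)" using a by simp
      ultimately show ?thesis by linarith
    next
      case False
      then have "N \<omega> = n" using N1[of \<omega>] unfolding t_def by simp
      then have tT: "t = T" unfolding t_def using h(4) by simp
      have "Y t \<omega> powr q \<le> U powr q" using False Y_nonneg q by (intro powr_mono2) auto
      then have "c (xi t \<omega>) * Y t \<omega> powr q \<le> c (xi t \<omega>) * U powr q"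
        using c[OF xi] by (intro mult_left_mono) auto
      also have "\<dots> \<le> U - a" using c[OF xi] by simp
      finally have "- W \<omega> \<le> exp (- rho * T) * (U - a)" unfolding W_eq tT by (intro mult_left_mono) auto
      moreover have "0 \<le> exp (q * ((mu + sig) * h)) * X \<omega>" using X_nn by simp
      ultimately show ?thesis by linarith
    qed
  qed
  have "(\<integral>\<omega>. - W \<omega> \<partial>Mc) \<le> (\<integral>\<omega>. exp (q * ((mu + sig) * h)) * X \<omega> + exp (- rho * T) * (U - a) \<partial>Mc)"
    using W(1) X_int pointwise by (intro integral_mono) auto
  also have "\<dots> = exp (q * ((mu + sig) * h)) * r + exp (- rho * T) * (U - a)"
    unfolding r_def using X_int c.prob_space prob_space by simp
  finally have "c s * y powr q - \<epsilon> \<le> exp (q * ((mu + sig) * h)) * r + exp (- rho * T) * (U - a)"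
    using W(2) by simp
  moreover have "0 \<le> r" unfolding r_def using X_nn by simp
  ultimately show ?thesis using h r_le by blast
qed

text \<open>\<open>hitting_reward\<close> is taken with horizon \<open>n + 1\<close> and tolerance
  \<open>1 / (n + 1)\<close>: the overshoot factor tends to 1 and the tail to 0. An infinite value
  leaves nothing to prove.\<close>

lemma value_function_ge:
  assumes S: "supersolution mu sig lambda rho (\<lambda>i u. - (c i * u powr q))" and ms: "mu < sig"
    and q: "0 < q" and c: "\<And>i. i \<in> {-1, 1} \<Longrightarrow> 0 \<le> c i \<and> c i * U powr q \<le> U - a"
    and a: "0 < a" "a < U" and y: "y < U"
  shows "ereal (c s * y powr q) \<le> value_function M xi mu sig a rho y"
proof (cases "value_function M xi mu sig a rho y")
  case (real v)
  have rule: "\<exists>h r. 0 < h \<and> h < 1 / real (Suc n) \<and> ereal r \<le> value_function M xi mu sig a rho y \<and> 0 \<le> r \<and>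
    c s * y powr q - 1 / real (Suc n) \<le> exp (q * ((mu + sig) * h)) * r + exp (- rho * real (Suc n)) * (U - a)" for n
    by (rule hitting_reward[OF S ms q c a y]) auto
  have bound: "c s * y powr q - 1 / real (Suc n) \<le> exp (q * ((mu + sig) * (1 / real (Suc n)))) * v + exp (- rho * real (Suc n)) * (U - a)" for n
  proof -
    obtain h r where hr: "0 < h" "h < 1 / real (Suc n)" "r \<le> v" "0 \<le> r"
      "c s * y powr q - 1 / real (Suc n) \<le> exp (q * ((mu + sig) * h)) * r + exp (- rho * real (Suc n)) * (U - a)"
      using rule[of n] unfolding real by auto
    have "exp (q * ((mu + sig) * h)) * r \<le> exp (q * ((mu + sig) * (1 / real (Suc n)))) * v"
    proof (rule mult_mono)
      have "q * ((mu + sig) * h) \<le> q * ((mu + sig) * (1 / real (Suc n)))"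
        using hr(1,2) q mu_pos sig_pos by (intro mult_left_mono) auto
      then show "exp (q * ((mu + sig) * h)) \<le> exp (q * ((mu + sig) * (1 / real (Suc n))))" by simp
    qed (use hr in auto)
    then show ?thesis using hr(5) by linarith
  qed
  have i0: "(\<lambda>n. 1 / real (Suc n)) \<longlonglongrightarrow> 0" using LIMSEQ_inverse_real_of_nat by (simp add: inverse_eq_divide)
  have e0: "(\<lambda>n. exp (- rho * real (Suc n))) \<longlonglongrightarrow> 0"
  proof -
    have "(\<lambda>n. exp (- rho) ^ (Suc n)) \<longlonglongrightarrow> 0"
      using rho_pos by (intro LIMSEQ_Suc LIMSEQ_power_zero) simp
    then show ?thesis by (simp only: exp_of_nat_mult[symmetric] mult.commute)
  qed
  have "c s * y powr q - 0 \<le> exp (q * ((mu + sig) * 0)) * v + 0 * (U - a)"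
    by (rule LIMSEQ_le[of "\<lambda>n. c s * y powr q - 1 / real (Suc n)" _
      "\<lambda>n. exp (q * ((mu + sig) * (1 / real (Suc n)))) * v + exp (- rho * real (Suc n)) * (U - a)"])
      (intro tendsto_intros i0 e0, intro tendsto_intros i0 e0, use bound in blast)
  then show ?thesis unfolding real by simp
qed (use value_function_nonneg[of a] in auto)

end

subsection \<open>The free boundary problem\<close>

text \<open>Strict Bernoulli inequality: the intermediate slope \<open>q * z powr (q - 1)\<close>
  from the mean value theorem is below \<open>q\<close>. It serves to compare powers with the
  stopping reward through a tangent.\<close>

lemma powr_gt_tangent:
  fixes x q :: real
  assumes "0 \<le> x" "x < 1" "1 < q"
  shows "1 + q * (x - 1) < x powr q"
proof -
  have "\<exists>z\<in>{x<..<1}. (1 :: real) powr q - x powr q = (*) (q * z powr (q - 1)) (1 - x)"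
  proof (rule mvt)
    show "continuous_on {x..1} (\<lambda>x. x powr q)"
      using assms by (intro continuous_on_powr' continuous_intros) auto
    show "((\<lambda>x. x powr q) has_derivative (*) (q * z powr (q - 1))) (at z)" if "x < z" "z < 1" for z
      using has_real_derivative_powr[of z q] that assms by (simp add: has_field_derivative_def)
  qed (use assms in auto)
  then obtain z where z: "x < z" "z < 1" "1 - x powr q = (1 - x) * (q * z powr (q - 1))" by (auto simp: mult.commute)
  have "z powr (q - 1) < 1 powr (q - 1)" using z assms by (intro powr_less_mono2) auto
  then have "(1 - x) * (q * z powr (q - 1)) < (1 - x) * (q * 1)"
    using assms by (intro mult_strict_left_mono) auto
  then show ?thesis using z(3) by (simp add: algebra_simps)
qed

text \<open>\<open>1 < q\<close> keeps the derivative bounded near 0, so the Lipschitz bound reaches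
  the origin, as \<open>supersolution\<close> demands.\<close>

lemma powr_lipschitz:
  fixes q R :: real
  assumes "1 < q"
  shows "(q * \<bar>R\<bar> powr (q - 1))-lipschitz_on {0..R} (\<lambda>x. x powr q)"
proof (rule lipschitz_onI)
  have le: "v powr q - u powr q \<le> q * \<bar>R\<bar> powr (q - 1) * (v - u)" "u powr q \<le> v powr q" if "0 \<le> u" "u < v" "v \<le> R" for u v :: real
  proof -
    show "u powr q \<le> v powr q" using that assms by (intro powr_mono2) auto
    have "\<exists>z\<in>{u<..<v}. v powr q - u powr q = (*) (q * z powr (q - 1)) (v - u)"
    proof (rule mvt)
      show "continuous_on {u..v} (\<lambda>x. x powr q)"
        using assms that by (intro continuous_on_powr' continuous_intros) auto
      show "((\<lambda>x. x powr q) has_derivative (*) (q * z powr (q - 1))) (at z)" if "u < z" "z < v" for z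
        using has_real_derivative_powr[of z q] that \<open>0 \<le> u\<close> by (simp add: has_field_derivative_def)
    qed (use that in auto)
    then obtain z where z: "u < z" "z < v" "v powr q - u powr q = (v - u) * (q * z powr (q - 1))" by (auto simp: mult.commute)
    have "z powr (q - 1) \<le> \<bar>R\<bar> powr (q - 1)" using z assms that by (intro powr_mono2) auto
    then have "(v - u) * (q * z powr (q - 1)) \<le> (v - u) * (q * \<bar>R\<bar> powr (q - 1))"
      using assms that by (intro mult_left_mono) auto
    then show "v powr q - u powr q \<le> q * \<bar>R\<bar> powr (q - 1) * (v - u)" using z(3) by (simp add: mult_ac)
  qed
  fix u v assume "u \<in> {0..R}" "v \<in> {0..R}"
  then show "dist (u powr q) (v powr q) \<le> q * \<bar>R\<bar> powr (q - 1) * dist u v"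
    using le[of u v] le[of v u] by (cases u v rule: linorder_cases) (auto simp: dist_real_def)
qed (use assms in simp)

lemma powr_supersolution_lipschitz:
  assumes "1 < (q :: real)"
  shows "\<exists>L. L-lipschitz_on {0..R} (\<lambda>x. k * x powr q)"
  using lipschitz_on_cmult_real[OF powr_lipschitz[OF assms], of k] by blast

text \<open>\<open>q\<close> is a root of the characteristic equation of the two coupled Euler equations, and \<open>w\<close> is
  the ratio of the two components of the corresponding solution.\<close>

locale euler_root =
  fixes mu sig lambda rho q w :: real
  assumes mu: "0 < mu" "mu < sig" and lambda: "0 < lambda" and rho: "0 < rho" and q: "1 < q"
    and w_minus: "lambda * w = lambda + rho + (sig - mu) * q"
    and w_plus: "(lambda + rho - (mu + sig) * q) * w = lambda"
begin

lemma w_gt_1: "1 < w"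
proof -
  have "lambda * 1 < lambda * w" unfolding w_minus using mu rho q by (simp add: add_pos_pos)
  then show ?thesis using lambda by simp
qed

text \<open>After the factor \<open>k * u powr q\<close> is taken out, what remains is
  \<open>w_minus\<close> for \<open>i = -1\<close> and \<open>w_plus\<close> for
  \<open>i = 1\<close>. The sign of \<open>k\<close> is free.\<close>

lemma euler_power:
  assumes "i \<in> {-1, 1}" "0 < u"
  defines "c \<equiv> \<lambda>i. if i = 1 then w else 1"
  shows "(mu + sig * i) * u * (k * c i * (q * u powr (q - 1))) + lambda * (k * c (-i) * u powr q - k * c i * u powr q)
     - rho * (k * c i * u powr q) = 0"
proof -
  have u: "u * u powr (q - 1) = u powr q" using assms(2) by (simp add: powr_mult_base)
  have "(mu + sig * i) * u * (k * c i * (q * u powr (q - 1))) + lambda * (k * c (-i) * u powr q - k * c i * u powr q)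
     - rho * (k * c i * u powr q) = k * u powr q * ((mu + sig * i) * q * c i + lambda * (c (-i) - c i) - rho * c i)"
    unfolding u[symmetric] by (simp add: algebra_simps)
  also have "(mu + sig * i) * q * c i + lambda * (c (-i) - c i) - rho * c i = 0"
    using assms(1) w_minus w_plus unfolding c_def by (auto simp: algebra_simps)
  finally show ?thesis by simp
qed

text \<open>The powers solve the equations exactly, so negation preserves the required inequality.
  This is the function behind the lower bound.\<close>

lemma power_supersolution:
  "supersolution mu sig lambda rho (\<lambda>i u. - ((if i = 1 then k * w else k) * u powr q))"
  unfolding supersolution_def
proof (intro conjI ballI exI[of _ "{}"] allI impI)
  fix i R :: real assume i: "i \<in> {-1, 1}"
  show "\<exists>L. L-lipschitz_on {0..R} (\<lambda>u. - ((if i = 1 then k * w else k) * u powr q))"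
    using powr_supersolution_lipschitz[OF q, of R "- (if i = 1 then k * w else k)"] by simp
next
  fix i u :: real assume i: "i \<in> {-1, 1}" and u: "0 < u"
  let ?c = "\<lambda>i :: real. if i = 1 then k * w else k"
  have "((\<lambda>u. - (?c i * u powr q)) has_real_derivative (- k) * (if i = 1 then w else 1) * (q * u powr (q - 1))) (at u)"
    using u by (auto intro!: derivative_eq_intros)
  moreover have "(mu + sig * i) * u * ((- k) * (if i = 1 then w else 1) * (q * u powr (q - 1)))
      + lambda * (- (?c (-i) * u powr q) - - (?c i * u powr q)) - rho * (- (?c i * u powr q)) \<le> 0"
    using i euler_power[OF i u, of "- k"] by (auto simp: algebra_simps)
  ultimately show "\<exists>D. ((\<lambda>u. - (?c i * u powr q)) has_real_derivative D) (at u) \<and>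
     (mu + sig * i) * u * D + lambda * (- (?c (-i) * u powr q) - - (?c i * u powr q)) - rho * (- (?c i * u powr q)) \<le> 0"
    by blast
qed (use q in simp_all)

end

text \<open>The free boundary \<open>U\<close> in state \<open>-1\<close>; in state \<open>1\<close> it is never optimal to stop.\<close>

locale free_boundary = euler_root +
  fixes a al be U :: real
  assumes a: "0 < a" "a < U"
    and al: "al * (lambda + rho - mu - sig) = lambda" "1 \<le> al" "al \<le> w"
    and be: "be * (lambda + rho) = lambda * a"
    and U: "w * (U - a) = al * U - be"
    and drift: "mu - sig + lambda * al - (lambda + rho) \<le> 0"
begin

text \<open>The coefficients \<open>al\<close> and \<open>be\<close> are those for which
  \<open>al * u - be\<close> solves the equation of state 1 with \<open>u - a\<close> in the other
  state. The two branches meet at \<open>U\<close> in state 1 by the equation for \<open>U\<close>,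
  in state -1 by the choice of the factor.\<close>

definition phi :: "real \<Rightarrow> real \<Rightarrow> real" where
  "phi i u = (if u \<le> U then (if i = 1 then w else 1) * (U - a) * (u / U) powr q
     else if i = 1 then al * u - be else u - a)"

lemma be_le: "be \<le> a"
proof -
  have "be * (lambda + rho) \<le> a * (lambda + rho)" unfolding be using a rho by (simp add: algebra_simps)
  then show ?thesis using lambda rho by simp
qed

text \<open>In state 1 both branches obey the same first-order equation with the same values at
  \<open>U\<close>, so their slopes agree: \<open>q * (w * (U - a)) = al * U\<close>. As
  \<open>al \<le> w\<close>, the slope of \<open>phi (-1)\<close> at \<open>U\<close> from the left
  is at most 1, the slope of the stopping reward.\<close>

lemma slope_le: "(U - a) * q \<le> U"
proof -
  have "(mu + sig) * (q * (w * (U - a))) = (lambda + rho) * (w * (U - a)) - lambda * (U - a)"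
  proof -
    have "(lambda + rho - (mu + sig) * q) * w * (U - a) = lambda * (U - a)" unfolding w_plus ..
    then show ?thesis by (simp add: algebra_simps)
  qed
  also have "\<dots> = (mu + sig) * (al * U)"
  proof -
    have "al * (lambda + rho - mu - sig) * U = lambda * U" unfolding al(1) ..
    then have "(mu + sig) * (al * U) = (lambda + rho) * (al * U) - lambda * U" by (simp add: algebra_simps)
    moreover have "(lambda + rho) * (w * (U - a)) = (lambda + rho) * (al * U) - lambda * a"
      unfolding U using be by (simp add: algebra_simps)
    ultimately show ?thesis by (simp add: algebra_simps)
  qed
  finally have "q * (w * (U - a)) = al * U" using mu by simp
  also have "\<dots> \<le> w * U" using al(3) a by (intro mult_right_mono) auto
  finally have "w * ((U - a) * q) \<le> w * U" by (simp add: mult_ac)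
  then show ?thesis using w_gt_1 by simp
qed

text \<open>The left side is affine in \<open>u\<close>, with slope controlled by
  \<open>drift\<close>. At \<open>U\<close> the equation valid from the left turns it into
  \<open>(mu - sig) * (U - (U - a) * q)\<close>, whose sign follows from \<open>mu < sig\<close> and
  \<open>slope_le\<close>. This is the generator inequality in state -1 above the boundary.\<close>

lemma stop_ineq:
  assumes "U \<le> u"
  shows "(mu - sig) * u + lambda * (al * u - be) - (lambda + rho) * (u - a) \<le> 0"
proof -
  have "(mu - sig) * u + lambda * (al * u - be) - (lambda + rho) * (u - a) =
     ((mu - sig) * U + lambda * (al * U - be) - (lambda + rho) * (U - a)) + (mu - sig + lambda * al - (lambda + rho)) * (u - U)"
    by (simp add: algebra_simps)
  also have "(mu - sig) * U + lambda * (al * U - be) - (lambda + rho) * (U - a) = (mu - sig) * (U - (U - a) * q)"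
  proof -
    have "lambda * (w * (U - a)) = (lambda + rho + (sig - mu) * q) * (U - a)" using w_minus by (simp flip: mult.assoc)
    then show ?thesis unfolding U[symmetric] by (simp add: algebra_simps)
  qed
  also have "\<dots> \<le> 0" using mu slope_le by (intro mult_nonpos_nonneg) auto
  also have "(mu - sig + lambda * al - (lambda + rho)) * (u - U) \<le> 0"
    using drift assms by (intro mult_nonpos_nonneg) auto
  finally show ?thesis by simp
qed

text \<open>Below \<open>U\<close> the tangent of the power at \<open>U\<close> passes through
  \<open>U - a\<close> with slope at most 1, so it lies above \<open>u - a\<close>; state 1 only
  adds the factor \<open>w > 1\<close>. Above \<open>U\<close> the bounds \<open>1 \<le> al\<close>
  and \<open>be \<le> a\<close> suffice.\<close>

lemma phi_ge:
  assumes "i \<in> {-1, 1}" "0 \<le> u"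
  shows "u - a \<le> phi i u"
proof (cases "u \<le> U")
  case True
  have p: "u - a \<le> (U - a) * (u / U) powr q"
  proof (cases "u = U")
    case False
    then have "1 + q * (u / U - 1) \<le> (u / U) powr q"
      using powr_gt_tangent[of "u / U" q] assms True a q by simp
    then have "(U - a) * (1 + q * (u / U - 1)) \<le> (U - a) * (u / U) powr q" using a by (intro mult_left_mono) auto
    moreover have "(U - a) * (1 + q * (u / U - 1)) = (U - a) - ((U - a) * q) * ((U - u) / U)"
      using a by (simp add: field_simps)
    moreover have "((U - a) * q) * ((U - u) / U) \<le> U * ((U - u) / U)"
      using slope_le True a by (intro mult_right_mono) auto
    moreover have "U * ((U - u) / U) = U - u" using a by simp
    ultimately show ?thesis by linarith
  qed (use a in simp)
  have "0 \<le> (U - a) * (u / U) powr q" using a by simp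
  then have "1 * ((U - a) * (u / U) powr q) \<le> w * ((U - a) * (u / U) powr q)"
    using w_gt_1 by (intro mult_right_mono) auto
  then show ?thesis using p True unfolding phi_def by (auto simp: mult.assoc)
next
  case False
  have "1 * u \<le> al * u" using al assms by (intro mult_right_mono) auto
  then show ?thesis using False be_le unfolding phi_def by auto
qed

lemma phi_power: "0 \<le> u \<Longrightarrow> u \<le> U \<Longrightarrow> phi i u = (U - a) / U powr q * (if i = 1 then w else 1) * u powr q"
  unfolding phi_def using a by (simp add: powr_divide)

lemma phi_supersolution: "supersolution mu sig lambda rho phi"
  unfolding supersolution_def
proof (intro conjI ballI exI[of _ "{U}"] allI impI)
  fix i R :: real assume i: "i \<in> {-1, 1}"
  show "phi i \<in> borel_measurable borel" unfolding phi_def by measurable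
  show "phi i 0 = 0" unfolding phi_def using a q by simp
  define f where "f u = (U - a) / U powr q * (if i = 1 then w else 1) * u powr q" for u
  define g where "g u = (if i = 1 then al * u - be else u - a)" for u
  obtain L1 where L1: "L1-lipschitz_on {0..U} f"
    unfolding f_def using powr_supersolution_lipschitz[OF q] by blast
  have L2: "al-lipschitz_on {U..\<bar>R\<bar> + U} g"
  proof (rule lipschitz_onI)
    fix u v
    have "dist (g u) (g v) = (if i = 1 then al else 1) * dist u v"
      unfolding g_def dist_real_def using al(2) abs_mult[of al "u - v"] by (simp add: right_diff_distrib)
    then show "dist (g u) (g v) \<le> al * dist u v" using al(2) by (simp add: mult_right_mono)
  qed (use al in simp)
  \<comment> \<open>In state 1 this is the equation that determines \<open>U\<close>.\<close>
  have fg: "f U = g U" unfolding f_def g_def using a U by (simp add: mult.commute)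
  have "(max L1 al)-lipschitz_on {0..\<bar>R\<bar> + U} (\<lambda>u. if u \<le> U then f u else g u)"
    by (rule lipschitz_on_concat[OF lipschitz_on_mono[OF L1] lipschitz_on_mono[OF L2] fg]) auto
  then have "(max L1 al)-lipschitz_on {0..R} (\<lambda>u. if u \<le> U then f u else g u)"
    by (rule lipschitz_on_mono) (use a in auto)
  then have "(max L1 al)-lipschitz_on {0..R} (phi i)"
    by (rule lipschitz_on_transform) (auto simp: f_def g_def phi_power, auto simp: phi_def)
  then show "\<exists>L. L-lipschitz_on {0..R} (phi i)" by blast
next
  fix i u :: real assume i: "i \<in> {-1, 1}" and u: "0 < u" "u \<notin> {U}"
  show "\<exists>D. (phi i has_real_derivative D) (at u) \<and>
     (mu + sig * i) * u * D + lambda * (phi (-i) u - phi i u) - rho * phi i u \<le> 0"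
  proof (cases "u < U")
    case True
    define k where "k = (U - a) / U powr q"
    have "((\<lambda>u. k * (if i = 1 then w else 1) * u powr q) has_real_derivative k * (if i = 1 then w else 1) * (q * u powr (q - 1))) (at u)"
      using u by (auto intro!: derivative_eq_intros)
    moreover have "eventually (\<lambda>v. v \<in> {0<..<U}) (nhds u)" using u True by (intro eventually_nhds_in_open) auto
    then have "eventually (\<lambda>v. phi i v = k * (if i = 1 then w else 1) * v powr q) (nhds u)"
      by eventually_elim (simp add: phi_power k_def)
    ultimately have "(phi i has_real_derivative k * (if i = 1 then w else 1) * (q * u powr (q - 1))) (at u)"
      by (subst DERIV_cong_ev[OF refl _ refl]) auto
    then show ?thesis using euler_power[OF i u(1), of k] True u
      by (intro exI[of _ "k * (if i = 1 then w else 1) * (q * u powr (q - 1))"]) (simp add: phi_power k_def)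
  next
    case False
    then have Uu: "U < u" using u by simp
    have ev: "eventually (\<lambda>v. v \<in> {U<..}) (nhds u)" using Uu by (intro eventually_nhds_in_open) auto
    have "((\<lambda>u. if i = 1 then al * u - be else u - a) has_real_derivative (if i = 1 then al else 1)) (at u)"
      using i by (auto intro!: derivative_eq_intros)
    moreover have "eventually (\<lambda>v. phi i v = (if i = 1 then al * v - be else v - a)) (nhds u)"
      using ev by eventually_elim (simp add: phi_def)
    ultimately have D: "(phi i has_real_derivative (if i = 1 then al else 1)) (at u)"
      by (subst DERIV_cong_ev[OF refl _ refl]) auto
    have vals: "phi 1 u = al * u - be" "phi (-1) u = u - a" using Uu unfolding phi_def by auto
    from i consider "i = -1" | "i = 1" by auto
    then show ?thesis
    proof cases
      case 1
      have "(mu + sig * i) * u * 1 + lambda * (phi (-i) u - phi i u) - rho * phi i u =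
          (mu - sig) * u + lambda * (al * u - be) - (lambda + rho) * (u - a)"
        unfolding 1 minus_minus vals by (simp add: algebra_simps)
      then show ?thesis using D stop_ineq[of u] Uu 1 by (intro exI[of _ 1]) simp
    next
      case 2
      have "al * (lambda + rho - mu - sig) * u = lambda * u" unfolding al(1) ..
      then have "(mu + sig) * u * al + lambda * (u - a - (al * u - be)) - rho * (al * u - be) = 0"
        using be by (simp add: algebra_simps)
      then show ?thesis using D vals 2 by (intro exI[of _ al]) simp
    qed
  qed
qed simp

end

subsection \<open>Asymptotics for large jump rates\<close>

locale limit_params =
  fixes mu sigma0 a rho :: real
  assumes mu: "0 < mu" and sigma0: "0 < sigma0" and a: "0 < a" and rho: "0 < rho"
    and growth: "mu + sigma0\<^sup>2 / 2 < rho"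
begin

abbreviation "sg \<equiv> \<lambda>l. sigma0 * sqrt l"
abbreviation "Om \<equiv> Omega_pm (-1) mu sigma0 rho"
abbreviation "Om0 \<equiv> Omega0 mu sigma0 rho"
abbreviation "u0 \<equiv> limit_threshold mu sigma0 a rho"
text \<open>\<open>wr\<close>, \<open>al\<close>, \<open>be\<close> and \<open>Ub\<close> solve
  \<open>w_minus\<close> and the equations of \<open>free_boundary\<close> in closed form. By
  \<open>w_plus\<close>, the reciprocal of \<open>wr l\<close> is \<open>omega_pm (-1)\<close> for
  large \<open>l\<close>.\<close>

definition "wr l = (l + rho + (sg l - mu) * Om l) / l"
definition "al l = l / (l + rho - mu - sg l)"
definition "be l = l * a / (l + rho)"
definition "Ub l = (wr l * a - be l) / (wr l - al l)"
definition "den l = 1 + rho * inverse l - mu * inverse l - sigma0 * inverse (sqrt l)"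

lemma inv_lim: "((\<lambda>l :: real. inverse l) \<longlongrightarrow> 0) at_top" "((\<lambda>l. inverse (sqrt l)) \<longlongrightarrow> 0) at_top"
  by (rule tendsto_inverse_0_at_top[OF filterlim_ident], rule tendsto_inverse_0_at_top[OF sqrt_at_top])

text \<open>\<open>growth\<close> is equivalent to \<open>(mu + sigma0\<^sup>2)\<^sup>2 < mu\<^sup>2
  + 2 * rho * sigma0\<^sup>2\<close>, hence to the root exceeding 1; this puts the limit threshold
  above \<open>a\<close>.\<close>

lemma Om0_gt_1: "1 < Om0"
proof -
  have "(mu + sigma0\<^sup>2)\<^sup>2 < mu\<^sup>2 + 2 * rho * sigma0\<^sup>2"
  proof -
    have "(2 * mu + sigma0\<^sup>2) * sigma0\<^sup>2 < (2 * rho) * sigma0\<^sup>2"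
      using growth sigma0 by (intro mult_strict_right_mono) auto
    then show ?thesis by (simp add: power2_eq_square algebra_simps)
  qed
  then have "mu + sigma0\<^sup>2 < sqrt (mu\<^sup>2 + 2 * rho * sigma0\<^sup>2)" by (rule real_less_rsqrt)
  then show ?thesis unfolding Omega0_def using sigma0 by (simp add: less_divide_eq)
qed

text \<open>The second fact is smooth fit of the limit value at \<open>u0\<close>; the third says
  that the tangent there meets the vertical axis at \<open>- a\<close>.\<close>

lemma u0: "a < u0" "(u0 - a) * Om0 = u0" "(u0 - a) * (Om0 - 1) = a"
proof -
  have "u0 - a = a / (Om0 - 1)" unfolding limit_threshold_def using Om0_gt_1 by (simp add: field_simps)
  then show "a < u0" "(u0 - a) * Om0 = u0" "(u0 - a) * (Om0 - 1) = a"
    unfolding limit_threshold_def using Om0_gt_1 a by (auto simp: field_simps)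
qed

text \<open>Numerator and denominator are of order \<open>l\<close>; after division by
  \<open>l\<close> both depend continuously on \<open>inverse l\<close>.\<close>

lemma Omega_pm_lim:
  "((\<lambda>l. Omega_pm e mu sigma0 rho l) \<longlongrightarrow> (mu + e * sqrt (mu\<^sup>2 + 2 * rho * sigma0\<^sup>2)) / (- sigma0\<^sup>2)) at_top"
proof -
  have "((\<lambda>l. ((1 + rho * inverse l) * mu + e * sqrt (mu\<^sup>2 + sigma0\<^sup>2 * (rho\<^sup>2 * inverse l + 2 * rho))) / (mu\<^sup>2 * inverse l - sigma0\<^sup>2))
     \<longlongrightarrow> ((1 + rho * 0) * mu + e * sqrt (mu\<^sup>2 + sigma0\<^sup>2 * (rho\<^sup>2 * 0 + 2 * rho))) / (mu\<^sup>2 * 0 - sigma0\<^sup>2)) at_top"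
    using sigma0 by (intro tendsto_intros inv_lim) auto
  moreover have "eventually (\<lambda>l. ((1 + rho * inverse l) * mu + e * sqrt (mu\<^sup>2 + sigma0\<^sup>2 * (rho\<^sup>2 * inverse l + 2 * rho))) / (mu\<^sup>2 * inverse l - sigma0\<^sup>2)
      = Omega_pm e mu sigma0 rho l) at_top"
    using eventually_gt_at_top[of 0]
  proof eventually_elim
    case (elim l)
    have "sqrt (l\<^sup>2 * mu\<^sup>2 + l * sigma0\<^sup>2 * (rho\<^sup>2 + 2 * l * rho)) = sqrt (l\<^sup>2 * (mu\<^sup>2 + sigma0\<^sup>2 * (rho\<^sup>2 * inverse l + 2 * rho)))"
      using elim by (simp add: field_simps power2_eq_square)
    also have "\<dots> = l * sqrt (mu\<^sup>2 + sigma0\<^sup>2 * (rho\<^sup>2 * inverse l + 2 * rho))"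
      using elim by (simp add: real_sqrt_mult)
    finally have "(l + rho) * mu + e * sqrt (l\<^sup>2 * mu\<^sup>2 + l * sigma0\<^sup>2 * (rho\<^sup>2 + 2 * l * rho)) =
       l * ((1 + rho * inverse l) * mu + e * sqrt (mu\<^sup>2 + sigma0\<^sup>2 * (rho\<^sup>2 * inverse l + 2 * rho)))"
      using elim by (simp add: distrib_left distrib_right)
    moreover have "mu\<^sup>2 - l * sigma0\<^sup>2 = l * (mu\<^sup>2 * inverse l - sigma0\<^sup>2)" using elim by (simp add: right_diff_distrib)
    ultimately show ?case unfolding Omega_pm_def using elim by simp
  qed
  ultimately show ?thesis by (simp add: mult_ac Lim_transform_eventually)
qed

lemma Om_lim: "(Om \<longlongrightarrow> Om0) at_top"
  using Omega_pm_lim[of "-1"] unfolding Omega0_def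
  by (simp add: minus_divide_left[symmetric] minus_divide_right[symmetric] diff_divide_distrib)

text \<open>\<open>Omega_pm\<close> stays bounded while its coefficient is of order
  \<open>1 / sqrt l\<close>.\<close>

lemma omega_pm_lim: "((\<lambda>l. omega_pm e mu sigma0 rho l) \<longlongrightarrow> 1) at_top"
proof -
  have "((\<lambda>l. 1 + rho * inverse l - (mu * inverse l + sigma0 * inverse (sqrt l)) * Omega_pm e mu sigma0 rho l)
     \<longlongrightarrow> 1 + rho * 0 - (mu * 0 + sigma0 * 0) * ((mu + e * sqrt (mu\<^sup>2 + 2 * rho * sigma0\<^sup>2)) / (- sigma0\<^sup>2))) at_top"
    by (intro tendsto_intros inv_lim Omega_pm_lim)
  moreover have "eventually (\<lambda>l. 1 + rho * inverse l - (mu * inverse l + sigma0 * inverse (sqrt l)) * Omega_pm e mu sigma0 rho l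
     = omega_pm e mu sigma0 rho l) at_top"
    using eventually_gt_at_top[of 0]
  proof eventually_elim
    case (elim l)
    have "sqrt l / l = inverse (sqrt l)" using elim by (simp add: field_simps)
    then have "(mu + sigma0 * sqrt l) / l = mu * inverse l + sigma0 * inverse (sqrt l)"
      by (simp add: distrib_right divide_inverse mult.assoc)
    then show ?case unfolding omega_pm_def by (simp add: divide_inverse)
  qed
  ultimately show ?thesis by (simp add: Lim_transform_eventually)
qed

section \<open>Expansions of the free boundary data to order \<open>1 / sqrt l\<close>\<close>

lemma den_lim: "(den \<longlongrightarrow> 1) at_top"
proof -
  have "(den \<longlongrightarrow> 1 + rho * 0 - mu * 0 - sigma0 * 0) at_top"
    unfolding den_def by (intro tendsto_intros inv_lim)
  then show ?thesis by simp
qed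

lemma den_eq:
  assumes "0 < l"
  shows "l + rho - mu - sg l = l * den l"
proof -
  define r where "r = sqrt l"
  have r: "r > 0" "l = r\<^sup>2" unfolding r_def using assms by auto
  show ?thesis unfolding den_def r_def[symmetric] unfolding r(2) using r(1)
    by (simp add: field_simps power2_eq_square)
qed

lemma wr_eq:
  assumes "0 < l"
  shows "sqrt l * (wr l - 1) = rho * inverse (sqrt l) + (sigma0 - mu * inverse (sqrt l)) * Om l"
proof -
  define r where "r = sqrt l"
  have r: "r > 0" "l = r\<^sup>2" unfolding r_def using assms by auto
  show ?thesis unfolding wr_def r_def[symmetric] unfolding r(2) using r(1)
    by (simp add: field_simps power2_eq_square)
qed

lemma al_eq:
  assumes "0 < l" "0 < den l"
  shows "sqrt l * (al l - 1) = ((mu - rho) * inverse (sqrt l) + sigma0) / den l"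
proof -
  define r where "r = sqrt l"
  have r: "r > 0" "l = r * r" unfolding r_def using assms by auto
  have "al l = 1 / den l" unfolding al_def den_eq[OF assms(1)] using assms by simp
  then have "r * (al l - 1) = (r - r * den l) / den l" using assms by (simp add: field_simps)
  also have "r - r * den l = (mu - rho) * inverse r + sigma0"
    unfolding den_def r_def[symmetric] unfolding r(2) using r(1) by (simp add: field_simps)
  finally show ?thesis unfolding r_def .
qed

lemma be_eq:
  assumes "0 < l"
  shows "sqrt l * (a - be l) = a * rho * inverse (sqrt l) / (1 + rho * inverse l)"
proof -
  define r where "r = sqrt l"
  have r: "r > 0" "l = r * r" unfolding r_def using assms by auto
  have "r * r + rho > 0" using r rho by (simp add: add_pos_pos)
  then show ?thesis unfolding be_def r_def[symmetric] unfolding r(2) using r(1) rho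
    by (simp add: field_simps)
qed

lemma wr_lim': "((\<lambda>l. sqrt l * (wr l - 1)) \<longlongrightarrow> sigma0 * Om0) at_top"
proof -
  have "((\<lambda>l. rho * inverse (sqrt l) + (sigma0 - mu * inverse (sqrt l)) * Om l) \<longlongrightarrow> rho * 0 + (sigma0 - mu * 0) * Om0) at_top"
    by (intro tendsto_intros inv_lim Om_lim)
  then show ?thesis
    by (rule Lim_transform_eventually[THEN tendsto_eq_rhs])
      (auto intro!: eventually_mono[OF eventually_gt_at_top[of 0]] simp: wr_eq)
qed

lemma den_pos: "eventually (\<lambda>l. 0 < den l) at_top"
  using order_tendstoD(1)[OF den_lim] by simp

lemma al_lim': "((\<lambda>l. sqrt l * (al l - 1)) \<longlongrightarrow> sigma0) at_top"
proof -
  have "((\<lambda>l. ((mu - rho) * inverse (sqrt l) + sigma0) / den l) \<longlongrightarrow> ((mu - rho) * 0 + sigma0) / 1) at_top"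
    by (intro tendsto_intros inv_lim den_lim) simp
  moreover have "eventually (\<lambda>l. ((mu - rho) * inverse (sqrt l) + sigma0) / den l = sqrt l * (al l - 1)) at_top"
    using eventually_gt_at_top[of 0] den_pos by eventually_elim (simp add: al_eq)
  ultimately show ?thesis by (simp add: Lim_transform_eventually)
qed

text \<open>\<open>a - be l\<close> is of order \<open>1 / l\<close>, smaller than
  \<open>wr l - 1\<close> and \<open>al l - 1\<close>, so it does not contribute to the limit of
  \<open>Ub\<close>.\<close>

lemma be_lim': "((\<lambda>l. sqrt l * (a - be l)) \<longlongrightarrow> 0) at_top"
proof -
  have "((\<lambda>l. a * rho * inverse (sqrt l) / (1 + rho * inverse l)) \<longlongrightarrow> a * rho * 0 / (1 + rho * 0)) at_top"
    by (intro tendsto_intros inv_lim) simp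
  moreover have "eventually (\<lambda>l. a * rho * inverse (sqrt l) / (1 + rho * inverse l) = sqrt l * (a - be l)) at_top"
    using eventually_gt_at_top[of 0] by eventually_elim (simp add: be_eq)
  ultimately show ?thesis by (simp add: Lim_transform_eventually)
qed

lemma lim_of_scaled:
  fixes f :: "real \<Rightarrow> real"
  assumes "((\<lambda>l. sqrt l * (f l - c)) \<longlongrightarrow> k) at_top"
  shows "(f \<longlongrightarrow> c) at_top"
proof -
  have "((\<lambda>l. c + inverse (sqrt l) * (sqrt l * (f l - c))) \<longlongrightarrow> c + 0 * k) at_top"
    by (intro tendsto_intros inv_lim assms)
  moreover have "eventually (\<lambda>l. c + inverse (sqrt l) * (sqrt l * (f l - c)) = f l) at_top"
    using eventually_gt_at_top[of 0]
  proof eventually_elim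
    case (elim l)
    then have "inverse (sqrt l) * sqrt l = 1" by simp
    then show ?case by (simp only: mult.assoc[symmetric]) simp
  qed
  ultimately show ?thesis by (simp add: Lim_transform_eventually)
qed

lemma wr_lim: "(wr \<longlongrightarrow> 1) at_top" by (rule lim_of_scaled[OF wr_lim'])
lemma al_lim: "(al \<longlongrightarrow> 1) at_top" by (rule lim_of_scaled[OF al_lim'])
lemma be_lim: "(be \<longlongrightarrow> a) at_top"
  by (rule lim_of_scaled[of _ _ "- 0"]) (use tendsto_minus[OF be_lim'] in \<open>simp add: algebra_simps\<close>)

text \<open>Numerator and denominator of \<open>Ub\<close> both vanish at rate
  \<open>1 / sqrt l\<close>; multiplied by \<open>sqrt l\<close> they tend to
  \<open>sigma0 * Om0 * a\<close> and \<open>sigma0 * (Om0 - 1)\<close>.\<close>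

lemma Ub_lim: "(Ub \<longlongrightarrow> u0) at_top"
proof -
  have "((\<lambda>l. (sqrt l * (wr l - 1) * a + sqrt l * (a - be l)) / (sqrt l * (wr l - 1) - sqrt l * (al l - 1)))
      \<longlongrightarrow> (sigma0 * Om0 * a + 0) / (sigma0 * Om0 - sigma0)) at_top"
    using Om0_gt_1 sigma0 by (intro tendsto_intros wr_lim' al_lim' be_lim') simp
  moreover have "eventually (\<lambda>l. (sqrt l * (wr l - 1) * a + sqrt l * (a - be l)) / (sqrt l * (wr l - 1) - sqrt l * (al l - 1)) = Ub l) at_top"
    using eventually_gt_at_top[of 0]
  proof eventually_elim
    case (elim l)
    have "sqrt l * (wr l - 1) * a + sqrt l * (a - be l) = sqrt l * (wr l * a - be l)"
      "sqrt l * (wr l - 1) - sqrt l * (al l - 1) = sqrt l * (wr l - al l)" by (simp_all add: algebra_simps)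
    then show ?case unfolding Ub_def using elim by simp
  qed
  moreover have "(sigma0 * Om0 * a + 0) / (sigma0 * Om0 - sigma0) = u0"
  proof -
    have "sigma0 * Om0 - sigma0 = sigma0 * (Om0 - 1)" by (simp add: algebra_simps)
    then show ?thesis unfolding limit_threshold_def using sigma0 by simp
  qed
  ultimately show ?thesis by (simp add: Lim_transform_eventually)
qed

text \<open>The left side is the product of the coefficients in \<open>w_plus\<close> and
  \<open>w_minus\<close>, so this is the solvability condition of the coupled system for powers.
  Expanded, it is the quadratic equation with leading coefficient \<open>d\<close> of which
  \<open>Om l\<close> is a root; \<open>mu < sg l\<close> makes \<open>d\<close> nonzero.\<close>

lemma Om_quadratic:
  assumes "0 < l" "mu < sg l"
  shows "(l + rho - mu * Om l)\<^sup>2 - (sg l)\<^sup>2 * (Om l)\<^sup>2 = l\<^sup>2"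
proof -
  define d where "d = mu\<^sup>2 - l * sigma0\<^sup>2"
  define P where "P = (l + rho) * mu"
  define Q where "Q = l\<^sup>2 * mu\<^sup>2 + l * sigma0\<^sup>2 * (rho\<^sup>2 + 2 * l * rho)"
  have sg2: "(sg l)\<^sup>2 = l * sigma0\<^sup>2" using assms(1) by (simp add: power_mult_distrib)
  have "mu\<^sup>2 < (sg l)\<^sup>2" using assms mu by (intro power_strict_mono) auto
  then have d: "d \<noteq> 0" unfolding d_def sg2 by simp
  have Q: "0 \<le> Q" unfolding Q_def using assms(1) rho by simp
  have "d * Om l = P - sqrt Q" unfolding Omega_pm_def d_def[symmetric] P_def Q_def using d by simp
  then have "(d * Om l - P)\<^sup>2 = Q" using Q by simp
  moreover have "P\<^sup>2 - Q = d * (rho\<^sup>2 + 2 * l * rho)"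
    unfolding P_def Q_def d_def by (simp add: power2_eq_square algebra_simps)
  ultimately have "d * (d * (Om l)\<^sup>2 - 2 * P * Om l + (rho\<^sup>2 + 2 * l * rho)) = 0"
    by (simp add: power2_eq_square algebra_simps)
  then have "d * (Om l)\<^sup>2 - 2 * P * Om l + (rho\<^sup>2 + 2 * l * rho) = 0" using d by simp
  then show ?thesis unfolding sg2 unfolding d_def P_def by (simp add: power2_eq_square algebra_simps)
qed

lemma eventually_free_boundary:
  "eventually (\<lambda>l. free_boundary mu (sg l) l rho (Om l) (wr l) a (al l) (be l) (Ub l)) at_top"
proof -
  have sg_top: "filterlim sg at_top at_top"
    by (rule filterlim_tendsto_pos_mult_at_top[OF tendsto_const sigma0 sqrt_at_top])
  \<comment> \<open>\<open>mu < sg l\<close> makes the price fall in state -1;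
    \<open>rho < sg l\<close> gives \<open>1 \<le> al l\<close>.\<close>
  have e1: "eventually (\<lambda>l. max mu rho < sg l) at_top"
    using sg_top unfolding filterlim_at_top_dense by blast
  have e2: "eventually (\<lambda>l. 1 < Om l) at_top" by (rule order_tendstoD(1)[OF Om_lim Om0_gt_1])
  have e3: "eventually (\<lambda>l. a < Ub l) at_top" by (rule order_tendstoD(1)[OF Ub_lim u0(1)])
  have e4: "eventually (\<lambda>l. 0 < sqrt l * (wr l - 1) - sqrt l * (al l - 1)) at_top"
    by (rule order_tendstoD(1)[OF tendsto_diff[OF wr_lim' al_lim']]) (use Om0_gt_1 sigma0 in simp)
  \<comment> \<open>This quantity is the left side of \<open>drift\<close> in expanded form; its
    limit \<open>2 * (mu - rho) + sigma0\<^sup>2\<close> is negative by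
    \<open>growth\<close>.\<close>
  have e5: "eventually (\<lambda>l. 2 * (mu - rho) + ((mu - rho) * inverse (sqrt l) + sigma0)\<^sup>2 / den l < 0) at_top"
  proof (rule order_tendstoD(2))
    show "((\<lambda>l. 2 * (mu - rho) + ((mu - rho) * inverse (sqrt l) + sigma0)\<^sup>2 / den l) \<longlongrightarrow> 2 * (mu - rho) + ((mu - rho) * 0 + sigma0)\<^sup>2 / 1) at_top"
      by (intro tendsto_intros inv_lim den_lim) simp
  qed (use growth in simp)
  show ?thesis
    using e1 e2 e3 e4 e5 den_pos eventually_gt_at_top[of 0]
  proof eventually_elim
    case (elim l)
    then have l: "0 < l" and sg: "mu < sg l" "rho < sg l" by auto
    have lw: "l * wr l = l + rho + (sg l - mu) * Om l" unfolding wr_def using l by simp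
    have den: "0 < l + rho - mu - sg l" unfolding den_eq[OF l] using l elim by simp
    show ?case
    proof
      show "(l + rho - (mu + sg l) * Om l) * wr l = l"
      proof -
        have "l * ((l + rho - (mu + sg l) * Om l) * wr l) = (l + rho - (mu + sg l) * Om l) * (l + rho + (sg l - mu) * Om l)"
          unfolding lw[symmetric] by simp
        also have "\<dots> = (l + rho - mu * Om l)\<^sup>2 - (sg l)\<^sup>2 * (Om l)\<^sup>2" by (simp add: power2_eq_square algebra_simps)
        also have "\<dots> = l * l" using Om_quadratic[OF l sg(1)] by (simp add: power2_eq_square)
        finally show ?thesis using l by simp
      qed
      show "al l * (l + rho - mu - sg l) = l" unfolding al_def using den by simp
      show "1 \<le> al l" unfolding al_def using den sg mu by (simp add: le_divide_eq)
      have "0 < sqrt l * (wr l - al l)" using elim by (simp add: algebra_simps)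
      then have wal: "al l < wr l" using l by (simp add: zero_less_mult_iff)
      then show "al l \<le> wr l" by simp
      show "be l * (l + rho) = l * a" unfolding be_def using l rho by simp
      have "Ub l * (wr l - al l) = wr l * a - be l" unfolding Ub_def using wal by simp
      then show "wr l * (Ub l - a) = al l * Ub l - be l" by (simp add: algebra_simps)
      \<comment> \<open>The terms of order \<open>l\<close> and \<open>sqrt l\<close> cancel: with
        \<open>l / den l = l + r * k + k\<^sup>2 / den l\<close> only the expression of
        \<open>e5\<close> is left.\<close>
      show "mu - sg l + l * al l - (l + rho) \<le> 0"
      proof -
        define r where "r = sqrt l"
        have r: "r > 0" "l = r * r" unfolding r_def using l by auto
        define k where "k = (mu - rho) * inverse r + sigma0"
        have rk: "r * k = mu - rho + sg l" unfolding k_def r_def[symmetric] using r by (simp add: distrib_left)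
        have ld: "r * (r * den l) = l - r * k" unfolding rk using den_eq[OF l] r by (simp add: mult.assoc)
        have rd: "den l = 1 - k / r"
        proof -
          have "r * (r * (den l - (1 - k / r))) = 0" using ld r by (simp add: right_diff_distrib)
          then show ?thesis using r by simp
        qed
        have "l * al l = l / den l" unfolding al_def den_eq[OF l] using l by simp
        moreover have "l / den l - l - r * k = k\<^sup>2 / den l"
        proof -
          have "l - (l + r * k) * den l = k\<^sup>2"
            unfolding rd unfolding r(2) using r by (simp add: field_simps power2_eq_square)
          then show ?thesis using elim(6) by (simp add: field_simps)
        qed
        ultimately have "mu - sg l + l * al l - (l + rho) = 2 * (mu - rho) + k\<^sup>2 / den l" using rk by simp
        then show ?thesis using elim(5) unfolding k_def r_def by simp
      qed
    qed (use l sg lw mu rho a elim in auto)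
  qed
qed

end

section \<open>Two-sided bounds for the value functions and their limits\<close>

locale limit_problem = limit_params +
  fixes M :: "real \<Rightarrow> real \<Rightarrow> 'w measure" and xi :: "real \<Rightarrow> real \<Rightarrow> real \<Rightarrow> 'w \<Rightarrow> real"
  assumes tele: "\<And>l s. 0 < l \<Longrightarrow> s \<in> {-1, 1} \<Longrightarrow> telegraph_process (M l s) l s (xi l s)"
begin

abbreviation "V \<equiv> \<lambda>l s y. value_function (M l s) (xi l s) mu (sg l) a rho y"

text \<open>This is \<open>phi\<close> of \<open>free_boundary\<close> written out, so that it makes
  sense for every \<open>l\<close>, not only for large ones.\<close>

definition upper :: "real \<Rightarrow> real \<Rightarrow> real \<Rightarrow> real" where
  "upper l s y = (if y \<le> Ub l then (if s = 1 then wr l else 1) * (Ub l - a) * (y / Ub l) powr Om l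
   else if s = 1 then al l * y - be l else y - a)"

text \<open>The power solution is scaled so that its state 1 component at \<open>u0\<close> is
  \<open>u0 - a\<close>; the other component is smaller by the factor \<open>wr l\<close>, so for
  large \<open>l\<close> both stay below the reward at that level, as
  \<open>value_function_ge\<close> requires.\<close>

definition lower :: "real \<Rightarrow> real \<Rightarrow> real \<Rightarrow> real" where
  "lower l s y = (if s = 1 then wr l else 1) * ((u0 - a) / wr l) * (y / u0) powr Om l"

lemma telegraph:
  assumes "0 < l" "s \<in> {-1, 1}" "0 \<le> y"
  shows "telegraph (M l s) l (xi l s) s mu (sg l) rho y"
proof -
  have "markov_chain (M l s) {-1, 1} (flip_generator l) (xi l s)" "AE \<omega> in M l s. xi l s 0 \<omega> = s"
    using tele[OF assms(1,2)] unfolding telegraph_process_def by auto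
  then show ?thesis
    using assms mu rho sigma0 by (simp add: telegraph_def telegraph_axioms_def)
qed

lemma V_ge_stopped: "0 < l \<Longrightarrow> s \<in> {-1, 1} \<Longrightarrow> 0 \<le> y \<Longrightarrow> ereal (y - a) \<le> V l s y"
  using telegraph.value_function_ge_stopped[OF telegraph] .

lemma V_le_upper: "eventually (\<lambda>l. \<forall>s\<in>{-1, 1}. \<forall>y\<ge>0. V l s y \<le> ereal (upper l s y)) at_top"
  using eventually_free_boundary eventually_gt_at_top[of 0]
proof eventually_elim
  case (elim l)
  interpret fb: free_boundary mu "sg l" l rho "Om l" "wr l" a "al l" "be l" "Ub l" by (rule elim(1))
  show ?case
  proof (intro ballI allI impI)
    fix s y :: real assume s: "s \<in> {-1, 1}" and y: "0 \<le> y"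
    have "V l s y \<le> ereal (fb.phi s y)"
      by (rule telegraph.value_function_le[OF telegraph[OF elim(2) s y] fb.phi_supersolution fb.mu(2) fb.phi_ge fb.a(1)])
    then show "V l s y \<le> ereal (upper l s y)" unfolding fb.phi_def upper_def .
  qed
qed

lemma V_ge_lower: "eventually (\<lambda>l. \<forall>s\<in>{-1, 1}. \<forall>y. 0 \<le> y \<longrightarrow> y < u0 \<longrightarrow> ereal (lower l s y) \<le> V l s y) at_top"
  using eventually_free_boundary eventually_gt_at_top[of 0]
proof eventually_elim
  case (elim l)
  interpret fb: free_boundary mu "sg l" l rho "Om l" "wr l" a "al l" "be l" "Ub l" by (rule elim(1))
  define k where "k = (u0 - a) / (wr l * u0 powr Om l)"
  define c where "c i = (if i = 1 then k * wr l else k)" for i :: real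
  have w: "1 < wr l" by (rule fb.w_gt_1)
  have k: "0 \<le> k" "k * u0 powr Om l = (u0 - a) / wr l"
    unfolding k_def using u0(1) a w by auto
  show ?case
  proof (intro ballI allI impI)
    fix s y :: real assume s: "s \<in> {-1, 1}" and y: "0 \<le> y" "y < u0"
    have "(u0 - a) / wr l \<le> u0 - a" using u0(1) w by (simp add: divide_le_eq mult_le_cancel_left1)
    moreover have "k * wr l * u0 powr Om l = wr l * (k * u0 powr Om l)" by (simp only: mult_ac)
    then have "k * wr l * u0 powr Om l = u0 - a" unfolding k(2) using w by simp
    ultimately have "0 \<le> c i \<and> c i * u0 powr Om l \<le> u0 - a" for i
      unfolding c_def using k w by (auto simp del: mult.assoc)
    then have "ereal (c s * y powr Om l) \<le> V l s y"
      by (intro telegraph.value_function_ge[OF telegraph[OF elim(2) s y(1)] _ fb.mu(2) _ _ a u0(1) y(2)])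
        (use fb.power_supersolution[of k] fb.q in \<open>simp_all add: c_def\<close>)
    moreover have "c s * y powr Om l = lower l s y"
      unfolding c_def lower_def k_def using y(1) u0(1) a by (simp add: powr_divide)
    ultimately show "ereal (lower l s y) \<le> V l s y" by simp
  qed
qed

lemma power_lim:
  assumes "0 \<le> y" "(f \<longlongrightarrow> u0) at_top"
  shows "((\<lambda>l. (y / f l) powr Om l) \<longlongrightarrow> (y / u0) powr Om0) at_top"
proof (cases "y = 0")
  case False
  then show ?thesis using assms u0(1) a by (intro tendsto_powr tendsto_divide tendsto_const Om_lim) auto
qed simp

lemma upper_lim:
  assumes s: "s \<in> {-1, 1}" and y: "0 \<le> y"
  shows "((\<lambda>l. upper l s y) \<longlongrightarrow> limit_value mu sigma0 a rho y) at_top"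
proof -
  define f where "f l = (if s = 1 then wr l else 1) * (Ub l - a) * (y / Ub l) powr Om l" for l
  define g where "g l = (if s = 1 then al l * y - be l else y - a)" for l
  have "((\<lambda>l. if s = 1 then wr l else 1) \<longlongrightarrow> 1) at_top" using wr_lim by (cases "s = 1") simp_all
  then have "(f \<longlongrightarrow> 1 * (u0 - a) * (y / u0) powr Om0) at_top"
    unfolding f_def by (intro tendsto_intros Ub_lim power_lim y)
  then have f: "(f \<longlongrightarrow> (u0 - a) * (y / u0) powr Om0) at_top" by simp
  have g: "(g \<longlongrightarrow> y - a) at_top"
  proof (cases "s = 1")
    case True
    have "((\<lambda>l. al l * y - be l) \<longlongrightarrow> 1 * y - a) at_top" by (intro tendsto_intros al_lim be_lim)
    then show ?thesis unfolding g_def using True by simp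
  qed (simp add: g_def[abs_def])
  have lv: "limit_value mu sigma0 a rho y = (if y \<le> u0 then (u0 - a) * (y / u0) powr Om0 else y - a)"
    unfolding limit_value_def by (simp add: Let_def)
  have "((\<lambda>l. if y \<le> Ub l then f l else g l) \<longlongrightarrow> limit_value mu sigma0 a rho y) at_top"
  proof (cases y u0 rule: linorder_cases)
    case less
    have "eventually (\<lambda>l. f l = (if y \<le> Ub l then f l else g l)) at_top"
      using order_tendstoD(1)[OF Ub_lim less] by eventually_elim simp
    then show ?thesis using f less lv by (simp add: Lim_transform_eventually)
  next
    case greater
    have "eventually (\<lambda>l. g l = (if y \<le> Ub l then f l else g l)) at_top"
      using order_tendstoD(2)[OF Ub_lim greater] by eventually_elim simp
    then show ?thesis using g greater lv by (simp add: Lim_transform_eventually)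
  next
    case equal
    \<comment> \<open>At \<open>y = u0\<close> the boundary \<open>Ub l\<close> may lie on either
      side for arbitrarily large \<open>l\<close>; both branches have the limit
      \<open>u0 - a\<close>.\<close>
    then have "(f \<longlongrightarrow> limit_value mu sigma0 a rho y) at_top" "(g \<longlongrightarrow> limit_value mu sigma0 a rho y) at_top"
      using f g lv u0(1) a by auto
    then show ?thesis by (intro filterlim_If tendsto_mono[OF inf_le1])
  qed
  then show ?thesis unfolding upper_def f_def g_def .
qed

lemma lower_lim:
  assumes s: "s \<in> {-1, 1}" and y: "0 \<le> y"
  shows "((\<lambda>l. lower l s y) \<longlongrightarrow> (u0 - a) * (y / u0) powr Om0) at_top"
proof -
  have "((\<lambda>l. if s = 1 then wr l else 1) \<longlongrightarrow> 1) at_top" using wr_lim by (cases "s = 1") simp_all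
  then have "((\<lambda>l. lower l s y) \<longlongrightarrow> 1 * ((u0 - a) / 1) * (y / u0) powr Om0) at_top"
    unfolding lower_def by (intro tendsto_intros wr_lim power_lim[OF y]) auto
  then show ?thesis by simp
qed

lemma value_lim:
  assumes s: "s \<in> {-1, 1}" and y: "0 \<le> y"
  shows "((\<lambda>l. V l s y) \<longlongrightarrow> ereal (limit_value mu sigma0 a rho y)) at_top"
proof -
  \<comment> \<open>From \<open>u0\<close> on, stopping at once already attains the limit
    value.\<close>
  define low where "low l = (if y < u0 then lower l s y else y - a)" for l
  have "(low \<longlongrightarrow> limit_value mu sigma0 a rho y) at_top"
  proof (cases "y < u0")
    case True
    then show ?thesis using lower_lim[OF s y] unfolding low_def limit_value_def by (simp add: Let_def)
  next
    case False
    then have "limit_value mu sigma0 a rho y = y - a"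
      using u0(1) a unfolding limit_value_def by (auto simp: Let_def)
    then show ?thesis using False unfolding low_def by simp
  qed
  then have lims: "((\<lambda>l. ereal (low l)) \<longlongrightarrow> ereal (limit_value mu sigma0 a rho y)) at_top"
    "((\<lambda>l. ereal (upper l s y)) \<longlongrightarrow> ereal (limit_value mu sigma0 a rho y)) at_top"
    using upper_lim[OF s y] by (simp_all add: lim_ereal)
  have ge: "eventually (\<lambda>l. ereal (low l) \<le> V l s y) at_top"
    using V_ge_lower eventually_gt_at_top[of 0]
  proof eventually_elim
    case (elim l)
    show ?case
      using elim(1)[rule_format, OF s y] V_ge_stopped[OF elim(2) s y] unfolding low_def by presburger
  qed
  have le: "eventually (\<lambda>l. V l s y \<le> ereal (upper l s y)) at_top"
    using V_le_upper
  proof eventually_elim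
    case (elim l)
    show ?case by (rule elim[rule_format, OF s y])
  qed
  show ?thesis by (rule tendsto_sandwich[OF ge le lims])
qed

text \<open>Pointwise convergence is too weak for the threshold, an infimum over \<open>y\<close>:
  the gap must hold for all \<open>y < c\<close> at once. The convex function
  \<open>lower l (-1)\<close> lies above its tangent at \<open>c\<close>, and this affine function
  beats \<open>y - a\<close> on \<open>[0, c]\<close> once it does so at both ends:
  \<open>c - a < B l\<close> at \<open>c\<close> and \<open>B l * (Om l - 1) < a\<close> at 0. Both
  inequalities are strict in the limit.\<close>

lemma V_gt_stopped_below:
  assumes c: "0 < c" "c < u0"
  shows "eventually (\<lambda>l. \<forall>y. 0 \<le> y \<longrightarrow> y < c \<longrightarrow> ereal (y - a) < V l (-1) y) at_top"
proof -
  \<comment> \<open>The value of \<open>lower l (-1)\<close> at \<open>c\<close>.\<close>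
  define B where "B l = (u0 - a) / wr l * (c / u0) powr Om l" for l
  have B_lim: "(B \<longlongrightarrow> (u0 - a) / 1 * (c / u0) powr Om0) at_top"
    unfolding B_def by (intro tendsto_intros wr_lim power_lim) (use c in auto)
  have tangent: "1 + Om0 * (c / u0 - 1) < (c / u0) powr Om0"
    using c Om0_gt_1 by (intro powr_gt_tangent) auto
  have "c - a = (u0 - a) * (1 + Om0 * (c / u0 - 1))"
  proof -
    have "(u0 - a) * (1 + Om0 * (c / u0 - 1)) = (u0 - a) + ((u0 - a) * Om0) * (c / u0 - 1)"
      by (simp only: distrib_left mult_1_right mult.assoc)
    also have "\<dots> = c - a" unfolding u0(2) using u0(1) a by (simp add: right_diff_distrib)
    finally show ?thesis by simp
  qed
  also have "\<dots> < (u0 - a) * (c / u0) powr Om0"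
    using tangent u0(1) by (intro mult_strict_left_mono) auto
  finally have "c - a < (u0 - a) / 1 * (c / u0) powr Om0" by simp
  then have e1: "eventually (\<lambda>l. c - a < B l) at_top" by (rule order_tendstoD(1)[OF B_lim])
  have "(c / u0) powr Om0 < 1 powr Om0" using c Om0_gt_1 by (intro powr_less_mono2) auto
  then have "(u0 - a) * (Om0 - 1) * (c / u0) powr Om0 < (u0 - a) * (Om0 - 1) * 1"
    using u0(1) Om0_gt_1 by (intro mult_strict_left_mono) auto
  then have "a * (c / u0) powr Om0 < a" unfolding u0(3) by simp
  have eq: "(u0 - a) / 1 * (c / u0) powr Om0 * (Om0 - 1) = (u0 - a) * (Om0 - 1) * (c / u0) powr Om0"
    by (simp only: div_by_1 mult_ac)
  have "(u0 - a) / 1 * (c / u0) powr Om0 * (Om0 - 1) < a" unfolding eq u0(3) by fact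
  then have e2: "eventually (\<lambda>l. B l * (Om l - 1) < a) at_top"
    by (rule order_tendstoD(2)[OF tendsto_mult[OF B_lim tendsto_diff[OF Om_lim tendsto_const]]])
  show ?thesis
    using V_ge_lower e1 e2 eventually_free_boundary
  proof eventually_elim
    case (elim l)
    interpret fb: free_boundary mu "sg l" l rho "Om l" "wr l" a "al l" "be l" "Ub l" by (rule elim(4))
    have B0: "0 \<le> B l" unfolding B_def using u0(1) fb.w_gt_1 by simp
    show ?case
    proof (intro allI impI)
      fix y assume y: "0 \<le> y" "y < c"
      define x where "x = y / c"
      have x: "0 \<le> x" "x < 1" "y = x * c" unfolding x_def using y c by auto
      have "1 + Om l * (x - 1) \<le> x powr Om l" using powr_gt_tangent[OF x(1,2) fb.q] by simp
      then have "B l * (1 + Om l * (x - 1)) \<le> B l * x powr Om l" using B0 by (intro mult_left_mono)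
      also have "B l * x powr Om l = lower l (-1) y"
      proof -
        have "y / u0 = (c / u0) * x" using x(3) by simp
        then have "(y / u0) powr Om l = (c / u0) powr Om l * x powr Om l" using c x by (simp only: powr_mult)
        then show ?thesis unfolding B_def lower_def by simp
      qed
      finally have "B l * (1 + Om l * (x - 1)) \<le> lower l (-1) y" .
      moreover have "y - a < B l * (1 + Om l * (x - 1))"
      proof -
        \<comment> \<open>The two endpoint inequalities are combined with weights
          \<open>1 - x\<close> and \<open>x\<close>.\<close>
        have "(1 - x) * (B l * (Om l - 1)) < (1 - x) * a" using elim(3) x by (intro mult_strict_left_mono) auto
        moreover have "x * (c - a) \<le> x * B l" using elim(2) x by (intro mult_left_mono) auto
        moreover have "B l * (1 + Om l * (x - 1)) = x * B l - (1 - x) * (B l * (Om l - 1))" by (simp add: algebra_simps)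
        ultimately show ?thesis unfolding x(3) by (simp add: algebra_simps)
      qed
      ultimately have "ereal (y - a) < ereal (lower l (-1) y)" by simp
      also have "\<dots> \<le> V l (-1) y" by (rule elim(1)[rule_format]) (use y c in simp_all)
      finally show "ereal (y - a) < V l (-1) y" .
    qed
  qed
qed

text \<open>From below, \<open>V_gt_stopped_below\<close> excludes stopping points under any given
  \<open>c < u0\<close>. From above, \<open>Ub l\<close> itself is a stopping point, since the upper
  bound there equals the reward of stopping at once.\<close>

lemma threshold_lim:
  "((\<lambda>l. threshold (M l (-1)) (xi l (-1)) mu (sg l) a rho) \<longlongrightarrow> ereal u0) at_top"
proof (rule order_tendstoI)
  fix x assume "x < ereal u0"
  then have "max x 0 < ereal u0" using u0(1) a by simp
  then obtain c where c: "max x 0 < ereal c" "ereal c < ereal u0" using ereal_dense2 by blast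
  then have c': "0 < c" "c < u0" "x < ereal c" by auto
  show "eventually (\<lambda>l. x < threshold (M l (-1)) (xi l (-1)) mu (sg l) a rho) at_top"
    using V_gt_stopped_below[OF c'(1,2)]
  proof eventually_elim
    case (elim l)
    have "ereal c \<le> threshold (M l (-1)) (xi l (-1)) mu (sg l) a rho"
      unfolding threshold_def
    proof (rule Inf_greatest)
      fix z assume "z \<in> ereal ` {y. 0 \<le> y \<and> V l (-1) y = ereal (y - a)}"
      then obtain y where y: "z = ereal y" "0 \<le> y" "V l (-1) y = ereal (y - a)" by auto
      have "\<not> y < c" using elim y by (metis less_irrefl)
      then show "ereal c \<le> z" using y by simp
    qed
    then show ?case using c'(3) by (rule less_le_trans[rotated])
  qed
next
  fix x assume "ereal u0 < x"
  moreover have "((\<lambda>l. ereal (Ub l)) \<longlongrightarrow> ereal u0) at_top" using Ub_lim by (simp add: lim_ereal)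
  ultimately have "eventually (\<lambda>l. ereal (Ub l) < x) at_top" by (rule order_tendstoD(2)[rotated])
  then show "eventually (\<lambda>l. threshold (M l (-1)) (xi l (-1)) mu (sg l) a rho < x) at_top"
    using V_le_upper eventually_free_boundary eventually_gt_at_top[of 0]
  proof eventually_elim
    case (elim l)
    interpret fb: free_boundary mu "sg l" l rho "Om l" "wr l" a "al l" "be l" "Ub l" by (rule elim(3))
    have U: "0 \<le> Ub l" using fb.a by simp
    have "V l (-1) (Ub l) \<le> ereal (upper l (-1) (Ub l))"
      using elim(2)[rule_format, of "-1" "Ub l"] U by simp
    also have "upper l (-1) (Ub l) = Ub l - a" unfolding upper_def using fb.a by simp
    finally have "V l (-1) (Ub l) = ereal (Ub l - a)"
      using V_ge_stopped[OF elim(4) _ U, of "-1"] by (intro antisym) auto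
    then have "threshold (M l (-1)) (xi l (-1)) mu (sg l) a rho \<le> ereal (Ub l)"
      unfolding threshold_def using U by (intro Inf_lower) auto
    then show ?case using elim(1) by (rule le_less_trans)
  qed
qed

end

theorem mainTheorem12:
  fixes mu sigma0 a rho :: real
    and M :: "real \<Rightarrow> real \<Rightarrow> 'w measure"
    and xi :: "real \<Rightarrow> real \<Rightarrow> real \<Rightarrow> 'w \<Rightarrow> real"
  assumes "mu > 0" and "sigma0 > 0" and "a > 0" and "rho > 0"
    and "rho > mu + sigma0\<^sup>2 / 2"
    and "\<And>lambda s. lambda > 0 \<Longrightarrow> s \<in> {-1, 1} \<Longrightarrow>
           telegraph_process (M lambda s) lambda s (xi lambda s)"
  shows "((\<lambda>lambda. Omega_pm (-1) mu sigma0 rho lambda) \<longlongrightarrow> Omega0 mu sigma0 rho) at_top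
    \<and> (\<forall>e\<in>{-1, 1}. ((\<lambda>lambda. omega_pm e mu sigma0 rho lambda) \<longlongrightarrow> 1) at_top)
    \<and> ((\<lambda>lambda. threshold (M lambda (-1)) (xi lambda (-1)) mu (sigma0 * sqrt lambda) a rho)
         \<longlongrightarrow> ereal (limit_threshold mu sigma0 a rho)) at_top
    \<and> (\<forall>y\<ge>0. \<forall>s\<in>{-1, 1}.
         ((\<lambda>lambda. value_function (M lambda s) (xi lambda s) mu (sigma0 * sqrt lambda) a rho y)
            \<longlongrightarrow> ereal (limit_value mu sigma0 a rho y)) at_top)"
proof -
  interpret limit_problem mu sigma0 a rho M xi
    by unfold_locales (use assms in auto)
  show ?thesis
    using Om_lim omega_pm_lim threshold_lim value_lim by blast
qed

end
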